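(* $\mathsf{AM}(2)=\mathsf{AM}$.
   Context: For a positive integer $k$, $\mathsf{AM}(k)$ is the class of languages $L\subseteq\{0,1\}^*$ for which there exist a polynomial $q$ and a probabilistic polynomial-time verifier $V$ such that for all inputs $x\in\{0,1\}^n$: if $x\in L$ there exist functions $b_1,\dots,b_k:\{0,1\}^{q(n)}\to\{0,1\}^{q(n)}$ (depending on $x$) with $\Pr[V(x,y_1,\dots,y_k,b_1(y_1),\dots,b_k(y_k))\text{ accepts}]\ge2/3$, where $y_1,\dots,y_k$ are independent uniformly random strings in $\{0,1\}^{q(n)}$; if $x\notin L$, then for all such functions this probability is at most $1/3$. (Each prover $i$ sees only its own challenge $y_i$.) $\mathsf{AM}=\mathsf{AM}(1)$ is the usual single-prover Arthur–Merlin class. *)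

theory Defs
  imports
    "HOL-Probability.Probability"
    "HOL-Computational_Algebra.Polynomial"
begin

section \<open>Probabilistic multitape Turing machines\<close>

datatype direction = Left | Stay | Right

text \<open>
  States and tape symbols are initial segments of the natural numbers; 0 is the start state
  and the blank symbol. In every step the machine tosses one fair coin, whose outcome is the
  last argument of the transition function (equivalently: there are two transition functions,
  chosen between uniformly at random). The transition function yields the next state and, for
  each tape, the symbol to be written and the head movement. Its values matter only
  on the finitely many arguments constrained by \<open>wf_ptm\<close> below.
\<close>

record ptm =
  num_tapes :: nat
  num_symbols :: nat
  num_states :: nat
  accept_state :: nat
  reject_state :: nat
  trans :: "nat \<Rightarrow> nat list \<Rightarrow> bool \<Rightarrow> nat \<times> (nat \<times> direction) list"

definition wf_ptm :: "ptm \<Rightarrow> bool" where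
  "wf_ptm M \<longleftrightarrow>
     num_tapes M \<ge> 1 \<and> num_symbols M \<ge> 4 \<and> num_states M \<ge> 1 \<and>
     accept_state M < num_states M \<and> reject_state M < num_states M \<and>
     accept_state M \<noteq> reject_state M \<and>
     (\<forall>s < num_states M. \<forall>reads coin.
        length reads = num_tapes M \<and> set reads \<subseteq> {..<num_symbols M} \<longrightarrow>
        (case trans M s reads coin of (s', acts) \<Rightarrow>
           s' < num_states M \<and> length acts = num_tapes M \<and>
           fst ` set acts \<subseteq> {..<num_symbols M}))"

text \<open>A two-way infinite tape together with the position of its head.\<close>

type_synonym tape = "(int \<Rightarrow> nat) \<times> int"

type_synonym config = "nat \<times> tape list"

fun move :: "direction \<Rightarrow> int \<Rightarrow> int" where
  "move Left i = i - 1"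
| "move Stay i = i"
| "move Right i = i + 1"

fun read_tape :: "tape \<Rightarrow> nat" where
  "read_tape (t, i) = t i"

fun act_tape :: "nat \<times> direction \<Rightarrow> tape \<Rightarrow> tape" where
  "act_tape (a, d) (t, i) = (t(i := a), move d i)"

definition halted :: "ptm \<Rightarrow> config \<Rightarrow> bool" where
  "halted M c \<longleftrightarrow> fst c \<in> {accept_state M, reject_state M}"

definition accepting :: "ptm \<Rightarrow> config \<Rightarrow> bool" where
  "accepting M c \<longleftrightarrow> fst c = accept_state M"

definition step :: "ptm \<Rightarrow> bool \<Rightarrow> config \<Rightarrow> config" where
  "step M coin c =
     (if halted M c then c
      else case trans M (fst c) (map read_tape (snd c)) coin of
             (s', acts) \<Rightarrow> (s', map2 act_tape acts (snd c)))"

definition run :: "ptm \<Rightarrow> bool list \<Rightarrow> config \<Rightarrow> config" where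
  "run M coins c = fold (step M) coins c"

text \<open>
  A tuple of bit strings is written on the input tape with symbol 1 for the bit 0, symbol 2 for
  the bit 1, and the separator 3 after each component.
\<close>

definition encode :: "bool list list \<Rightarrow> nat list" where
  "encode ws = concat (map (\<lambda>w. map (\<lambda>b. if b then 2 else 1) w @ [3]) ws)"

definition blank_tape :: tape where
  "blank_tape = (\<lambda>_. 0, 0)"

definition input_tape :: "nat list \<Rightarrow> tape" where
  "input_tape u = (\<lambda>i. if 0 \<le> i \<and> nat i < length u then u ! nat i else 0, 0)"

definition init :: "ptm \<Rightarrow> bool list list \<Rightarrow> config" where
  "init M ws = (0, input_tape (encode ws) # replicate (num_tapes M - 1) blank_tape)"

text \<open>
  \<open>M\<close> is a probabilistic machine taking \<open>m\<close> strings as arguments that halts within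
  \<open>p\<close> of the input length many steps, on every input and for all outcomes of its coins.
\<close>

definition poly_time_ptm :: "nat \<Rightarrow> nat poly \<Rightarrow> ptm \<Rightarrow> bool" where
  "poly_time_ptm m p M \<longleftrightarrow>
     wf_ptm M \<and>
     (\<forall>ws coins. length ws = m \<and> length coins = poly p (length (encode ws)) \<longrightarrow>
        halted M (run M coins (init M ws)))"

definition bitstrings :: "nat \<Rightarrow> bool list set" where
  "bitstrings n = {w. length w = n}"

text \<open>
  The random verdict of \<open>M\<close> on the tuple \<open>ws\<close>. Since halting configurations are
  never left, this does not depend on the choice of the time bound \<open>p\<close>.
\<close>

definition verdict :: "ptm \<Rightarrow> nat poly \<Rightarrow> bool list list \<Rightarrow> bool pmf" where
  "verdict M p ws =
     map_pmf (\<lambda>coins. accepting M (run M coins (init M ws)))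
       (pmf_of_set (bitstrings (poly p (length (encode ws)))))"


section \<open>Arthur--Merlin protocols with several provers\<close>

text \<open>
  \<open>b i\<close>, for \<open>i < k\<close>, is the strategy of the \<open>i\<close>-th prover, which sees only the
  \<open>i\<close>-th challenge. The probability is taken over the independent uniform challenges and
  the verifier's own coins; the latter are independent of the challenges.
\<close>

definition accept_prob ::
    "nat \<Rightarrow> nat poly \<Rightarrow> nat poly \<Rightarrow> ptm \<Rightarrow> bool list \<Rightarrow> (nat \<Rightarrow> bool list \<Rightarrow> bool list) \<Rightarrow> real" where
  "accept_prob k q p V x b =
     pmf (bind_pmf (replicate_pmf k (pmf_of_set (bitstrings (poly q (length x)))))
            (\<lambda>ys. verdict V p (x # ys @ map2 b [0..<k] ys))) True"

definition strategies :: "nat \<Rightarrow> nat \<Rightarrow> (nat \<Rightarrow> bool list \<Rightarrow> bool list) set" where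
  "strategies k m = {b. \<forall>i<k. b i \<in> bitstrings m \<rightarrow> bitstrings m}"

definition AM_provers :: "nat \<Rightarrow> bool list set set" where
  "AM_provers k =
     {L. \<exists>q p V. poly_time_ptm (2 * k + 1) p V \<and>
        (\<forall>x.
           (x \<in> L \<longrightarrow>
              (\<exists>b \<in> strategies k (poly q (length x)). accept_prob k q p V x b \<ge> 2 / 3)) \<and>
           (x \<notin> L \<longrightarrow>
              (\<forall>b \<in> strategies k (poly q (length x)). accept_prob k q p V x b \<le> 1 / 3)))}"

definition AM :: "bool list set set" where
  "AM = AM_provers 1"

end

theory Submission
  imports Defs
begin

text \<open>
  Given a two-prover verifier, Arthur sends \<open>M\<close> independent challenges meant for the first prover,
  \<open>N\<close> independent challenges meant for the second one and coins for each of the \<open>M N\<close> pairs, all in one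
  string to the single Merlin, who answers all of them; Arthur accepts if at least half of the \<open>M N\<close>
  runs of the original verifier accept. Completeness is the law of large numbers. For soundness
  Merlin may answer each challenge in the light of all others. Against fixed answers of the second
  prover on the sample, the best response of the first prover is, up to a small error, the best
  response to a sample of \<open>\<kappa>\<close> of these answers only, so few strategies matter: a union bound over
  the \<open>2 \<kappa>\<close> strings determining such a response, with \<open>N\<close> much larger than \<open>\<kappa>\<close> times the answer
  length, and then over all answer tuples of the second prover, with \<open>M\<close> much larger than
  \<open>N\<close> times the answer length, shows that the sampled game is not much easier than the original one.

  In both directions the coins of the simulated verifier are part of the challenge (the challenge of the
  ignored second prover in the converse direction), so the new verifiers are deterministic. They are written
  in a small language of while programs over finitely many tapes; loops run along unary counters, so
  their running time is polynomial irrespective of the contents of the other tapes.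
\<close>

section \<open>While programs on tapes\<close>

text \<open>Merlin sees all challenges and all coins, so soundness must hold uniformly: no choice of
  answers, adapted to the sample, may raise the score by much. A union bound over functions
  \<open>S \<rightarrow> S\<close> is out of reach, as these take up to \<open>l * 2 ^ l\<close>
  bits; best responses against \<open>\<kappa>\<close> sampled answers take only
  \<open>2 * l * \<kappa>\<close> bits. Each sample has to exceed the number of bits quantified over
  by a constant factor, which makes \<open>\<kappa>\<close>, \<open>N\<close> and \<open>M\<close>
  of order l, l squared and l cubed. Since Merlin knows the coins too, these are a third sample:
  \<open>M * N\<close> blocks against the \<open>l * (M + N)\<close> bits of all answers. Errors are
  measured by the expected largest deviation, because expectations add up; a single Markov
  inequality at the threshold 1/2, halfway between 1/3 and 2/3, concludes. On the machine side, the
  time bound concerns every tuple of strings, whatever the lengths of its components. The programs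
  are therefore specified on malformed challenges and answers as well, missing symbols being read as
  blanks.\<close>

type_synonym tapes = "nat \<Rightarrow> tape"

datatype prog =
    Act "(nat \<Rightarrow> nat) \<Rightarrow> nat \<Rightarrow> nat \<times> direction"
  | Then prog prog (infixr ";;" 60)
  | Loop "(nat \<Rightarrow> nat) \<Rightarrow> bool" prog

definition reads :: "tapes \<Rightarrow> nat \<Rightarrow> nat" where
  "reads \<tau> r = read_tape (\<tau> r)"

definition perform :: "((nat \<Rightarrow> nat) \<Rightarrow> nat \<Rightarrow> nat \<times> direction) \<Rightarrow> tapes \<Rightarrow> tapes" where
  "perform f \<tau> r = act_tape (f (reads \<tau>) r) (\<tau> r)"

text \<open>Small steps on a stack of programs still to be executed. Only the finitely many stacks in
  \<open>conts p []\<close> and the empty one are reachable from \<open>[p]\<close>; they are the states of the compiled machine.\<close>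

fun cstep :: "prog list \<times> tapes \<Rightarrow> prog list \<times> tapes" where
  "cstep ([], \<tau>) = ([], \<tau>)"
| "cstep (Act f # K, \<tau>) = (K, perform f \<tau>)"
| "cstep ((p ;; q) # K, \<tau>) = (p # q # K, \<tau>)"
| "cstep (Loop c p # K, \<tau>) = (if c (reads \<tau>) then p # Loop c p # K else K, \<tau>)"

fun conts :: "prog \<Rightarrow> prog list \<Rightarrow> prog list set" where
  "conts (Act f) K = {Act f # K}"
| "conts (p ;; q) K = insert ((p ;; q) # K) (conts p (q # K) \<union> conts q K)"
| "conts (Loop c p) K = insert (Loop c p # K) (conts p (Loop c p # K))"

lemma finite_conts [simp]: "finite (conts p K)"
  by (induction p arbitrary: K) auto

lemma conts_self [simp]: "p # K \<in> conts p K"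
  by (cases p) auto

lemma conts_closed: "s \<in> conts p K \<Longrightarrow> fst (cstep (s, \<tau>)) \<in> insert K (conts p K)"
proof (induction p arbitrary: K s)
  case (Then p q)
  have "q # K \<in> conts q K" by simp
  then show ?case using Then.IH(1)[of s "q # K"] Then.IH(2)[of s K] Then.prems by auto
next
  case (Loop c p)
  have "p # Loop c p # K \<in> conts p (Loop c p # K)" by simp
  then show ?case using Loop.IH[of s "Loop c p # K"] Loop.prems
    by (cases "s = Loop c p # K") auto
qed auto

definition wf_act :: "nat \<Rightarrow> nat \<Rightarrow> ((nat \<Rightarrow> nat) \<Rightarrow> nat \<Rightarrow> nat \<times> direction) \<Rightarrow> bool" where
  "wf_act k S f \<longleftrightarrow>
     (\<forall>\<rho>. (\<forall>r<k. \<rho> r < S) \<longrightarrow> (\<forall>r<k. fst (f \<rho> r) < S)) \<and>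
     (\<forall>\<rho> r. r \<ge> k \<longrightarrow> f \<rho> r = (\<rho> r, Stay))"

fun wf_prog :: "nat \<Rightarrow> nat \<Rightarrow> prog \<Rightarrow> bool" where
  "wf_prog k S (Act f) \<longleftrightarrow> wf_act k S f"
| "wf_prog k S (p ;; q) \<longleftrightarrow> wf_prog k S p \<and> wf_prog k S q"
| "wf_prog k S (Loop c p) \<longleftrightarrow> wf_prog k S p"

lemma conts_wf: "Act f # K' \<in> conts p K \<Longrightarrow> wf_prog k S p \<Longrightarrow> wf_act k S f"
  by (induction p arbitrary: K) auto

definition init_tapes :: "bool list list \<Rightarrow> tapes" where
  "init_tapes ws = (\<lambda>r. if r = 0 then input_tape (encode ws) else blank_tape)"

lemma act_tape_stay [simp]: "act_tape (read_tape T, d) T = (fst T, move d (snd T))"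
  by (cases T) auto

lemma run_halted: "halted M c \<Longrightarrow> run M coins c = c"
  unfolding run_def by (induction coins arbitrary: c) (auto simp: step_def)

text \<open>Machines start in state 0, so the initial stack has to receive this number.\<close>

lemma finite_numbering:
  assumes "finite Q" "a \<in> Q"
  shows "\<exists>e. bij_betw e Q {..<card Q} \<and> e a = (0::nat)"
proof -
  obtain e where e: "bij_betw e Q {0..<card Q}"
    using ex_bij_betw_finite_nat[OF assms(1)] by blast
  have c: "0 < card Q" using assms by (auto simp: card_gt_0_iff)
  have ea: "e a < card Q" using e assms(2) by (auto simp: bij_betw_def)
  have "bij_betw (Transposition.transpose (e a) 0) {..<card Q} {..<card Q}"
    using c ea by (auto simp: bij_betw_def inj_on_def Transposition.transpose_def image_def
        split: if_splits) 
  then have "bij_betw (Transposition.transpose (e a) 0 \<circ> e) Q {..<card Q}"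
    using e by (auto intro: bij_betw_trans simp: lessThan_atLeast0)
  then show ?thesis by (intro exI[of _ "Transposition.transpose (e a) 0 \<circ> e"]) auto
qed

text \<open>The finite control holds the stack of pending programs; the coins are ignored. One
  further step leads from the empty stack to the accepting or the rejecting state according to
  \<open>g\<close>, which is why \<open>length coins\<close> has to exceed \<open>n\<close>.\<close>

lemma compile:
  assumes wf: "wf_prog k S p" and k: "k \<ge> 1" and S: "S \<ge> 4"
  shows "\<exists>M. wf_ptm M \<and>
    (\<forall>ws coins n \<tau>'. (cstep ^^ n) ([p], init_tapes ws) = ([], \<tau>') \<and> length coins > n \<longrightarrow>
       halted M (run M coins (init M ws)) \<and>
       (accepting M (run M coins (init M ws)) \<longleftrightarrow> g (reads \<tau>')))"
proof -
  define Q where "Q = insert [] (conts p [])"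
  have finQ: "finite Q" and pQ: "[p] \<in> Q" by (auto simp: Q_def)
  have closed: "fst (cstep (s, \<tau>)) \<in> Q" if "s \<in> Q" for s \<tau>
    using that conts_closed[of s p "[]" \<tau>] by (auto simp: Q_def)
  define N where "N = card Q"
  obtain e where e: "bij_betw e Q {..<N}" and e0: "e [p] = 0"
    using finite_numbering[OF finQ pQ] N_def by blast
  have inv: "inv_into Q e (e s) = s" if "s \<in> Q" for s
    using e that by (auto simp: bij_betw_def)
  have eN: "e s < N" if "s \<in> Q" for s using e that by (auto simp: bij_betw_def)
  have invQ: "inv_into Q e i \<in> Q" if "i < N" for i
    using e that by (metis bij_betw_imp_surj_on inv_into_into lessThan_iff)
  \<comment> \<open>Tapes from \<open>k\<close> on stay blank throughout, so the default 0, the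
    blank symbol, agrees with \<open>reads\<close>.\<close>
  define \<rho>of :: "nat list \<Rightarrow> nat \<Rightarrow> nat" where "\<rho>of = (\<lambda>rs r. if r < k then rs ! r else 0)"
  define keep :: "(nat \<Rightarrow> nat) \<Rightarrow> (nat \<times> direction) list"
    where "keep = (\<lambda>\<rho>. map (\<lambda>r. (\<rho> r, Stay)) [0..<k])"
  define M where "M = \<lparr>num_tapes = k, num_symbols = S, num_states = N + 2,
     accept_state = N, reject_state = N + 1,
     trans = (\<lambda>s rs coin. let \<rho> = \<rho>of rs in
       if s \<ge> N then (s, keep \<rho>) else
       (case inv_into Q e s of
          [] \<Rightarrow> (if g \<rho> then N else N + 1, keep \<rho>)
        | Act f # K \<Rightarrow> (e K, map (f \<rho>) [0..<k])
        | (a ;; b) # K \<Rightarrow> (e (a # b # K), keep \<rho>)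
        | Loop c a # K \<Rightarrow> (e (if c \<rho> then a # Loop c a # K else K), keep \<rho>)))\<rparr>"
  have M: "num_tapes M = k" "num_symbols M = S" "num_states M = N + 2"
     "accept_state M = N" "reject_state M = N + 1" by (simp_all add: M_def)
  have wfM: "wf_ptm M"
  proof -
    have "(case trans M s rs coin of (s', acts) \<Rightarrow>
           s' < N + 2 \<and> length acts = k \<and> fst ` set acts \<subseteq> {..<S})"
      if s: "s < N + 2" and rs: "length rs = k" "set rs \<subseteq> {..<S}" for s rs coin
    proof -
      have r: "\<rho>of rs r < S" if "r < k" for r
        using that rs by (auto simp: \<rho>of_def subset_iff)
      have keep: "length (keep (\<rho>of rs)) = k" "fst ` set (keep (\<rho>of rs)) \<subseteq> {..<S}"
        using r by (auto simp: keep_def)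
      show ?thesis
      proof (cases "s < N")
        case True
        define u where "u = inv_into Q e s"
        have u: "u \<in> Q" using True invQ u_def by auto
        have eu: "e (fst (cstep (u, \<tau>))) < N + 2" for \<tau> using eN[OF closed[OF u, of \<tau>]] by simp
        show ?thesis
        proof (cases u)
          case Nil
          then show ?thesis using True keep unfolding M_def u_def by (simp add: Let_def)
        next
          case (Cons a K)
          show ?thesis
          proof (cases a)
            case (Act f)
            have "wf_act k S f" using u wf Cons Act conts_wf[of f K p "[]"] by (auto simp: Q_def)
            then have "fst ` set (map (f (\<rho>of rs)) [0..<k]) \<subseteq> {..<S}"
              using r by (auto simp: wf_act_def)
            then show ?thesis using True Cons Act eu unfolding M_def u_def
              by (simp add: Let_def)
          next
            case (Then a1 b1)
            then show ?thesis using True Cons keep eu unfolding M_def u_def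
              by (simp add: Let_def)
          next
            case (Loop c b1)
            \<comment> \<open>\<open>closed\<close> speaks of tapes; constant tapes showing the
              symbols of \<open>rs\<close> realise the given reads.\<close>
            have "e (b1 # Loop c b1 # K) < N + 2" if "c (\<rho>of rs)"
              using eu[of "\<lambda>r. (\<lambda>_. \<rho>of rs r, 0)"] that Cons Loop by (simp add: reads_def[abs_def])
            moreover have "e K < N + 2" if "\<not> c (\<rho>of rs)"
              using eu[of "\<lambda>r. (\<lambda>_. \<rho>of rs r, 0)"] that Cons Loop by (simp add: reads_def[abs_def])
            ultimately show ?thesis using True Cons Loop keep unfolding M_def u_def
              by (simp add: Let_def)
          qed
        qed
      qed (use s keep in \<open>simp add: M_def Let_def\<close>)
    qed
    then show ?thesis unfolding wf_ptm_def M using k S by auto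
  qed
  have rho: "\<rho>of (map read_tape (map \<tau> [0..<k])) = reads \<tau>" if "\<forall>r\<ge>k. \<tau> r = blank_tape" for \<tau>
    using that by (auto simp: \<rho>of_def reads_def blank_tape_def fun_eq_iff)
  have keep: "map2 act_tape (keep (reads \<tau>)) (map \<tau> [0..<k]) = map \<tau> [0..<k]" for \<tau>
    by (rule nth_equalityI) (auto simp: keep_def reads_def)
  have step: "step M coin (e s, map \<tau> [0..<k]) = (e s', map \<tau>' [0..<k]) \<and> s' \<in> Q \<and>
        (\<forall>r\<ge>k. \<tau>' r = blank_tape)"
    if s: "s \<in> Q" "s \<noteq> []" and b: "\<forall>r\<ge>k. \<tau> r = blank_tape" and c: "cstep (s, \<tau>) = (s', \<tau>')"
    for s \<tau> s' \<tau>' coin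
  proof -
    have nh: "\<not> halted M (e s, map \<tau> [0..<k])" using eN[OF s(1)] by (simp add: halted_def M)
    have s'Q: "s' \<in> Q" using closed[OF s(1), of \<tau>] c by simp
    obtain a K where aK: "s = a # K" using s(2) by (cases s) auto
    show ?thesis
    proof (cases a)
      case (Act f)
      have "wf_act k S f" using s(1) wf aK Act conts_wf[of f K p "[]"] by (auto simp: Q_def)
      then have "\<forall>r\<ge>k. \<tau>' r = blank_tape" using c aK Act b
        by (auto simp: perform_def wf_act_def reads_def blank_tape_def)
      moreover have "map2 act_tape (map (f (reads \<tau>)) [0..<k]) (map \<tau> [0..<k]) = map \<tau>' [0..<k]"
        using c aK Act by (intro nth_equalityI) (auto simp: perform_def)
      moreover have "trans M (e s) (map read_tape (map \<tau> [0..<k])) coin = (e s', map (f (reads \<tau>)) [0..<k])"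
        using c aK Act rho[OF b] inv[OF s(1)] eN[OF s(1)] by (simp add: M_def Let_def)
      ultimately show ?thesis using s'Q nh by (simp add: step_def)
    next
      case (Then p q)
      have "trans M (e s) (map read_tape (map \<tau> [0..<k])) coin = (e s', keep (reads \<tau>))"
        using c aK Then rho[OF b] inv[OF s(1)] eN[OF s(1)] by (auto simp add: M_def Let_def)
      then show ?thesis using s'Q nh c aK Then keep b by (auto simp: step_def)
    next
      case (Loop d q)
      have "trans M (e s) (map read_tape (map \<tau> [0..<k])) coin = (e s', keep (reads \<tau>))"
        using c aK Loop rho[OF b] inv[OF s(1)] eN[OF s(1)] by (auto simp add: M_def Let_def)
      then show ?thesis using s'Q nh c aK Loop keep b by (auto simp: step_def)
    qed
  qed
  have fin: "fst (run M coins (e s, map \<tau> [0..<k])) = (if g (reads \<tau>') then N else N + 1)"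
    if "(cstep ^^ n) (s, \<tau>) = ([], \<tau>')" "length coins > n" "s \<in> Q" "\<forall>r\<ge>k. \<tau> r = blank_tape"
    for n coins s \<tau> \<tau>'
    using that
  proof (induction n arbitrary: coins s \<tau>)
    case 0
    show ?case
    proof (cases coins)
      case Nil
      then show ?thesis using 0 by simp
    next
      case (Cons a as)
      have sn: "s = []" "\<tau> = \<tau>'" using 0 by auto
      let ?h = "(if g (reads \<tau>) then N else N + 1, map \<tau> [0..<k])"
      have "trans M (e s) (map read_tape (map \<tau> [0..<k])) a =
          (if g (reads \<tau>) then N else N + 1, keep (reads \<tau>))"
        using sn rho[OF 0(4)] inv[OF 0(3)] eN[OF 0(3)] by (simp add: M_def Let_def)
      moreover have "\<not> halted M (e s, map \<tau> [0..<k])"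
        using eN[OF 0(3)] by (simp add: halted_def M)
      ultimately have "step M a (e s, map \<tau> [0..<k]) = ?h"
        using keep[of \<tau>] by (simp add: step_def)
      then have "run M coins (e s, map \<tau> [0..<k]) = run M as ?h"
        unfolding Cons run_def by simp
      also have "\<dots> = ?h" by (rule run_halted) (simp add: halted_def M)
      finally show ?thesis using sn by simp
    qed
  next
    case (Suc n)
    show ?case
    proof (cases "s = []")
      case True
      have "(cstep ^^ m) ([], \<tau>) = ([], \<tau>)" for m by (induction m) auto
      then show ?thesis using Suc.IH[of s \<tau> coins] Suc.prems True
        by (metis Suc_lessD)
    next
      case False
      obtain s' \<tau>1 where c: "cstep (s, \<tau>) = (s', \<tau>1)" by force
      obtain a as where coins: "coins = a # as" using Suc.prems by (cases coins) auto
      have cn: "(cstep ^^ n) (s', \<tau>1) = ([], \<tau>')"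
        using Suc.prems(1) c by (simp add: funpow_Suc_right del: funpow.simps)
      note st = step[OF Suc.prems(3) False Suc.prems(4) c, of a]
      have "fst (run M as (e s', map \<tau>1 [0..<k])) = (if g (reads \<tau>') then N else N + 1)"
        using Suc.IH[OF cn, of as] Suc.prems(2) coins st by simp
      moreover have "run M coins (e s, map \<tau> [0..<k]) = run M as (e s', map \<tau>1 [0..<k])"
        using conjunct1[OF st] unfolding coins run_def by simp
      ultimately show ?thesis by simp
    qed
  qed
  have init: "init M ws = (e [p], map (init_tapes ws) [0..<k])" for ws
  proof -
    have "[0..<k] = 0 # [1..<k]" using k by (simp add: upt_conv_Cons)
    moreover have "map (init_tapes ws) [1..<k] = replicate (k - 1) blank_tape"
      by (rule nth_equalityI) (auto simp: init_tapes_def)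
    ultimately show ?thesis by (simp add: init_def e0 M init_tapes_def)
  qed
  have bl: "\<forall>r\<ge>k. init_tapes ws r = blank_tape" for ws using k by (auto simp: init_tapes_def)
  have "halted M (run M coins (init M ws)) \<and>
       (accepting M (run M coins (init M ws)) \<longleftrightarrow> g (reads \<tau>'))"
    if "(cstep ^^ n) ([p], init_tapes ws) = ([], \<tau>')" "length coins > n" for ws coins n \<tau>'
    using fin[OF that pQ bl]
    by (cases "g (reads \<tau>')") (simp_all add: init halted_def accepting_def M)
  then show ?thesis using wfM by blast
qed

text \<open>The running time if no loop makes more than \<open>B\<close> iterations.\<close>

fun tm :: "nat \<Rightarrow> prog \<Rightarrow> nat" where
  "tm B (Act f) = 1"
| "tm B (p ;; q) = 1 + tm B p + tm B q"
| "tm B (Loop c p) = 1 + B * (1 + tm B p)"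

lemma tm_poly: "\<exists>P. \<forall>B. tm B p = poly P B"
proof (induction p)
  case (Act f)
  show ?case by (intro exI[of _ 1]) auto
next
  case (Then p q)
  then obtain P Q where "\<forall>B. tm B p = poly P B" "\<forall>B. tm B q = poly Q B" by blast
  then show ?case by (intro exI[of _ "1 + P + Q"]) auto
next
  case (Loop c p)
  then obtain P where "\<forall>B. tm B p = poly P B" by blast
  then show ?case by (intro exI[of _ "1 + [:0,1:] * (1 + P)"]) auto
qed

text \<open>Total correctness including the running time. The bound \<open>tm B p\<close> does not
  depend on the tapes, and demanding the same run for every continuation \<open>K\<close> lets runs
  be chained in \<open>wp_Then\<close> and \<open>wp_Loop\<close>.\<close>

definition wp :: "nat \<Rightarrow> prog \<Rightarrow> (tapes \<Rightarrow> bool) \<Rightarrow> tapes \<Rightarrow> bool" where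
  "wp B p Q \<tau> \<longleftrightarrow>
     (\<exists>n \<tau>'. n \<le> tm B p \<and> (\<forall>K. (cstep ^^ n) (p # K, \<tau>) = (K, \<tau>')) \<and> Q \<tau>')"

lemma wp_mono: "wp B p P \<tau> \<Longrightarrow> (\<And>\<tau>'. P \<tau>' \<Longrightarrow> Q \<tau>') \<Longrightarrow> wp B p Q \<tau>"
  by (auto simp: wp_def)

lemma wp_Act: "Q (perform f \<tau>) \<Longrightarrow> wp B (Act f) Q \<tau>"
  unfolding wp_def by (intro exI[of _ 1] exI[of _ "perform f \<tau>"]) auto

lemma wp_Then:
  assumes "wp B p (wp B q Q) \<tau>"
  shows "wp B (p ;; q) Q \<tau>"
proof -
  obtain n \<tau>1 m \<tau>2 where n: "n \<le> tm B p" "\<And>K. (cstep ^^ n) (p # K, \<tau>) = (K, \<tau>1)"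
    and m: "m \<le> tm B q" "\<And>K. (cstep ^^ m) (q # K, \<tau>1) = (K, \<tau>2)" "Q \<tau>2"
    using assms unfolding wp_def by blast
  have "(cstep ^^ (m + n + 1)) ((p ;; q) # K, \<tau>) = (K, \<tau>2)" for K
    unfolding funpow_add by (simp add: n m)
  then show ?thesis unfolding wp_def using n(1) m(1,3)
    by (intro exI[of _ "m + n + 1"] exI[of _ \<tau>2]) auto
qed

text \<open>The number \<open>m\<close> of iterations is fixed in advance, so one invariant yields
  termination, time bound and postcondition; the induction runs over the iterations still to
  come.\<close>

lemma wp_Loop:
  assumes "m \<le> B" "I 0 \<tau>"
    and body: "\<And>i \<tau>. i < m \<Longrightarrow> I i \<tau> \<Longrightarrow> c (reads \<tau>) \<and> wp B p (I (Suc i)) \<tau>"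
    and exit: "\<And>\<tau>. I m \<tau> \<Longrightarrow> \<not> c (reads \<tau>) \<and> Q \<tau>"
  shows "wp B (Loop c p) Q \<tau>"
proof -
  have "\<exists>n \<tau>'. n \<le> 1 + k * (1 + tm B p) \<and>
      (\<forall>K. (cstep ^^ n) (Loop c p # K, \<tau>) = (K, \<tau>')) \<and> Q \<tau>'" if "k \<le> m" "I (m - k) \<tau>" for k \<tau>
    using that
  proof (induction k arbitrary: \<tau>)
    case 0
    then show ?case using exit[of \<tau>] by (intro exI[of _ 1] exI[of _ \<tau>]) auto
  next
    case (Suc k)
    have c: "c (reads \<tau>)" and w: "wp B p (I (m - k)) \<tau>"
      using body[of "m - Suc k" \<tau>] Suc.prems by (auto simp: Suc_diff_Suc)
    obtain n1 \<tau>1 where n1: "n1 \<le> tm B p" "\<And>K. (cstep ^^ n1) (p # K, \<tau>) = (K, \<tau>1)"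
      "I (m - k) \<tau>1" using w unfolding wp_def by blast
    obtain n2 \<tau>2 where n2: "n2 \<le> 1 + k * (1 + tm B p)"
      "\<And>K. (cstep ^^ n2) (Loop c p # K, \<tau>1) = (K, \<tau>2)" "Q \<tau>2"
      using Suc.IH[of \<tau>1] n1 Suc.prems by auto
    have "(cstep ^^ (n2 + n1 + 1)) (Loop c p # K, \<tau>) = (K, \<tau>2)" for K
      unfolding funpow_add by (simp add: n1 n2 c)
    then show ?case using n1(1) n2(1,3)
      by (intro exI[of _ "n2 + n1 + 1"] exI[of _ \<tau>2]) auto
  qed
  from this[of m \<tau>] obtain n \<tau>' where n: "n \<le> 1 + m * (1 + tm B p)"
    "\<forall>K. (cstep ^^ n) (Loop c p # K, \<tau>) = (K, \<tau>')" "Q \<tau>'" using assms(2) by auto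
  have "m * (1 + tm B p) \<le> B * (1 + tm B p)" using assms(1) by (intro mult_right_mono) auto
  then show ?thesis unfolding wp_def using n by (intro exI[of _ n] exI[of _ \<tau>']) auto
qed

lemma in_bitstrings: "w \<in> bitstrings n \<longleftrightarrow> length w = n"
  by (simp add: bitstrings_def)

lemma finite_bitstrings [simp]: "finite (bitstrings n)"
  using finite_lists_length_eq[of "UNIV :: bool set" n] by (simp add: bitstrings_def)

lemma bitstrings_nonempty [simp]: "bitstrings n \<noteq> {}"
proof -
  have "replicate n False \<in> bitstrings n" by (simp add: bitstrings_def)
  then show ?thesis by blast
qed

lemma deterministic_ptm:
  assumes wf: "wf_prog k S p" "k \<ge> 1" "S \<ge> 4"
    and p: "\<And>ws. length ws = m \<Longrightarrow>
      wp (poly P (length (encode ws))) p (\<lambda>\<tau>. g (reads \<tau>) \<longleftrightarrow> F ws) (init_tapes ws)"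
  shows "\<exists>M T. poly_time_ptm m T M \<and> (\<forall>ws. length ws = m \<longrightarrow> verdict M T ws = return_pmf (F ws))"
proof -
  obtain M where wfM: "wf_ptm M" and M: "\<And>ws coins n \<tau>'.
      (cstep ^^ n) ([p], init_tapes ws) = ([], \<tau>') \<Longrightarrow> length coins > n \<Longrightarrow>
       halted M (run M coins (init M ws)) \<and>
       (accepting M (run M coins (init M ws)) \<longleftrightarrow> g (reads \<tau>'))"
    using compile[OF wf, of g] by blast
  obtain R where R: "\<And>B. tm B p = poly R B" using tm_poly by blast
  \<comment> \<open>\<open>tm\<close> bounds the run to the empty stack; the summand 1 pays for the
    step that delivers the verdict.\<close>
  define T where "T = pcompose R P + 1"
  have T: "poly T n = tm (poly P n) p + 1" for n by (simp add: T_def poly_pcompose R)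
  have fin: "halted M (run M coins (init M ws)) \<and> (accepting M (run M coins (init M ws)) \<longleftrightarrow> F ws)"
    if lens: "length ws = m" "length coins = poly T (length (encode ws))" for ws coins
  proof -
    obtain n \<tau>' where n: "n \<le> tm (poly P (length (encode ws))) p"
      "\<forall>K. (cstep ^^ n) (p # K, init_tapes ws) = (K, \<tau>')" "g (reads \<tau>') \<longleftrightarrow> F ws"
      using p[OF lens(1)] unfolding wp_def by blast
    then show ?thesis using M[of n ws \<tau>' coins] lens(2) T by (metis less_add_one order_le_less_trans)
  qed
  have "verdict M T ws = return_pmf (F ws)" if "length ws = m" for ws
  proof -
    let ?A = "bitstrings (poly T (length (encode ws)))"
    have "verdict M T ws = map_pmf (\<lambda>_. F ws) (pmf_of_set ?A)"
      unfolding verdict_def using fin[OF that]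
      by (intro map_pmf_cong) (auto simp: bitstrings_def[symmetric] finite_bitstrings bitstrings_nonempty in_bitstrings)
    then show ?thesis by simp
  qed
  then show ?thesis using wfM fin unfolding poly_time_ptm_def by blast
qed

section \<open>Head movements, rulers and counting loops\<close>

definition mv :: "nat set \<Rightarrow> direction \<Rightarrow> prog" where
  "mv D d = Act (\<lambda>\<rho> r. if r \<in> D then (\<rho> r, d) else (\<rho> r, Stay))"

definition shift :: "nat set \<Rightarrow> int \<Rightarrow> tapes \<Rightarrow> tapes" where
  "shift D \<delta> \<tau> = (\<lambda>r. if r \<in> D then (fst (\<tau> r), snd (\<tau> r) + \<delta>) else \<tau> r)"

lemma shift_0 [simp]: "shift D 0 \<tau> = \<tau>" by (auto simp: shift_def)
lemma shift_shift [simp]: "shift D a (shift D b \<tau>) = shift D (a + b) \<tau>"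
  by (auto simp: shift_def)
lemma shift_in: "r \<in> D \<Longrightarrow> shift D \<delta> \<tau> r = (fst (\<tau> r), snd (\<tau> r) + \<delta>)"
  and shift_notin: "r \<notin> D \<Longrightarrow> shift D \<delta> \<tau> r = \<tau> r"
  by (auto simp: shift_def)

lemma wp_mv:
  assumes "Q (shift D (move d 0) \<tau>)"
  shows "wp B (mv D d) Q \<tau>"
proof -
  have "perform (\<lambda>\<rho> r. if r \<in> D then (\<rho> r, d) else (\<rho> r, Stay)) \<tau> = shift D (move d 0) \<tau>"
    by (cases d) (auto simp: perform_def shift_def reads_def fun_eq_iff)
  then show ?thesis unfolding mv_def by (intro wp_Act) (use assms in simp)
qed

text \<open>Only blankness counts, so a tape holding a bit string is a ruler for its length; copies
  of \<open>x\<close> serve in this way as rulers for \<open>n\<close>.\<close>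

definition is_ruler :: "(int \<Rightarrow> nat) \<Rightarrow> nat \<Rightarrow> bool" where
  "is_ruler t m \<longleftrightarrow> (\<forall>j. t j \<noteq> 0 \<longleftrightarrow> 0 \<le> j \<and> j < int m)"

definition ruler :: "tape \<Rightarrow> nat \<Rightarrow> bool" where
  "ruler T m \<longleftrightarrow> snd T = 0 \<and> is_ruler (fst T) m"

text \<open>The head of \<open>r\<close> starts on the blank behind the ruler and leaves the loop on
  the blank before it, whence the moves around the loop. All heads in \<open>D\<close> are dragged
  along, with \<open>r\<close> measuring the way back for them.\<close>

definition rewind :: "nat \<Rightarrow> nat set \<Rightarrow> prog" where
  "rewind r D = mv D Left ;; Loop (\<lambda>\<rho>. \<rho> r \<noteq> 0) (mv D Left) ;; mv D Right"

definition For :: "nat \<Rightarrow> prog \<Rightarrow> prog" where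
  "For r body = Loop (\<lambda>\<rho>. \<rho> r \<noteq> 0) (body ;; mv {r} Right) ;; rewind r {r}"

lemma wp_rewind:
  assumes m: "is_ruler t m" "m \<le> B" and r: "r \<in> D" "\<tau> r = (t, int m)"
    and Q: "Q (shift D (- int m) \<tau>)"
  shows "wp B (rewind r D) Q \<tau>"
  unfolding rewind_def
proof (intro wp_Then wp_mv, rule wp_Loop[where m = m and I = "\<lambda>i \<tau>'. \<tau>' = shift D (- int i - 1) \<tau>"])
  fix i \<tau>' assume i: "i < m" "\<tau>' = shift D (- int i - 1) \<tau>"
  have "reads \<tau>' r \<noteq> 0" using i r m(1) by (simp add: reads_def shift_in is_ruler_def)
  then show "reads \<tau>' r \<noteq> 0 \<and> wp B (mv D Left) (\<lambda>\<tau>'. \<tau>' = shift D (- int (Suc i) - 1) \<tau>) \<tau>'"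
    by (intro conjI wp_mv) (simp_all add: i(2))
next
  fix \<tau>' assume i: "\<tau>' = shift D (- int m - 1) \<tau>"
  have "\<not> (0::int) \<le> - 1" by simp
  then have "t (- 1) = 0" using m(1) unfolding is_ruler_def by blast
  then have "reads \<tau>' r = 0" using i r by (simp add: reads_def shift_in)
  moreover have "shift D (move Right 0) \<tau>' = shift D (- int m) \<tau>" by (simp add: i)
  ultimately show "\<not> reads \<tau>' r \<noteq> 0 \<and> wp B (mv D Right) Q \<tau>'"
    by (intro conjI wp_mv) (use Q in simp_all)
qed (use m in simp_all)

text \<open>The head of \<open>r\<close> is the loop counter. By \<open>ins\<close> the invariant
  does not see this head, so advancing and rewinding it preserve \<open>I\<close>.\<close>

lemma wp_For:
  assumes m: "ruler (\<tau>\<^sub>0 r) m" "m \<le> B"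
    and I0: "I 0 \<tau>\<^sub>0"
    and body: "\<And>i \<tau>. i < m \<Longrightarrow> I i \<tau> \<Longrightarrow> \<tau> r = (fst (\<tau>\<^sub>0 r), int i) \<Longrightarrow>
        wp B body (\<lambda>\<tau>'. \<tau>' r = (fst (\<tau>\<^sub>0 r), int i) \<and> I (Suc i) \<tau>') \<tau>"
    and ins: "\<And>i \<tau> \<delta>. I i \<tau> \<Longrightarrow> I i (shift {r} \<delta> \<tau>)"
    and Q: "\<And>\<tau>. I m \<tau> \<Longrightarrow> \<tau> r = \<tau>\<^sub>0 r \<Longrightarrow> Q \<tau>"
  shows "wp B (For r body) Q \<tau>\<^sub>0"
proof -
  define t where "t = fst (\<tau>\<^sub>0 r)"
  have t: "is_ruler t m" and r: "\<tau>\<^sub>0 r = (t, 0)"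
    using m by (auto simp: ruler_def t_def prod_eq_iff)
  note body = body[folded t_def] and Q = Q[unfolded r]
  show ?thesis
    unfolding For_def
  proof (intro wp_Then, rule wp_Loop[where m = m and I = "\<lambda>i \<tau>. I i \<tau> \<and> \<tau> r = (t, int i)"])
    fix i \<tau> assume i: "i < m" "I i \<tau> \<and> \<tau> r = (t, int i)"
    have "reads \<tau> r \<noteq> 0" using i t by (simp add: reads_def is_ruler_def)
    moreover have "wp B (body ;; mv {r} Right) (\<lambda>\<tau>. I (Suc i) \<tau> \<and> \<tau> r = (t, int (Suc i))) \<tau>"
      using i body by (intro wp_Then, rule_tac wp_mono[OF body]) (auto intro!: wp_mv ins simp: shift_in)
    ultimately show "reads \<tau> r \<noteq> 0 \<and>
        wp B (body ;; mv {r} Right) (\<lambda>\<tau>. I (Suc i) \<tau> \<and> \<tau> r = (t, int (Suc i))) \<tau>" by simp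
  next
    fix \<tau> assume i: "I m \<tau> \<and> \<tau> r = (t, int m)"
    have "t (int m) = 0" using t unfolding is_ruler_def by (metis less_irrefl)
    then have "reads \<tau> r = 0" using i by (simp add: reads_def)
    moreover have "wp B (rewind r {r}) Q \<tau>"
      using i by (intro wp_rewind[OF t m(2)]) (auto intro!: Q ins simp: shift_in)
    ultimately show "\<not> reads \<tau> r \<noteq> 0 \<and> wp B (rewind r {r}) Q \<tau>" by simp
  qed (use m r I0 in simp_all)
qed

lemma wp_For_iter:
  assumes m: "ruler (\<tau> r) m" "m \<le> B"
    and \<sigma>0: "\<sigma> 0 = \<tau>" and \<sigma>r: "\<And>i. i \<le> m \<Longrightarrow> \<sigma> i r = \<tau> r"
    and body: "\<And>i. i < m \<Longrightarrow>
        wp B body (\<lambda>\<tau>'. \<tau>' = (\<sigma> (Suc i))(r := (fst (\<tau> r), int i))) ((\<sigma> i)(r := (fst (\<tau> r), int i)))"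
    and Q: "Q (\<sigma> m)"
  shows "wp B (For r body) Q \<tau>"
proof (rule wp_For[of \<tau> r, OF m, where I = "\<lambda>i \<tau>. \<forall>s. s \<noteq> r \<longrightarrow> \<tau> s = \<sigma> i s"])
  fix i \<tau>' assume i: "i < m" "\<forall>s. s \<noteq> r \<longrightarrow> \<tau>' s = \<sigma> i s" "\<tau>' r = (fst (\<tau> r), int i)"
  then have "\<tau>' = (\<sigma> i)(r := (fst (\<tau> r), int i))" by (simp add: fun_eq_iff)
  then show "wp B body (\<lambda>\<tau>'. \<tau>' r = (fst (\<tau> r), int i) \<and> (\<forall>s. s \<noteq> r \<longrightarrow> \<tau>' s = \<sigma> (Suc i) s)) \<tau>'"
    using body[OF i(1)] by (auto elim: wp_mono)
next
  fix \<tau>' assume "\<forall>s. s \<noteq> r \<longrightarrow> \<tau>' s = \<sigma> m s" "\<tau>' r = \<tau> r"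
  then have "\<tau>' = \<sigma> m" using \<sigma>r[of m] by (metis order_refl ext)
  then show "Q \<tau>'" using Q by simp
qed (use \<sigma>0 in \<open>auto simp: shift_def\<close>)

lemma wp_For_mv:
  assumes m: "ruler (\<tau> r) m" "m \<le> B" and r: "r \<notin> D"
    and Q: "Q (shift D (int m * move d 0) \<tau>)"
  shows "wp B (For r (mv D d)) Q \<tau>"
proof (rule wp_For_iter[of \<tau> r, OF m, where \<sigma> = "\<lambda>i. shift D (int i * move d 0) \<tau>"])
  fix i
  show "wp B (mv D d) (\<lambda>\<tau>'. \<tau>' = (shift D (int (Suc i) * move d 0) \<tau>)(r := (fst (\<tau> r), int i)))
      ((shift D (int i * move d 0) \<tau>)(r := (fst (\<tau> r), int i)))"
    using r by (intro wp_mv) (auto simp: shift_def fun_eq_iff algebra_simps)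
qed (use r Q in \<open>auto simp: shift_def\<close>)

lemma wp_For_For_mv:
  assumes m: "ruler (\<tau> r) m" "m \<le> B" and r: "r \<notin> D"
    and l: "ruler (\<tau> s) l" "l \<le> B" and s: "s \<notin> D" "r \<noteq> s"
    and Q: "Q (shift D (int m * (int l * move d 0)) \<tau>)"
  shows "wp B (For r (For s (mv D d))) Q \<tau>"
proof (rule wp_For_iter[of \<tau> r, OF m, where \<sigma> = "\<lambda>i. shift D (int i * (int l * move d 0)) \<tau>"])
  fix i
  show "wp B (For s (mv D d)) (\<lambda>\<tau>'. \<tau>' = (shift D (int (Suc i) * (int l * move d 0)) \<tau>)(r := (fst (\<tau> r), int i)))
      ((shift D (int i * (int l * move d 0)) \<tau>)(r := (fst (\<tau> r), int i)))"
    using r s l by (intro wp_For_mv[where m = l]) (auto simp: shift_def fun_eq_iff algebra_simps)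
qed (use r Q in \<open>auto simp: shift_def\<close>)

section \<open>Writing and copying blocks of symbols\<close>

definition inscribe :: "tape \<Rightarrow> nat list \<Rightarrow> tape" where
  "inscribe T us = fold (\<lambda>u. act_tape (u, Right)) us T"

lemma inscribe_Nil [simp]: "inscribe T [] = T"
  and inscribe_append: "inscribe T (us @ vs) = inscribe (inscribe T us) vs"
  and inscribe_single: "inscribe T [u] = act_tape (u, Right) T"
  by (simp_all add: inscribe_def)

lemma inscribe_closed:
  "inscribe (t, h) us =
     (\<lambda>j. if h \<le> j \<and> j < h + int (length us) then us ! nat (j - h) else t j, h + int (length us))"
proof (induction us rule: rev_induct)
  case (snoc u us)
  then show ?case
    by (auto simp: inscribe_append inscribe_single fun_eq_iff nth_append)
qed (simp add: fun_eq_iff)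

definition block :: "tape \<Rightarrow> nat \<Rightarrow> nat list" where
  "block T m = map (\<lambda>i. fst T (snd T + int i)) [0..<m]"

lemma block_0 [simp]: "block T 0 = []" and block_Suc: "block T (Suc m) = block T m @ [fst T (snd T + int m)]"
  and length_block [simp]: "length (block T m) = m"
  by (simp_all add: block_def)

definition put :: "nat \<Rightarrow> nat \<Rightarrow> prog" where
  "put v a = Act (\<lambda>\<rho> r. if r = v then (a, Right) else (\<rho> r, Stay))"

definition copy :: "nat \<Rightarrow> nat \<Rightarrow> prog" where
  "copy v s = Act (\<lambda>\<rho> r. if r = v then (\<rho> s, Right) else if r = s then (\<rho> r, Right) else (\<rho> r, Stay))"

lemma wp_put: "Q (\<tau>(v := inscribe (\<tau> v) [a])) \<Longrightarrow> wp B (put v a) Q \<tau>"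
proof -
  have "perform (\<lambda>\<rho> r. if r = v then (a, Right) else (\<rho> r, Stay)) \<tau> = \<tau>(v := inscribe (\<tau> v) [a])"
    by (auto simp: perform_def reads_def inscribe_single fun_eq_iff)
  then show "Q (\<tau>(v := inscribe (\<tau> v) [a])) \<Longrightarrow> ?thesis"
    unfolding put_def by (intro wp_Act) simp
qed

lemma wp_copy:
  assumes "v \<noteq> s" "Q (shift {s} 1 (\<tau>(v := inscribe (\<tau> v) [fst (\<tau> s) (snd (\<tau> s))])))"
  shows "wp B (copy v s) Q \<tau>"
proof -
  have "perform (\<lambda>\<rho> r. if r = v then (\<rho> s, Right) else if r = s then (\<rho> r, Right) else (\<rho> r, Stay)) \<tau>
      = shift {s} 1 (\<tau>(v := inscribe (\<tau> v) [fst (\<tau> s) (snd (\<tau> s))]))"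
    using assms(1)
    by (cases "\<tau> s") (auto simp: perform_def reads_def inscribe_single shift_def fun_eq_iff)
  then show ?thesis unfolding copy_def by (intro wp_Act) (use assms(2) in simp)
qed

lemma wp_For_copy:
  assumes m: "ruler (\<tau> r) m" "m \<le> B" and r: "r \<noteq> v" "r \<noteq> s" "v \<noteq> s"
    and Q: "Q (shift {s} (int m) (\<tau>(v := inscribe (\<tau> v) (block (\<tau> s) m))))"
  shows "wp B (For r (copy v s)) Q \<tau>"
proof (rule wp_For_iter[of \<tau> r, OF m, where
    \<sigma> = "\<lambda>i. shift {s} (int i) (\<tau>(v := inscribe (\<tau> v) (block (\<tau> s) i)))"])
  fix i
  show "wp B (copy v s) (\<lambda>\<tau>'. \<tau>' = (shift {s} (int (Suc i)) (\<tau>(v := inscribe (\<tau> v) (block (\<tau> s) (Suc i)))))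
           (r := (fst (\<tau> r), int i)))
      ((shift {s} (int i) (\<tau>(v := inscribe (\<tau> v) (block (\<tau> s) i))))(r := (fst (\<tau> r), int i)))"
    using r by (intro wp_copy) (auto simp: shift_def fun_eq_iff block_Suc inscribe_append)
qed (use r Q in \<open>auto simp: shift_def\<close>)

section \<open>Loading the input tuple onto work tapes\<close>

definition bit_syms :: "bool list \<Rightarrow> nat list" where
  "bit_syms w = map (\<lambda>b. if b then 2 else 1) w"

lemma length_bit_syms [simp]: "length (bit_syms w) = length w"
  by (simp add: bit_syms_def)

lemma encode_simps [simp]:
  "encode [] = []" "encode (w # ws) = bit_syms w @ 3 # encode ws"
  "encode (us @ vs) = encode us @ encode vs"
  by (simp_all add: encode_def bit_syms_def)

lemma fst_input_tape: "fst (input_tape u) j = (if 0 \<le> j \<and> nat j < length u then u ! nat j else 0)"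
  and snd_input_tape [simp]: "snd (input_tape u) = 0"
  by (simp_all add: input_tape_def)

lemma inscribe_blank: "inscribe blank_tape u = (fst (input_tape u), int (length u))"
  by (auto simp: blank_tape_def inscribe_closed input_tape_def fun_eq_iff)

lemma ruler_input_tape: "0 \<notin> set u \<Longrightarrow> ruler (input_tape u) (length u)"
  by (auto simp: ruler_def is_ruler_def fst_input_tape in_set_conv_nth nat_less_iff)

lemma zero_bit_syms [simp]: "0 \<notin> set (bit_syms w)"
  by (auto simp: bit_syms_def)

text \<open>This loop runs along the input itself: the separator 3 ends it after
  \<open>length w\<close> iterations. All tapes in \<open>D\<close> are filled in one pass since the
  input head only moves forward; \<open>d\<close> then serves as the ruler for their common way
  back.\<close>

definition load :: "nat \<Rightarrow> nat set \<Rightarrow> prog" where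
  "load d D =
     Loop (\<lambda>\<rho>. \<rho> 0 \<noteq> 3)
       (Act (\<lambda>\<rho> r. if r \<in> insert 0 D then (\<rho> 0, Right) else (\<rho> r, Stay))) ;;
     mv {0} Right ;; rewind d D"

lemma wp_load:
  assumes d: "d \<in> D" "0 \<notin> D" and bl: "\<And>r. r \<in> D \<Longrightarrow> \<tau> r = blank_tape"
    and t0: "\<tau> 0 = (fst (input_tape (encode (us @ w # vs))), int (length (encode us)))"
    and B: "length w \<le> B"
    and Q: "Q (\<lambda>r. if r \<in> D then input_tape (bit_syms w)
       else if r = 0 then (fst (input_tape (encode (us @ w # vs))), int (length (encode (us @ [w])))) else \<tau> r)"
  shows "wp B (load d D) Q \<tau>"
proof -
  let ?t = "fst (input_tape (encode (us @ w # vs)))"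
  define h where "h = int (length (encode us))"
  define \<sigma> where "\<sigma> = (\<lambda>i r. if r \<in> D then inscribe blank_tape (take i (bit_syms w))
       else if r = 0 then (?t, h + int i) else \<tau> r)"
  have ti: "?t (h + int i) = bit_syms w ! i" if "i < length w" for i
  proof -
    have "nat (h + int i) = length (encode us) + i" by (simp add: h_def nat_add_distrib)
    then show ?thesis using that by (simp add: fst_input_tape h_def nth_append)
  qed
  have te: "?t (h + int (length w)) = 3"
  proof -
    have "nat (h + int (length w)) = length (encode us) + length w" by (simp add: h_def nat_add_distrib)
    then show ?thesis by (simp add: fst_input_tape h_def nth_append)
  qed
  have isr: "is_ruler (fst (input_tape (bit_syms w))) (length w)"
    using ruler_input_tape[of "bit_syms w"] by (simp add: ruler_def)
  show ?thesis unfolding load_def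
  proof (intro wp_Then, rule wp_Loop[where m = "length w" and I = "\<lambda>i \<tau>. \<tau> = \<sigma> i"])
    show "\<tau> = \<sigma> 0" using bl t0 by (auto simp: \<sigma>_def h_def fun_eq_iff)
  next
    fix i \<tau>' assume i: "i < length w" "\<tau>' = \<sigma> i"
    have s0: "\<sigma> i 0 = (?t, h + int i)" using d by (simp add: \<sigma>_def)
    have r0: "reads (\<sigma> i) 0 = bit_syms w ! i" using ti[OF i(1)] by (simp add: reads_def s0)
    have "bit_syms w ! i \<noteq> 3" using i(1) by (simp add: bit_syms_def)
    moreover have "perform (\<lambda>\<rho> r. if r \<in> insert 0 D then (\<rho> 0, Right) else (\<rho> r, Stay)) (\<sigma> i) = \<sigma> (Suc i)"
    proof
      fix r
      consider "r = 0" | "r \<in> D" "r \<noteq> 0" | "r \<notin> D" "r \<noteq> 0" by blast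
      then show "perform (\<lambda>\<rho> r. if r \<in> insert 0 D then (\<rho> 0, Right) else (\<rho> r, Stay)) (\<sigma> i) r = \<sigma> (Suc i) r"
      proof cases
        case 1
        then show ?thesis using d by (simp add: perform_def reads_def) (simp add: \<sigma>_def)
      next
        case 2
        then show ?thesis using i(1) r0
          by (simp add: perform_def) (simp add: \<sigma>_def take_Suc_conv_app_nth inscribe_append inscribe_single)
      next
        case 3
        then show ?thesis by (simp add: perform_def reads_def) (simp add: \<sigma>_def)
      qed
    qed
    ultimately show "reads \<tau>' 0 \<noteq> 3 \<and> wp B (Act (\<lambda>\<rho> r. if r \<in> insert 0 D then (\<rho> 0, Right) else (\<rho> r, Stay)))
         (\<lambda>\<tau>. \<tau> = \<sigma> (Suc i)) \<tau>'"
      using i r0 by (intro conjI wp_Act) simp_all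
  next
    fix \<tau>' assume i: "\<tau>' = \<sigma> (length w)"
    have "reads \<tau>' 0 = 3" using te d i by (simp add: reads_def \<sigma>_def)
    moreover have "wp B (mv {0} Right ;; rewind d D) Q \<tau>'"
    proof (intro wp_Then wp_mv, rule wp_rewind[OF isr B d(1)])
      show "shift {0} (move Right 0) \<tau>' d = (fst (input_tape (bit_syms w)), int (length w))"
        using d i by (auto simp: shift_def \<sigma>_def inscribe_blank)
      have "shift D (- int (length w)) (shift {0} (move Right 0) \<tau>') =
         (\<lambda>r. if r \<in> D then input_tape (bit_syms w)
           else if r = 0 then (?t, int (length (encode (us @ [w])))) else \<tau> r)"
        using d i by (auto simp: shift_def \<sigma>_def inscribe_blank fun_eq_iff h_def prod_eq_iff)
      then show "Q (shift D (- int (length w)) (shift {0} (move Right 0) \<tau>'))" using Q by simp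
    qed
    ultimately show "\<not> reads \<tau>' 0 \<noteq> 3 \<and> wp B (mv {0} Right ;; rewind d D) Q \<tau>'" by simp
  qed (use B in simp_all)
qed

section \<open>Unary values of polynomials\<close>

definition skip :: prog where "skip = mv {} Stay"

lemma wp_skip: "Q \<tau> \<Longrightarrow> wp B skip Q \<tau>"
  unfolding skip_def by (rule wp_mv) simp

fun repeat :: "nat \<Rightarrow> prog \<Rightarrow> prog" where
  "repeat 0 p = skip"
| "repeat (Suc n) p = p ;; repeat n p"

text \<open>Evaluates a polynomial by Horner's scheme; the nested loops need one ruler per coefficient.\<close>

fun horner :: "nat \<Rightarrow> nat list \<Rightarrow> prog \<Rightarrow> prog" where
  "horner X [] p = skip"
| "horner X (c # cs) p = repeat c p ;; For X (horner (Suc X) cs p)"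

lemma wp_repeat_put:
  "Q (\<tau>(v := inscribe (\<tau> v) (replicate c a))) \<Longrightarrow> wp B (repeat c (put v a)) Q \<tau>"
proof (induction c arbitrary: \<tau>)
  case 0
  then show ?case by (simp add: wp_skip)
next
  case (Suc c)
  have "inscribe (inscribe (\<tau> v) [a]) (replicate c a) = inscribe (\<tau> v) (replicate (Suc c) a)"
    by (simp flip: inscribe_append)
  then show ?case using Suc.prems unfolding repeat.simps
    by (intro wp_Then wp_put Suc.IH) (simp only: fun_upd_upd fun_upd_same)
qed

lemma wp_horner_put:
  assumes "\<And>i. i < length cs \<Longrightarrow> ruler (\<tau> (X + i)) n" "n \<le> B" "v < X"
    and "Q (\<tau>(v := inscribe (\<tau> v) (replicate (poly (Poly cs) n) a)))"
  shows "wp B (horner X cs (put v a)) Q \<tau>"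
  using assms
proof (induction cs arbitrary: X \<tau> Q)
  case Nil
  then show ?case by (simp add: wp_skip)
next
  case (Cons c cs)
  let ?P = "poly (Poly cs) n"
  let ?\<sigma> = "\<lambda>i. \<tau>(v := inscribe (\<tau> v) (replicate (c + i * ?P) a))"
  have X: "ruler (\<tau> X) n" using Cons.prems(1)[of 0] by simp
  have "wp B (For X (horner (Suc X) cs (put v a))) Q (?\<sigma> 0)"
  proof (rule wp_For_iter[where \<sigma> = ?\<sigma> and m = n])
    fix i assume "i < n"
    have e: "inscribe (inscribe (\<tau> v) (replicate (c + i * ?P) a)) (replicate ?P a) =
       inscribe (\<tau> v) (replicate (c + Suc i * ?P) a)"
      unfolding inscribe_append[symmetric] replicate_add[symmetric] by (simp add: algebra_simps)
    show "wp B (horner (Suc X) cs (put v a))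
          (\<lambda>\<tau>'. \<tau>' = (?\<sigma> (Suc i))(X := (fst (?\<sigma> 0 X), int i)))
          ((?\<sigma> i)(X := (fst (?\<sigma> 0 X), int i)))"
      using Cons.prems(1)[of "Suc _"] Cons.prems(2,3) e
      by (intro Cons.IH) (auto simp: fun_eq_iff)
  next
    show "Q (?\<sigma> n)" using Cons.prems(4) by (simp del: fun_upd_apply)
  qed (use X Cons.prems in auto)
  then show ?case unfolding horner.simps by (intro wp_Then wp_repeat_put) (simp del: fun_upd_apply)
qed

definition make_ruler :: "nat \<Rightarrow> nat \<Rightarrow> nat poly \<Rightarrow> prog" where
  "make_ruler X v P = horner X (coeffs P) (put v 1) ;; rewind v {v}"

definition unary :: "nat \<Rightarrow> tape" where
  "unary m = input_tape (replicate m 1)"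

lemma ruler_unary [simp]: "ruler (unary m) m"
  using ruler_input_tape[of "replicate m 1"] by (auto simp: unary_def)

lemma wp_make_ruler:
  assumes "\<And>i. i < length (coeffs P) \<Longrightarrow> ruler (\<tau> (X + i)) n" "n \<le> B" "v < X"
    and "\<tau> v = blank_tape" "poly P n \<le> B" "Q (\<tau>(v := unary (poly P n)))"
  shows "wp B (make_ruler X v P) Q \<tau>"
proof -
  have isr: "is_ruler (fst (unary (poly P n))) (poly P n)"
    using ruler_unary[of "poly P n"] by (simp add: ruler_def)
  have "shift {v} (- int (poly P n)) (\<tau>(v := (fst (unary (poly P n)), int (poly P n)))) = \<tau>(v := unary (poly P n))"
    by (auto simp: shift_def unary_def prod_eq_iff fun_eq_iff)
  then show ?thesis unfolding make_ruler_def using assms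
    by (intro wp_Then wp_horner_put wp_rewind[OF isr])
       (auto simp: inscribe_blank unary_def)
qed

fun make_rulers :: "nat \<Rightarrow> (nat \<times> nat poly) list \<Rightarrow> prog" where
  "make_rulers X [] = skip"
| "make_rulers X ((v, P) # l) = make_ruler X v P ;; make_rulers X l"

lemma wp_make_rulers:
  assumes "\<And>i P. P \<in> snd ` set l \<Longrightarrow> i < length (coeffs P) \<Longrightarrow> ruler (\<tau> (X + i)) n"
    and "\<And>P. P \<in> snd ` set l \<Longrightarrow> poly P n \<le> B"
    and "\<And>v. v \<in> fst ` set l \<Longrightarrow> v < X \<and> \<tau> v = blank_tape"
    and "n \<le> B" "distinct (map fst l)"
    and "Q (\<lambda>r. case map_of l r of Some P \<Rightarrow> unary (poly P n) | None \<Rightarrow> \<tau> r)"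
  shows "wp B (make_rulers X l) Q \<tau>"
  using assms
proof (induction l arbitrary: \<tau>)
  case Nil
  then show ?case by (simp add: wp_skip)
next
  case (Cons a l)
  obtain v P where a: "a = (v, P)" by (cases a)
  have "(\<lambda>r. case map_of (a # l) r of Some P \<Rightarrow> unary (poly P n) | None \<Rightarrow> \<tau> r) =
     (\<lambda>r. case map_of l r of Some P \<Rightarrow> unary (poly P n) | None \<Rightarrow> (\<tau>(v := unary (poly P n))) r)"
  proof
    fix r
    have "map_of l v = None" using Cons.prems(5) by (simp add: a map_of_eq_None_iff)
    then show "(case map_of (a # l) r of Some P \<Rightarrow> unary (poly P n) | None \<Rightarrow> \<tau> r) =
      (case map_of l r of Some P \<Rightarrow> unary (poly P n) | None \<Rightarrow> (\<tau>(v := unary (poly P n))) r)"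
      by (cases "r = v") (auto simp: a split: option.splits)
  qed
  then have "wp B (make_rulers X l) Q (\<tau>(v := unary (poly P n)))"
    using Cons.prems by (intro Cons.IH) (auto simp: a)
  moreover have "v < X" "\<tau> v = blank_tape" "poly P n \<le> B"
    using Cons.prems(2,3) by (auto simp: a)
  ultimately show ?case using Cons.prems(1,4) unfolding a
    by (auto intro!: wp_Then wp_make_ruler[where n = n])
qed

text \<open>Ruler \<open>r\<close> fixes the length of the block taken from tape \<open>s\<close>.
  Closing each block with 3 gives a tuple in the format of \<open>encode\<close> when the blocks are
  bit strings.\<close>

fun gather :: "nat \<Rightarrow> (nat \<times> nat) list \<Rightarrow> prog" where
  "gather v [] = skip"
| "gather v ((r, s) # l) = For r (copy v s) ;; For r (mv {s} Left) ;; put v 3 ;; gather v l"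

lemma wp_gather:
  assumes "\<And>r s. (r, s) \<in> set l \<Longrightarrow> ruler (\<tau> r) (len r) \<and> len r \<le> B \<and> r \<noteq> s \<and> r \<noteq> v \<and> s \<noteq> v"
    and "Q (\<tau>(v := inscribe (\<tau> v) (concat (map (\<lambda>(r, s). block (\<tau> s) (len r) @ [3]) l))))"
  shows "wp B (gather v l) Q \<tau>"
  using assms
proof (induction l arbitrary: \<tau>)
  case Nil
  then show ?case by (simp add: wp_skip)
next
  case (Cons a l)
  obtain r s where a: "a = (r, s)" by (cases a)
  have rs: "ruler (\<tau> r) (len r)" "len r \<le> B" "r \<noteq> s" "r \<noteq> v" "s \<noteq> v"
    using Cons.prems(1)[of r s] by (auto simp: a)
  let ?u = "block (\<tau> s) (len r)"
  let ?\<tau>' = "\<tau>(v := inscribe (\<tau> v) (?u @ [3]))"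
  have m: "map (\<lambda>(r, s). block (?\<tau>' s) (len r) @ [3]) l = map (\<lambda>(r, s). block (\<tau> s) (len r) @ [3]) l"
  proof (intro map_cong refl)
    fix x assume "x \<in> set l"
    then show "(\<lambda>(r, s). block (?\<tau>' s) (len r) @ [3]) x = (\<lambda>(r, s). block (\<tau> s) (len r) @ [3]) x"
      using Cons.prems(1)[of "fst x" "snd x"] by (auto split: prod.splits)
  qed
  have e: "?\<tau>'(v := inscribe (?\<tau>' v) (concat (map (\<lambda>(r, s). block (?\<tau>' s) (len r) @ [3]) l))) =
      \<tau>(v := inscribe (\<tau> v) (concat (map (\<lambda>(r, s). block (\<tau> s) (len r) @ [3]) (a # l))))"
    unfolding m by (simp add: a flip: inscribe_append)
  have IH: "wp B (gather v l) Q ?\<tau>'"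
  proof (rule Cons.IH)
    fix r' s' assume "(r', s') \<in> set l"
    then show "ruler (?\<tau>' r') (len r') \<and> len r' \<le> B \<and> r' \<noteq> s' \<and> r' \<noteq> v \<and> s' \<noteq> v"
      using Cons.prems(1)[of r' s'] by simp
  qed (unfold e, rule Cons.prems(2))
  let ?\<tau>1 = "shift {s} (int (len r)) (\<tau>(v := inscribe (\<tau> v) ?u))"
  have 1: "shift {s} (int (len r) * move Left 0) ?\<tau>1 = \<tau>(v := inscribe (\<tau> v) ?u)" by simp
  have 2: "(\<tau>(v := inscribe (\<tau> v) ?u))(v := inscribe ((\<tau>(v := inscribe (\<tau> v) ?u)) v) [3]) = ?\<tau>'"
    by (simp add: inscribe_append)
  have 3: "wp B (put v 3 ;; gather v l) Q (\<tau>(v := inscribe (\<tau> v) ?u))"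
    by (intro wp_Then wp_put) (unfold 2, rule IH)
  have 4: "wp B (For r (mv {s} Left) ;; put v 3 ;; gather v l) Q ?\<tau>1"
    by (rule wp_Then, rule wp_For_mv[where m = "len r"]) (use rs 3 in \<open>simp_all add: shift_notin\<close>)
  show ?case unfolding a gather.simps
    by (rule wp_Then, rule wp_For_copy[where m = "len r"]) (use rs 4 in auto)
qed

section \<open>Simulating a machine on given coins\<close>

text \<open>A run of \<open>d\<close> steps sees only cells within distance \<open>d\<close> of the
  heads. Comparing tapes relative to the heads, and only there, permits a simulation at any place of
  a tape that is dirty elsewhere.\<close>

definition agree :: "nat \<Rightarrow> tape \<Rightarrow> tape \<Rightarrow> bool" where
  "agree d T T' \<longleftrightarrow> (\<forall>j. \<bar>j\<bar> \<le> int d \<longrightarrow> fst T (snd T + j) = fst T' (snd T' + j))"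

lemma agree_read: "agree d T T' \<Longrightarrow> read_tape T = read_tape T'"
  unfolding agree_def by (cases T; cases T') (auto dest: spec[of _ 0])

lemma agree_act: "agree (Suc d) T T' \<Longrightarrow> agree d (act_tape a T) (act_tape a T')"
proof (cases T; cases T'; cases a)
  fix t h t' h' x m assume *: "agree (Suc d) T T'" "T = (t, h)" "T' = (t', h')" "a = (x, m)"
  have eq: "t (h + j) = t' (h' + j)" if "\<bar>j\<bar> \<le> int d + 1" for j
    using * that by (auto simp: agree_def)
  have mv: "move m i = i + move m 0" for i by (cases m) auto
  have le: "\<bar>move m 0\<bar> \<le> 1" by (cases m) auto
  have "(t(h := x)) (move m h + j) = (t'(h' := x)) (move m h' + j)" if j: "\<bar>j\<bar> \<le> int d" for j
    using eq[of "move m 0 + j"] j le unfolding mv[of h] mv[of h'] by (auto simp: algebra_simps)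
  then show ?thesis using * by (simp add: agree_def)
qed

text \<open>\<open>wf_ptm\<close> constrains \<open>trans\<close> only on states and symbols in
  range; this invariant keeps the simulated machine there.\<close>

definition valid_config :: "ptm \<Rightarrow> config \<Rightarrow> bool" where
  "valid_config V c \<longleftrightarrow> fst c < num_states V \<and> length (snd c) = num_tapes V \<and>
     (\<forall>T\<in>set (snd c). \<forall>j. fst T j < num_symbols V)"

lemma valid_reads: "valid_config V c \<Longrightarrow> set (map read_tape (snd c)) \<subseteq> {..<num_symbols V}"
proof clarsimp
  fix t h assume "valid_config V c" "(t, h) \<in> set (snd c)"
  then show "t h < num_symbols V" unfolding valid_config_def by (metis fst_conv)
qed

lemma valid_trans:
  assumes "wf_ptm V" "valid_config V c" "trans V (fst c) (map read_tape (snd c)) coin = (s', acts)"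
  shows "s' < num_states V" "length acts = num_tapes V" "\<And>a. a \<in> set acts \<Longrightarrow> fst a < num_symbols V"
proof -
  have all: "\<forall>s < num_states V. \<forall>reads coin.
        length reads = num_tapes V \<and> set reads \<subseteq> {..<num_symbols V} \<longrightarrow>
        (case trans V s reads coin of (s', acts) \<Rightarrow>
           s' < num_states V \<and> length acts = num_tapes V \<and>
           fst ` set acts \<subseteq> {..<num_symbols V})"
    using assms(1) unfolding wf_ptm_def by (elim conjE)
  have "fst c < num_states V" "length (map read_tape (snd c)) = num_tapes V"
    using assms(2) by (simp_all add: valid_config_def)
  then have "case trans V (fst c) (map read_tape (snd c)) coin of (s', acts) \<Rightarrow>
      s' < num_states V \<and> length acts = num_tapes V \<and> fst ` set acts \<subseteq> {..<num_symbols V}"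
    using all valid_reads[OF assms(2)] by (simp only:)
  then show "s' < num_states V" "length acts = num_tapes V" "\<And>a. a \<in> set acts \<Longrightarrow> fst a < num_symbols V"
    unfolding assms(3) by auto
qed

lemma valid_step:
  assumes "wf_ptm V" "valid_config V c"
  shows "valid_config V (step V coin c)"
proof (cases "halted V c")
  case False
  obtain s' acts where t: "trans V (fst c) (map read_tape (snd c)) coin = (s', acts)" by force
  note v = valid_trans[OF assms t]
  have act: "fst (act_tape a T) j < num_symbols V" if "a \<in> set acts" "T \<in> set (snd c)" for a T j
    using v(3)[OF that(1)] assms(2) that(2) by (cases a; cases T) (auto simp: valid_config_def)
  have "fst T j < num_symbols V" if "T \<in> set (map2 act_tape acts (snd c))" for T j
  proof -
    from that have "\<exists>p \<in> set (zip acts (snd c)). T = (\<lambda>(a, t). act_tape a t) p"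
      by (simp only: set_map image_iff)
    then obtain p where p: "p \<in> set (zip acts (snd c))" "T = act_tape (fst p) (snd p)"
      by (auto simp only: case_prod_beta)
    have "fst p \<in> set acts" "snd p \<in> set (snd c)"
      using p(1) by (metis in_set_zipE prod.collapse)+
    then show ?thesis using act p(2) by simp
  qed
  moreover have "step V coin c = (s', map2 act_tape acts (snd c))"
    using False by (simp add: step_def t)
  ultimately show ?thesis using v(1,2) assms(2) by (simp add: valid_config_def)
qed (use assms in \<open>simp add: step_def\<close>)

lemma valid_run: "wf_ptm V \<Longrightarrow> valid_config V c \<Longrightarrow> valid_config V (run V coins c)"
  unfolding run_def by (induction coins arbitrary: c) (auto simp: valid_step)

text \<open>Tape 3 supplies the coins of the simulated machine \<open>V\<close>, tape 6 holds its state, and its tapes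
  start at index 14.\<close>

definition sim_act :: "ptm \<Rightarrow> (nat \<Rightarrow> nat) \<Rightarrow> nat \<Rightarrow> nat \<times> direction" where
  "sim_act V \<rho> r =
     (let rs = map (\<lambda>i. \<rho> (14 + i)) [0..<num_tapes V];
          live = \<rho> 6 < num_states V \<and> \<rho> 6 \<notin> {accept_state V, reject_state V} \<and>
                 set rs \<subseteq> {..<num_symbols V};
          t = trans V (\<rho> 6) rs (\<rho> 3 = 2)
      in if r = 3 then (\<rho> r, Right)
         else if live \<and> r = 6 then (fst t, Stay)
         else if live \<and> 14 \<le> r \<and> r < 14 + num_tapes V then snd t ! (r - 14)
         else (\<rho> r, Stay))"

abbreviation sim_tapes :: "ptm \<Rightarrow> nat set" where
  "sim_tapes V \<equiv> {14..<14 + num_tapes V}"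

text \<open>The tapes of \<open>V\<close> and their simulation differ in absolute positions and far
  from the heads, so no equality of tapes is available. Instead one action \<open>a\<close> is shown
  to hit both, as \<open>agree_act\<close> requires; a halted machine is matched by rewriting the
  symbol read.\<close>

lemma perform_sim_act:
  assumes wf: "wf_ptm V" and c: "valid_config V c" "read_tape (\<tau> 6) = fst c"
    and ag: "\<And>v. v < num_tapes V \<Longrightarrow> agree d (\<tau> (14 + v)) (snd c ! v)"
    and \<tau>': "\<tau>' = perform (sim_act V) \<tau>" and c': "c' = step V (read_tape (\<tau> 3) = 2) c"
  shows "\<tau>' 3 = (fst (\<tau> 3), snd (\<tau> 3) + 1)"
    and "read_tape (\<tau>' 6) = fst c'"
    and "\<And>r. r \<notin> {3, 6} \<union> sim_tapes V \<Longrightarrow> \<tau>' r = \<tau> r"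
    and "\<And>v. v < num_tapes V \<Longrightarrow>
      \<exists>a. \<tau>' (14 + v) = act_tape a (\<tau> (14 + v)) \<and> snd c' ! v = act_tape a (snd c ! v)"
proof -
  have rs: "map (\<lambda>i. reads \<tau> (14 + i)) [0..<num_tapes V] = map read_tape (snd c)"
    using c(1) agree_read[OF ag] by (intro nth_equalityI) (auto simp: valid_config_def reads_def)
  have ok: "set (map read_tape (snd c)) \<subseteq> {..<num_symbols V}" "fst c < num_states V"
    using c valid_reads[OF c(1)] by (simp_all add: valid_config_def)
  obtain s' acts where t: "trans V (fst c) (map read_tape (snd c)) (read_tape (\<tau> 3) = 2) = (s', acts)"
    by force
  note v = valid_trans[OF wf c(1) t]
  have len: "length (snd c) = num_tapes V" using c by (simp add: valid_config_def)
  have sa: "sim_act V (reads \<tau>) r =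
     (if r = 3 then (read_tape (\<tau> 3), Right)
      else if \<not> halted V c \<and> r = 6 then (s', Stay)
      else if \<not> halted V c \<and> r \<in> sim_tapes V then acts ! (r - 14) else (reads \<tau> r, Stay))" for r
    unfolding sim_act_def Let_def rs using ok c(2) t by (auto simp: reads_def halted_def)
  show "\<tau>' 3 = (fst (\<tau> 3), snd (\<tau> 3) + 1)"
    unfolding \<tau>' perform_def sa by simp
  show "read_tape (\<tau>' 6) = fst c'"
    unfolding \<tau>' perform_def sa c' using t c(2)
    by (cases "\<tau> 6") (auto simp: step_def reads_def)
  show "\<tau>' r = \<tau> r" if "r \<notin> {3, 6} \<union> sim_tapes V" for r
    using that unfolding \<tau>' perform_def sa by (auto simp: reads_def)
  show "\<exists>a. \<tau>' (14 + v) = act_tape a (\<tau> (14 + v)) \<and> snd c' ! v = act_tape a (snd c ! v)"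
    if "v < num_tapes V" for v
  proof (cases "halted V c")
    case True
    then have "\<tau>' (14 + v) = \<tau> (14 + v)" unfolding \<tau>' perform_def sa by (auto simp: reads_def)
    moreover have "c' = c" using True by (simp add: c' step_def)
    moreover have "act_tape (read_tape (\<tau> (14 + v)), Stay) (\<tau> (14 + v)) = \<tau> (14 + v)" by simp
    moreover have "act_tape (read_tape (\<tau> (14 + v)), Stay) (snd c ! v) = snd c ! v"
      using agree_read[OF ag[OF that]] by simp
    ultimately show ?thesis by metis
  next
    case False
    then show ?thesis using that v(2) len t
      by (intro exI[of _ "acts ! v"]) (auto simp: \<tau>' perform_def sa c' step_def)
  qed
qed

lemma act_tape_snd: "\<bar>snd (act_tape a T) - snd T\<bar> \<le> 1"
  by (cases a; cases T; cases "snd a") auto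

lemma act_tape_fst: "j \<noteq> snd T \<Longrightarrow> fst (act_tape a T) j = fst T j"
  by (cases a; cases T) auto

text \<open>Each step costs one cell of agreement, so agreement up to distance \<open>T\<close>
  lasts for \<open>T\<close> steps. Steps after halting still advance tape 3; hence every simulation
  consumes exactly \<open>T\<close> coins and the next one finds its block at a known place.\<close>

lemma wp_simulate:
  assumes wf: "wf_ptm V" and c: "valid_config V c" "read_tape (\<tau> 6) = fst c"
    and ag: "\<And>v. v < num_tapes V \<Longrightarrow> agree T (\<tau> (14 + v)) (snd c ! v)"
    and T: "ruler (\<tau> 9) T" "T \<le> B" "T \<le> e"
    and e: "\<And>v j. v \<in> sim_tapes V \<Longrightarrow> j \<ge> snd (\<tau> v) + int e \<Longrightarrow> fst (\<tau> v) j = 0"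
    and Q: "\<And>\<tau>'. (\<And>r. r \<notin> {3, 6} \<union> sim_tapes V \<Longrightarrow> \<tau>' r = \<tau> r) \<Longrightarrow>
       \<tau>' 3 = (fst (\<tau> 3), snd (\<tau> 3) + int T) \<Longrightarrow>
       read_tape (\<tau>' 6) = fst (run V (map (\<lambda>u. u = 2) (block (\<tau> 3) T)) c) \<Longrightarrow>
       (\<And>v. v \<in> sim_tapes V \<Longrightarrow> \<bar>snd (\<tau>' v) - snd (\<tau> v)\<bar> \<le> int T) \<Longrightarrow>
       (\<And>v j. v \<in> sim_tapes V \<Longrightarrow> j \<ge> snd (\<tau> v) + int e \<Longrightarrow> fst (\<tau>' v) j = 0) \<Longrightarrow> Q \<tau>'"
  shows "wp B (For 9 (Act (sim_act V))) Q \<tau>"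
proof -
  define C where "C i = run V (map (\<lambda>u. u = 2) (block (\<tau> 3) i)) c" for i
  have C0: "C 0 = c" by (simp add: C_def run_def)
  have CS: "C (Suc i) = step V (fst (\<tau> 3) (snd (\<tau> 3) + int i) = 2) (C i)" for i
    by (simp add: C_def block_Suc run_def)
  have CV: "valid_config V (C i)" for i using valid_run[OF wf c(1)] by (simp add: C_def)
  define I where "I i \<tau>' \<longleftrightarrow>
     (\<forall>r. r \<notin> {3, 6, 9} \<union> sim_tapes V \<longrightarrow> \<tau>' r = \<tau> r) \<and>
     \<tau>' 3 = (fst (\<tau> 3), snd (\<tau> 3) + int i) \<and> read_tape (\<tau>' 6) = fst (C i) \<and>
     (\<forall>v < num_tapes V. agree (T - i) (\<tau>' (14 + v)) (snd (C i) ! v)) \<and>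
     (\<forall>v \<in> sim_tapes V. \<bar>snd (\<tau>' v) - snd (\<tau> v)\<bar> \<le> int i \<and>
        (\<forall>j \<ge> snd (\<tau> v) + int e. fst (\<tau>' v) j = 0))" for i \<tau>'
  show ?thesis
  proof (rule wp_For[of \<tau> 9, OF T(1,2), where I = I])
    show "I 0 \<tau>" using c(2) ag e by (auto simp: I_def C0)
  next
    fix i \<tau>1 assume i: "i < T" "I i \<tau>1" "\<tau>1 9 = (fst (\<tau> 9), int i)"
    define \<tau>2 where "\<tau>2 = perform (sim_act V) \<tau>1"
    have I1: "read_tape (\<tau>1 6) = fst (C i)"
      "\<And>v. v < num_tapes V \<Longrightarrow> agree (T - i) (\<tau>1 (14 + v)) (snd (C i) ! v)"
      "\<And>r. r \<notin> {3, 6, 9} \<union> sim_tapes V \<Longrightarrow> \<tau>1 r = \<tau> r"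
      "\<tau>1 3 = (fst (\<tau> 3), snd (\<tau> 3) + int i)"
      "\<And>v. v \<in> sim_tapes V \<Longrightarrow> \<bar>snd (\<tau>1 v) - snd (\<tau> v)\<bar> \<le> int i"
      "\<And>v j. v \<in> sim_tapes V \<Longrightarrow> j \<ge> snd (\<tau> v) + int e \<Longrightarrow> fst (\<tau>1 v) j = 0"
      using i(2) unfolding I_def by blast+
    have CS': "C (Suc i) = step V (read_tape (\<tau>1 3) = 2) (C i)"
      by (simp add: CS I1(4))
    note P = perform_sim_act[OF wf CV[of i] I1(1) I1(2) \<tau>2_def CS']
    have 4: "agree (T - Suc i) (\<tau>2 (14 + v)) (snd (C (Suc i)) ! v)" if v: "v < num_tapes V" for v
    proof -
      obtain a where "\<tau>2 (14 + v) = act_tape a (\<tau>1 (14 + v))" "snd (C (Suc i)) ! v = act_tape a (snd (C i) ! v)"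
        using P(4)[OF _ v] by blast
      moreover have "agree (Suc (T - Suc i)) (\<tau>1 (14 + v)) (snd (C i) ! v)"
        using I1(2)[OF v] i(1) by (simp add: Suc_diff_Suc)
      ultimately show ?thesis by (metis agree_act)
    qed
    have 5: "\<bar>snd (\<tau>2 v) - snd (\<tau> v)\<bar> \<le> int (Suc i) \<and> (\<forall>j \<ge> snd (\<tau> v) + int e. fst (\<tau>2 v) j = 0)"
      if v: "v \<in> sim_tapes V" for v
    proof -
      have "v - 14 < num_tapes V" "14 + (v - 14) = v" using v by auto
      then obtain a where a: "\<tau>2 v = act_tape a (\<tau>1 v)" using P(4)[of "v - 14"] by metis
      \<comment> \<open>In step \<open>i < T\<close> the head is less than \<open>T \<le> e\<close>
        cells from its start, so no cell at distance \<open>e\<close> or more to the right is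
        written.\<close>
      have "fst (\<tau>2 v) j = 0" if "j \<ge> snd (\<tau> v) + int e" for j
        using act_tape_fst[of j "\<tau>1 v" a] I1(5)[OF v] I1(6)[OF v that] that T(3) i(1) a by auto
      then show ?thesis using act_tape_snd[of a "\<tau>1 v"] I1(5)[OF v] a by auto
    qed
    have "I (Suc i) \<tau>2" unfolding I_def
      using P(1,2,3) I1(3,4) 4 5 by (auto simp: CS')
    moreover have "\<tau>2 9 = (fst (\<tau> 9), int i)" using P(3)[of 9] i(3) by auto
    ultimately show "wp B (Act (sim_act V)) (\<lambda>\<tau>'. \<tau>' 9 = (fst (\<tau> 9), int i) \<and> I (Suc i) \<tau>') \<tau>1"
      by (intro wp_Act) (simp add: \<tau>2_def)
  next
    show "I i (shift {9} \<delta> \<tau>')" if "I i \<tau>'" for i \<tau>' \<delta>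
      using that unfolding I_def by (auto simp: shift_def)
  next
    show "Q \<tau>'" if I: "I T \<tau>'" "\<tau>' 9 = \<tau> 9" for \<tau>'
    proof (rule Q)
      show "\<tau>' r = \<tau> r" if "r \<notin> {3, 6} \<union> sim_tapes V" for r
        using I that unfolding I_def by (cases "r = 9") auto
    qed (use I in \<open>auto simp: I_def C_def\<close>)
  qed
qed

text \<open>Tapes 7 to 13 are rulers, i.e. unary numbers: the length of challenges (7), of the simulated input (8)
  and of its coins (9), the numbers of challenges to the provers (11, 12) and the acceptance threshold (13),
  whose head counts the accepting runs. The tapes of \<open>V\<close> are never erased: each simulation is run on
  a region to the right of everything written before, at a distance given by ruler 10.\<close>

definition clean :: "nat \<Rightarrow> tape \<Rightarrow> bool" where
  "clean T t \<longleftrightarrow> (\<forall>j \<ge> snd t - int T. fst t j = 0)"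

definition simulate :: "ptm \<Rightarrow> (nat \<times> nat) list \<Rightarrow> prog" where
  "simulate V srcs =
     gather 14 srcs ;; For 8 (mv {14} Left) ;;
     Act (\<lambda>\<rho> r. if r = 6 then (0, Stay) else (\<rho> r, Stay)) ;;
     For 9 (Act (sim_act V)) ;;
     Act (\<lambda>\<rho> r. if r = 13 \<and> \<rho> 6 = accept_state V then (\<rho> r, Right) else (\<rho> r, Stay)) ;;
     For 10 (mv (sim_tapes V) Right)"

definition accepts :: "ptm \<Rightarrow> bool list \<Rightarrow> nat list \<Rightarrow> bool" where
  "accepts V coins u =
     accepting V (run V coins (0, input_tape u # replicate (num_tapes V - 1) blank_tape))"

text \<open>\<open>clean\<close> is both assumed and restored, which makes the program repeatable
  without erasing anything: the final move carries the simulated heads past all earlier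
  writing.\<close>

lemma wp_simulate_all:
  assumes wf: "wf_ptm V"
    and srcs: "\<And>r s. (r, s) \<in> set srcs \<Longrightarrow>
      ruler (\<tau> r) (len r) \<and> len r \<le> B \<and> r \<noteq> s \<and> r \<noteq> 14 \<and> s \<noteq> 14"
    and u: "u = concat (map (\<lambda>(r, s). block (\<tau> s) (len r) @ [3]) srcs)" "set u \<subseteq> {..<num_symbols V}"
    and rulers: "ruler (\<tau> 8) (length u)" "length u \<le> B" "ruler (\<tau> 9) T" "T \<le> B"
      "ruler (\<tau> 10) W" "W \<le> B" "W \<ge> 3 * T + length u"
    and clean: "\<And>v. v \<in> sim_tapes V \<Longrightarrow> clean T (\<tau> v)"
    and Q: "\<And>\<tau>'. (\<And>r. r \<notin> {3, 6, 13} \<union> sim_tapes V \<Longrightarrow> \<tau>' r = \<tau> r) \<Longrightarrow>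
       \<tau>' 3 = (fst (\<tau> 3), snd (\<tau> 3) + int T) \<Longrightarrow>
       \<tau>' 13 = (fst (\<tau> 13), snd (\<tau> 13) + of_bool (accepts V (map (\<lambda>u. u = 2) (block (\<tau> 3) T)) u)) \<Longrightarrow>
       (\<And>v. v \<in> sim_tapes V \<Longrightarrow> clean T (\<tau>' v)) \<Longrightarrow> Q \<tau>'"
  shows "wp B (simulate V srcs) Q \<tau>"
proof -
  have nt: "num_tapes V \<ge> 1" "num_symbols V \<ge> 4" "num_states V \<ge> 1" using wf by (auto simp: wf_ptm_def)
  then have 14: "14 \<in> sim_tapes V" by simp
  define c where "c = (0 :: nat, input_tape u # replicate (num_tapes V - 1) blank_tape)"
  have vc: "valid_config V c" using nt u(2)
    by (auto simp: valid_config_def c_def blank_tape_def fst_input_tape subset_iff)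
  define \<tau>1 where "\<tau>1 = shift {14} (- int (length u)) (\<tau>(14 := inscribe (\<tau> 14) u))"
  define \<tau>2 where "\<tau>2 = perform (\<lambda>\<rho> r. if r = 6 then (0, Stay) else (\<rho> r, Stay)) \<tau>1"
  have \<tau>1: "\<tau>1 r = (if r = 14 then (\<lambda>j. if snd (\<tau> 14) \<le> j \<and> j < snd (\<tau> 14) + int (length u)
        then u ! nat (j - snd (\<tau> 14)) else fst (\<tau> 14) j, snd (\<tau> 14)) else \<tau> r)" for r
    unfolding \<tau>1_def by (cases "\<tau> 14") (auto simp: shift_def inscribe_closed)
  have \<tau>2: "\<tau>2 r = \<tau>1 r" if "r \<noteq> 6" for r
    using that by (simp add: \<tau>2_def perform_def reads_def)
  have \<tau>26: "read_tape (\<tau>2 6) = 0"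
    by (cases "\<tau>1 6") (simp add: \<tau>2_def perform_def)
  have h2: "snd (\<tau>2 v) = snd (\<tau> v)" if "v \<in> sim_tapes V" for v
    using that by (auto simp: \<tau>2 \<tau>1)
  have ag: "agree T (\<tau>2 (14 + v)) (snd c ! v)" if v: "v < num_tapes V" for v
  proof -
    have "clean T (\<tau> (14 + v))" using v by (intro clean) auto
    then have cl: "fst (\<tau> (14 + v)) j = 0" if "j \<ge> snd (\<tau> (14 + v)) - int T" for j
      using that by (auto simp: clean_def)
    show ?thesis
    proof (cases v)
      case 0
      show ?thesis using cl 0 unfolding agree_def
        by (auto simp: \<tau>2 \<tau>1 c_def fst_input_tape nat_less_iff)
    next
      case (Suc v')
      then show ?thesis using cl v unfolding agree_def by (auto simp: \<tau>2 \<tau>1 c_def blank_tape_def)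
    qed
  qed
  \<comment> \<open>To the right of the start, non-blank cells stem from the inscribed input,
    \<open>length u\<close> cells, or from the simulated steps, which reach at most \<open>T\<close>
    cells.\<close>
  define e where "e = max T (length u)"
  have cl2: "fst (\<tau>2 v) j = 0" if "v \<in> sim_tapes V" "j \<ge> snd (\<tau>2 v) + int e" for v j
    using clean[OF that(1)] that by (auto simp: \<tau>2 \<tau>1 clean_def e_def)
  let ?acc = "accepts V (map (\<lambda>u. u = 2) (block (\<tau> 3) T)) u"
  have b3: "\<tau>2 3 = \<tau> 3" by (simp add: \<tau>2 \<tau>1)
  have fin: "wp B (Act (\<lambda>\<rho> r. if r = 13 \<and> \<rho> 6 = accept_state V then (\<rho> r, Right) else (\<rho> r, Stay)) ;;
     For 10 (mv (sim_tapes V) Right)) Q \<tau>3"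
    if \<tau>3: "\<And>r. r \<notin> {3, 6} \<union> sim_tapes V \<Longrightarrow> \<tau>3 r = \<tau>2 r"
       "\<tau>3 3 = (fst (\<tau>2 3), snd (\<tau>2 3) + int T)"
       "read_tape (\<tau>3 6) = fst (run V (map (\<lambda>u. u = 2) (block (\<tau>2 3) T)) c)"
       "\<And>v. v \<in> sim_tapes V \<Longrightarrow> \<bar>snd (\<tau>3 v) - snd (\<tau>2 v)\<bar> \<le> int T"
       "\<And>v j. v \<in> sim_tapes V \<Longrightarrow> j \<ge> snd (\<tau>2 v) + int e \<Longrightarrow> fst (\<tau>3 v) j = 0" for \<tau>3
  proof -
    define \<tau>4 where "\<tau>4 = perform (\<lambda>\<rho> r. if r = 13 \<and> \<rho> 6 = accept_state V then (\<rho> r, Right) else (\<rho> r, Stay)) \<tau>3"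
    have acc: "reads \<tau>3 6 = accept_state V \<longleftrightarrow> ?acc"
      using \<tau>3(3) by (simp add: b3 accepts_def accepting_def c_def reads_def)
    have \<tau>4: "\<tau>4 r = (if r = 13 then (fst (\<tau> 13), snd (\<tau> 13) + of_bool ?acc) else \<tau>3 r)" for r
      using \<tau>3(1)[of 13] acc unfolding \<tau>4_def perform_def
      by (auto simp: reads_def \<tau>2 \<tau>1)
    have "Q (shift (sim_tapes V) (int W) \<tau>4)"
    proof (rule Q)
      fix r assume "r \<notin> {3, 6, 13} \<union> sim_tapes V"
      then show "shift (sim_tapes V) (int W) \<tau>4 r = \<tau> r"
        using \<tau>3(1)[of r] 14 by (auto simp: shift_def \<tau>4 \<tau>2 \<tau>1)
    next
      fix v assume v: "v \<in> sim_tapes V"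
      have "fst (\<tau>4 v) j = 0" if "j \<ge> snd (\<tau>4 v) + int W - int T" for j
      proof -
        have "v \<noteq> 13" using v by auto
        \<comment> \<open>The head may have drifted \<open>T\<close> cells to the left, and the next
          run wants \<open>T\<close> blank cells before its own start. With
          \<open>W \<ge> 3 * T + length u\<close> there remain \<open>T + length u\<close> cells, at
          least \<open>e\<close>.\<close>
        then have "j \<ge> snd (\<tau>2 v) + int e"
          using that \<tau>3(4)[OF v] rulers(7) by (auto simp: \<tau>4 e_def)
        then show ?thesis using \<tau>3(5)[OF v] \<open>v \<noteq> 13\<close> by (simp add: \<tau>4)
      qed
      then show "clean T (shift (sim_tapes V) (int W) \<tau>4 v)"
        using v by (auto simp: clean_def shift_in)
    qed (use \<tau>3(2) b3 in \<open>auto simp: shift_def \<tau>4\<close>)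
    moreover have "\<tau>4 10 = \<tau> 10" using \<tau>3(1)[of 10] by (simp add: \<tau>4 \<tau>2 \<tau>1)
    ultimately show ?thesis using rulers(5,6)
      by (intro wp_Then wp_Act, fold \<tau>4_def) (rule wp_For_mv[where m = W], auto)
  qed
  have sim: "wp B (For 9 (Act (sim_act V)) ;;
     Act (\<lambda>\<rho> r. if r = 13 \<and> \<rho> 6 = accept_state V then (\<rho> r, Right) else (\<rho> r, Stay)) ;;
     For 10 (mv (sim_tapes V) Right)) Q \<tau>2"
  proof (rule wp_Then, rule wp_simulate[OF wf vc _ ag _ rulers(4), where e = e])
    show "read_tape (\<tau>2 6) = fst c" by (simp add: \<tau>26 c_def)
    show "ruler (\<tau>2 9) T" using rulers by (simp add: \<tau>2 \<tau>1)
    show "T \<le> e" by (simp add: e_def)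
  qed (use cl2 fin in blast)+
  have act0: "wp B (Act (\<lambda>\<rho> r. if r = 6 then (0, Stay) else (\<rho> r, Stay)) ;; For 9 (Act (sim_act V)) ;;
     Act (\<lambda>\<rho> r. if r = 13 \<and> \<rho> 6 = accept_state V then (\<rho> r, Right) else (\<rho> r, Stay)) ;;
     For 10 (mv (sim_tapes V) Right)) Q \<tau>1"
    by (rule wp_Then, rule wp_Act, fold \<tau>2_def, rule sim)
  show ?thesis unfolding simulate_def
  proof (rule wp_Then, rule wp_gather[where len = len, OF srcs], assumption, fold u(1), rule wp_Then,
      rule wp_For_mv[where m = "length u"])
    show "wp B (Act (\<lambda>\<rho> r. if r = 6 then (0, Stay) else (\<rho> r, Stay)) ;; For 9 (Act (sim_act V)) ;;
     Act (\<lambda>\<rho> r. if r = 13 \<and> \<rho> 6 = accept_state V then (\<rho> r, Right) else (\<rho> r, Stay)) ;;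
     For 10 (mv (sim_tapes V) Right)) Q (shift {14} (int (length u) * move Left 0) (\<tau>(14 := inscribe (\<tau> 14) u)))"
      using act0 by (simp add: \<tau>1_def)
  qed (use rulers in auto)
qed

lemma poly_nat_mono: "m \<le> n \<Longrightarrow> poly (P :: nat poly) m \<le> poly P n"
  by (induction P) (auto intro!: add_mono mult_mono)

section \<open>Tape and symbol bounds of the programs\<close>

lemma wf_mv: "D \<subseteq> {..<K} \<Longrightarrow> wf_prog K S (mv D d)"
  by (auto simp: mv_def wf_act_def)

lemma wf_rewind: "D \<subseteq> {..<K} \<Longrightarrow> wf_prog K S (rewind r D)"
  by (simp add: rewind_def wf_mv)

lemma wf_For: "r < K \<Longrightarrow> wf_prog K S p \<Longrightarrow> wf_prog K S (For r p)"
  by (simp add: For_def wf_mv wf_rewind)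

lemma wf_put: "v < K \<Longrightarrow> a < S \<Longrightarrow> wf_prog K S (put v a)"
  by (auto simp: put_def wf_act_def)

lemma wf_copy: "v < K \<Longrightarrow> s < K \<Longrightarrow> wf_prog K S (copy v s)"
  by (auto simp: copy_def wf_act_def)

lemma wf_load: "d \<in> D \<Longrightarrow> D \<subseteq> {..<K} \<Longrightarrow> wf_prog K S (load d D)"
  by (auto simp: load_def wf_act_def wf_mv wf_rewind)

lemma wf_skip: "wf_prog K S skip"
  by (simp add: skip_def wf_mv)

lemma wf_repeat: "wf_prog K S p \<Longrightarrow> wf_prog K S (repeat n p)"
  by (induction n) (auto simp: wf_skip)

lemma wf_horner: "X + length cs \<le> K \<Longrightarrow> wf_prog K S p \<Longrightarrow> wf_prog K S (horner X cs p)"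
  by (induction cs arbitrary: X) (auto simp: wf_skip wf_For wf_repeat)

lemma wf_make_rulers:
  "(\<And>v P. (v, P) \<in> set l \<Longrightarrow> v < K \<and> X + length (coeffs P) \<le> K) \<Longrightarrow> S \<ge> 2 \<Longrightarrow>
    wf_prog K S (make_rulers X l)"
proof (induction l)
  case (Cons a l)
  obtain v P where a: "a = (v, P)" by (cases a)
  have "wf_prog K S (make_rulers X l)" using Cons.prems by (intro Cons.IH) auto
  then show ?case using Cons.prems(1)[of v P] Cons.prems(2)
    by (simp add: a make_ruler_def wf_horner wf_put wf_rewind)
qed (simp add: wf_skip)

lemma wf_gather:
  "v < K \<Longrightarrow> S \<ge> 4 \<Longrightarrow> (\<And>r s. (r, s) \<in> set l \<Longrightarrow> r < K \<and> s < K) \<Longrightarrow> wf_prog K S (gather v l)"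
proof (induction l)
  case (Cons a l)
  obtain r s where a: "a = (r, s)" by (cases a)
  have "wf_prog K S (gather v l)" using Cons.prems by (intro Cons.IH) auto
  then show ?case using Cons.prems(1,2) Cons.prems(3)[of r s]
    by (simp add: a wf_put wf_copy wf_For wf_mv)
qed (simp add: wf_skip)

text \<open>Outside the valid states and symbols \<open>trans\<close> is arbitrary and might leave
  the alphabet; the test \<open>live\<close> excludes such reads. \<open>S\<close> bounds the states
  as well because tape 6 stores the state as a symbol.\<close>

lemma wf_sim_act:
  assumes wf: "wf_ptm V" and "14 + num_tapes V \<le> K" "num_symbols V \<le> S" "num_states V \<le> S"
  shows "wf_act K S (sim_act V)"
  unfolding wf_act_def
proof (intro conjI allI impI)
  fix \<rho> :: "nat \<Rightarrow> nat" and r assume \<rho>: "\<forall>r<K. \<rho> r < S" and r: "r < K"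
  define rs where "rs = map (\<lambda>i. \<rho> (14 + i)) [0..<num_tapes V]"
  obtain s' acts where t: "trans V (\<rho> 6) rs (\<rho> 3 = 2) = (s', acts)" by force
  have all: "\<forall>s < num_states V. \<forall>reads coin.
        length reads = num_tapes V \<and> set reads \<subseteq> {..<num_symbols V} \<longrightarrow>
        (case trans V s reads coin of (s', acts) \<Rightarrow>
           s' < num_states V \<and> length acts = num_tapes V \<and>
           fst ` set acts \<subseteq> {..<num_symbols V})"
    using wf unfolding wf_ptm_def by (elim conjE)
  have live: "s' < num_states V \<and> length acts = num_tapes V \<and> fst ` set acts \<subseteq> {..<num_symbols V}"
    if "\<rho> 6 < num_states V" "set rs \<subseteq> {..<num_symbols V}"
    using all[rule_format, of "\<rho> 6" rs "\<rho> 3 = 2"] that t by (simp add: rs_def)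
  have "fst (acts ! (r - 14)) < num_symbols V"
    if "\<rho> 6 < num_states V" "set rs \<subseteq> {..<num_symbols V}" "14 \<le> r" "r < 14 + num_tapes V"
  proof -
    have "acts ! (r - 14) \<in> set acts" using live that by (intro nth_mem) auto
    then show ?thesis using live[OF that(1,2)] by auto
  qed
  then show "fst (sim_act V \<rho> r) < S"
    using \<rho> r live assms(3,4) unfolding sim_act_def rs_def[symmetric] Let_def t
    by (auto intro: order_less_le_trans)
next
  fix \<rho> r assume "K \<le> r"
  then show "sim_act V \<rho> r = (\<rho> r, Stay)" using assms(2) by (simp add: sim_act_def Let_def)
qed

lemma wf_simulate:
  assumes "wf_ptm V" "14 + num_tapes V \<le> K" "num_symbols V \<le> S" "num_states V \<le> S"
    and "\<And>r s. (r, s) \<in> set srcs \<Longrightarrow> r < K \<and> s < K"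
  shows "wf_prog K S (simulate V srcs)"
proof -
  have "num_tapes V \<ge> 1" "num_symbols V \<ge> 4" using assms(1) by (auto simp: wf_ptm_def)
  moreover from this have "wf_act K S (\<lambda>\<rho> r. if r = 6 then (0, Stay) else (\<rho> r, Stay))"
     "wf_act K S (\<lambda>\<rho> r. if r = 13 \<and> \<rho> 6 = accept_state V then (\<rho> r, Right) else (\<rho> r, Stay))"
    using assms(2-4) by (auto simp: wf_act_def)
  ultimately show ?thesis unfolding simulate_def using assms
    by (auto simp: wf_gather wf_sim_act intro!: wf_For wf_mv)
qed

text \<open>Cells behind the end of \<open>w\<close> count as blanks, so the programs have a
  definite outcome on strings of any length.\<close>

definition cut :: "bool list \<Rightarrow> nat \<Rightarrow> nat \<Rightarrow> nat list" where
  "cut w h m = block (fst (input_tape (bit_syms w)), int h) m"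

lemma cut_eq: "h + m \<le> length w \<Longrightarrow> cut w h m = bit_syms (take m (drop h w))"
  by (rule nth_equalityI)
     (auto simp: cut_def block_def fst_input_tape bit_syms_def nat_add_distrib)

lemma length_cut [simp]: "length (cut w h m) = m"
  by (simp add: cut_def)

lemma set_cut: "set (cut w h m) \<subseteq> {..<3}"
  by (auto simp: cut_def block_def fst_input_tape bit_syms_def)

definition bits_of :: "nat list \<Rightarrow> bool list" where
  "bits_of u = map (\<lambda>a. a = 2) u"

lemma bits_of_bit_syms [simp]: "bits_of (bit_syms w) = w"
  by (induction w) (auto simp: bits_of_def bit_syms_def)

text \<open>The number of tapes holding a copy of \<open>x\<close> that suffices for \<open>make_rulers\<close>.\<close>

definition spare :: "(nat \<times> nat poly) list \<Rightarrow> nat" where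
  "spare l = 2 + (\<Sum>(v, P) \<leftarrow> l. length (coeffs P))"

lemma length_coeffs_le_spare: "(v, P) \<in> set l \<Longrightarrow> length (coeffs P) \<le> spare l"
  unfolding spare_def using member_le_sum_list[of "length (coeffs P)" "map (\<lambda>(v, P). length (coeffs P)) l"]
  by force

text \<open>One bound for all loops: the linear term covers the components of the input tuple, each
  summand covers a ruler.\<close>

definition bound :: "(nat \<times> nat poly) list \<Rightarrow> nat poly" where
  "bound l = [:0, 1:] + (\<Sum>(v, P) \<leftarrow> l. P)"

lemma poly_sum_list: "poly (sum_list l) x = (\<Sum>P\<leftarrow>l. poly P x)"
  by (induction l) auto

lemma le_bound: "m \<le> poly (bound l) m"
  by (simp add: bound_def)

lemma poly_le_bound:
  assumes "(v, P) \<in> set l" "n \<le> m"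
  shows "poly P n \<le> poly (bound l) m"
proof -
  have "P \<in> set (map (\<lambda>(v, P). P) l)" using assms(1) by force
  then have "poly P m \<le> (\<Sum>P\<leftarrow>map (\<lambda>(v, P). P) l. poly P m)"
    by (intro member_le_sum_list) force+
  then show ?thesis using poly_nat_mono[OF assms(2), of P]
    by (simp add: bound_def poly_sum_list)
qed

lemma length_le_encode: "w \<in> set ws \<Longrightarrow> length w \<le> length (encode ws)"
  by (induction ws) auto

text \<open>Number of the first tape holding a copy of the input \<open>x\<close>.\<close>

abbreviation copies :: "ptm \<Rightarrow> nat" where
  "copies V \<equiv> 14 + num_tapes V"

lemma block_input_tape [simp]: "block (input_tape (bit_syms w)) (length w) = bit_syms w"
  by (rule nth_equalityI) (auto simp: block_def fst_input_tape)

lemma cut_0: "cut w 0 m = block (input_tape (bit_syms w)) m"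
  by (simp add: cut_def block_def)

lemma set_bit_syms: "set (bit_syms w) \<subseteq> {..<3}"
  by (auto simp: bit_syms_def)

text \<open>Tape 13 counts accepting runs by its head position, so a blank under this head is the
  test that the threshold \<open>m\<close> has been reached.\<close>

lemma unary_past_end: "fst (unary m) (int i) = 0 \<longleftrightarrow> m \<le> i"
  by (auto simp: unary_def fst_input_tape)

definition run_once :: "ptm \<Rightarrow> (nat \<times> nat poly) list \<Rightarrow> prog" where
  "run_once V l =
     load (copies V) {copies V..<copies V + spare l} ;; load 1 {1} ;; load 3 {3} ;; load 4 {4} ;;
     make_rulers (copies V) l ;;
     simulate V [(copies V, copies V + 1), (7, 1), (7, 4)]"

text \<open>Writing \<open>x\<close> into the simulated input takes two copies at once, one as ruler
  and one as source.\<close>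

lemma spare_ge: "spare l \<ge> 2" by (simp add: spare_def)

lemma wf_run_once:
  assumes "wf_ptm V" "num_symbols V \<le> S" "num_states V \<le> S" "S \<ge> 4" "\<forall>(v, P) \<in> set l. v < 14"
  shows "wf_prog (copies V + spare l) S (run_once V l)"
proof -
  have "wf_prog (copies V + spare l) S (make_rulers (copies V) l)"
    using assms(4,5) length_coeffs_le_spare[of _ _ l] by (intro wf_make_rulers) fastforce+
  moreover have "wf_prog (copies V + spare l) S (simulate V [(copies V, copies V + 1), (7, 1), (7, 4)])"
    using assms spare_ge[of l] by (intro wf_simulate) auto
  ultimately show ?thesis using spare_ge[of l] by (auto simp: run_once_def intro!: wf_load)
qed

text \<open>No lengths are assumed because \<open>poly_time_ptm\<close> quantifies over all tuples
  of strings. The second challenge is loaded onto tape 3, the coin tape.\<close>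

lemma wp_run_once:
  assumes wf: "wf_ptm V" and l: "l = [(7, q), (8, U), (9, p), (10, W), (13, 1)]"
    and U: "\<And>n. poly U n = n + 2 * poly q n + 3" and W: "\<And>n. poly W n = 3 * poly p n + poly U n"
    and ws: "ws = [x, y1, y2, b1, b2]"
  shows "wp (poly (bound l) (length (encode ws))) (run_once V l)
    (\<lambda>\<tau>. reads \<tau> 13 = 0 \<longleftrightarrow> accepts V (bits_of (cut y2 0 (poly p (length x))))
       (bit_syms x @ [3] @ cut y1 0 (poly q (length x)) @ [3] @ cut b1 0 (poly q (length x)) @ [3]))
    (init_tapes ws)"
proof -
  define n B X where "n = length x" and "B = poly (bound l) (length (encode ws))" and "X = copies V"
  have le: "length w \<le> B" if "w \<in> set ws" for w
    using length_le_encode[OF that] le_bound[of "length (encode ws)" l] by (simp add: B_def)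
  have n: "n \<le> B" using le[of x] by (simp add: ws n_def)
  have P: "poly P n \<le> B" if "(v, P) \<in> set l" for v P
    using poly_le_bound[OF that] length_le_encode[of x ws] by (simp add: ws n_def B_def)
  have nt: "num_symbols V \<ge> 4" and X14: "X \<noteq> 14" using wf by (auto simp: wf_ptm_def X_def)
  let ?D = "{X..<X + spare l}"
  have X: "X \<ge> 14" "X \<in> ?D" "Suc X \<in> ?D" using spare_ge[of l] by (auto simp: X_def)
  define u where "u = bit_syms x @ [3] @ cut y1 0 (poly q n) @ [3] @ cut b1 0 (poly q n) @ [3]"
  let ?acc = "accepts V (bits_of (cut y2 0 (poly p n))) u"
  define \<tau>1 where "\<tau>1 = (\<lambda>r. if r \<in> ?D then input_tape (bit_syms x) else if r = 1 then input_tape (bit_syms y1)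
      else if r = 3 then input_tape (bit_syms y2) else if r = 4 then input_tape (bit_syms b1)
      else if r = 0 then (fst (input_tape (encode ws)), int (length (encode [x, y1, y2, b1]))) else blank_tape)"
  define \<tau>2 where "\<tau>2 = (\<lambda>r. case map_of l r of Some P \<Rightarrow> unary (poly P n) | None \<Rightarrow> \<tau>1 r)"
  have sim: "wp B (simulate V [(X, X + 1), (7, 1), (7, 4)]) (\<lambda>\<tau>. reads \<tau> 13 = 0 \<longleftrightarrow> ?acc) \<tau>2"
  proof (rule wp_simulate_all[OF wf, where len = "\<lambda>r. if r = X then n else poly q n" and u = u
        and T = "poly p n" and W = "poly W n"])
    show "u = concat (map (\<lambda>(r, s). block (\<tau>2 s) (if r = X then n else poly q n) @ [3])
       [(X, X + 1), (7, 1), (7, 4)])"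
      using X by (auto simp: u_def \<tau>2_def \<tau>1_def l n_def cut_0)
    show "set u \<subseteq> {..<num_symbols V}"
      using nt set_cut[of y1 0 "poly q n"] set_cut[of b1 0 "poly q n"] set_bit_syms[of x]
      by (auto simp: u_def subset_iff)
    show "clean (poly p n) (\<tau>2 v)" if "v \<in> sim_tapes V" for v
      using that by (auto simp: \<tau>2_def \<tau>1_def l X_def clean_def blank_tape_def)
    have lu: "length u = poly U n" by (simp add: u_def U n_def)
    show "ruler (\<tau>2 8) (length u)" "ruler (\<tau>2 9) (poly p n)" "ruler (\<tau>2 10) (poly W n)"
      "length u \<le> B" "poly p n \<le> B" "poly W n \<le> B" "poly W n \<ge> 3 * poly p n + length u"
      using P[of 8 U] P[of 9 p] P[of 10 W] by (simp_all add: \<tau>2_def l lu W)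
    have r: "\<tau>2 X = input_tape (bit_syms x)" "\<tau>2 7 = unary (poly q n)"
      using X by (auto simp: \<tau>2_def \<tau>1_def l)
    fix r s assume "(r, s) \<in> set [(X, X + 1), (7, 1), (7, 4)]"
    then show "ruler (\<tau>2 r) (if r = X then n else poly q n) \<and>
       (if r = X then n else poly q n) \<le> B \<and> r \<noteq> s \<and> r \<noteq> 14 \<and> s \<noteq> 14"
      using X X14 P[of 7 q] n ruler_input_tape[of "bit_syms x"] r by (auto simp: l n_def)
  next
    fix \<tau>' :: tapes assume "\<tau>' 13 = (fst (\<tau>2 13), snd (\<tau>2 13) +
       of_bool (accepts V (map (\<lambda>u. u = 2) (block (\<tau>2 3) (poly p n))) u))"
    moreover have "map (\<lambda>u. u = 2) (block (\<tau>2 3) (poly p n)) = bits_of (cut y2 0 (poly p n))"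
      by (simp add: \<tau>2_def \<tau>1_def l X_def bits_of_def cut_def input_tape_def)
    ultimately have "\<tau>' 13 = (fst (unary 1), int (of_bool ?acc))"
      by (simp add: \<tau>2_def l unary_def)
    then show "reads \<tau>' 13 = 0 \<longleftrightarrow> ?acc"
      by (auto simp: reads_def unary_past_end simp del: of_nat_of_bool)
  qed
  have rul: "wp B (make_rulers X l ;; simulate V [(X, X + 1), (7, 1), (7, 4)])
     (\<lambda>\<tau>. reads \<tau> 13 = 0 \<longleftrightarrow> ?acc) \<tau>1"
  proof (rule wp_Then, rule wp_make_rulers[where n = n], goal_cases)
    case (1 i P)
    then have "i < spare l" using length_coeffs_le_spare[of _ P l] by fastforce
    then show ?case using ruler_input_tape[of "bit_syms x"] by (simp add: \<tau>1_def n_def)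
  next
    case 6
    then show ?case using sim by (simp add: \<tau>2_def)
  qed (use P[of 7 q] P[of 8 U] P[of 9 p] P[of 10 W] P[of 13 1] n X in \<open>auto simp: l \<tau>1_def\<close>)
  show ?thesis
    unfolding run_once_def X_def[symmetric] B_def[symmetric] n_def[symmetric] u_def[symmetric]
  proof (rule wp_Then, rule wp_load[where us = "[]" and w = x and vs = "[y1, y2, b1, b2]"],
      goal_cases)
    case 6
    show ?case
    proof (rule wp_Then, rule wp_load[where us = "[x]" and w = y1 and vs = "[y2, b1, b2]"], goal_cases)
      case 6
      show ?case
      proof (rule wp_Then, rule wp_load[where us = "[x, y1]" and w = y2 and vs = "[b1, b2]"], goal_cases)
        case 6
        show ?case
        proof (rule wp_Then, rule wp_load[where us = "[x, y1, y2]" and w = b1 and vs = "[b2]"], goal_cases)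
          case 6
          show ?case
            by (rule back_subst[where P = "wp _ _ _", OF rul]) (use X in \<open>auto simp: \<tau>1_def ws fun_eq_iff init_tapes_def\<close>)
        qed (use X le in \<open>auto simp: init_tapes_def ws\<close>)
      qed (use X le in \<open>auto simp: init_tapes_def ws\<close>)
    qed (use X le in \<open>auto simp: init_tapes_def ws\<close>)
  qed (use X le in \<open>auto simp: init_tapes_def ws input_tape_def\<close>)
qed


text \<open>The challenge consists of \<open>M\<close> challenges for the first prover, \<open>N\<close> challenges for the second one
  and a block of coins for each pair; the answer consists of \<open>M\<close> and \<open>N\<close> answers.\<close>

definition run_pairs :: "ptm \<Rightarrow> (nat \<times> nat poly) list \<Rightarrow> prog" where
  "run_pairs V l =
     load (copies V) {copies V..<copies V + spare l} ;; load 1 {1, 2, 3} ;; load 4 {4, 5} ;;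
     make_rulers (copies V) l ;;
     For 11 (For 7 (mv {2, 3, 5} Right)) ;; For 12 (For 7 (mv {3} Right)) ;;
     For 11
       (For 12 (simulate V [(copies V, copies V + 1), (7, 1), (7, 2), (7, 4), (7, 5)] ;;
                For 7 (mv {2, 5} Right)) ;;
        For 12 (For 7 (mv {2, 5} Left)) ;;
        For 7 (mv {1, 4} Right))"

lemma wf_run_pairs:
  assumes "wf_ptm V" "num_symbols V \<le> S" "num_states V \<le> S" "S \<ge> 4" "\<forall>(v, P) \<in> set l. v < 14"
  shows "wf_prog (copies V + spare l) S (run_pairs V l)"
proof -
  have "wf_prog (copies V + spare l) S (make_rulers (copies V) l)"
    using assms(4,5) length_coeffs_le_spare[of _ _ l] by (intro wf_make_rulers) fastforce+
  moreover have "wf_prog (copies V + spare l) S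
      (simulate V [(copies V, copies V + 1), (7, 1), (7, 2), (7, 4), (7, 5)])"
    using assms spare_ge[of l] by (intro wf_simulate) auto
  ultimately show ?thesis using spare_ge[of l] unfolding run_pairs_def
    by (auto intro!: wf_load wf_For wf_mv)
qed

section \<open>Correctness of the program running all pairs\<close>

locale pairs =
  fixes V :: ptm and q U p W M N H :: "nat poly"
  assumes wf: "wf_ptm V"
    and U: "\<And>n. poly U n = n + 4 * poly q n + 5"
    and W: "\<And>n. poly W n = 3 * poly p n + poly U n"
begin

definition l :: "(nat \<times> nat poly) list" where
  "l = [(7, q), (8, U), (9, p), (10, W), (11, M), (12, N), (13, H)]"

definition word :: "bool list \<Rightarrow> bool list \<Rightarrow> bool list \<Rightarrow> nat \<Rightarrow> nat \<Rightarrow> nat list" where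
  "word x y b i j =
     (let n = length x; L = poly q n in
      bit_syms x @ [3] @ cut y (i * L) L @ [3] @ cut y ((poly M n + j) * L) L @ [3] @
      cut b (i * L) L @ [3] @ cut b ((poly M n + j) * L) L @ [3])"

definition hit :: "bool list \<Rightarrow> bool list \<Rightarrow> bool list \<Rightarrow> nat \<Rightarrow> nat \<Rightarrow> bool" where
  "hit x y b i j =
     (let n = length x; T = poly p n in
      accepts V
        (bits_of (cut y ((poly M n + poly N n) * poly q n + (i * poly N n + j) * T) T))
        (word x y b i j))"

text \<open>Invariant of the nested loops; \<open>E\<close> holds the rulers whose heads are in use
  as loop counters. The column \<open>j\<close> and the number \<open>c\<close> of spent coin blocks
  are separate since the heads on the second prover's blocks return after every row, whereas the
  coin head only moves forward.\<close>

definition stage :: "bool list \<Rightarrow> bool list \<Rightarrow> bool list \<Rightarrow> nat set \<Rightarrow> nat \<Rightarrow> nat \<Rightarrow> nat \<Rightarrow> nat \<Rightarrow> tapes \<Rightarrow> bool" where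
  "stage x y b E i j c a \<tau> \<longleftrightarrow>
     (let n = length x; L = poly q n; Y = fst (input_tape (bit_syms y)); A = fst (input_tape (bit_syms b)) in
     (\<forall>s < spare l. \<tau> (copies V + s) = input_tape (bit_syms x)) \<and>
     (\<forall>(v, P) \<in> set l. v \<notin> E \<union> {13} \<longrightarrow> \<tau> v = unary (poly P n)) \<and>
     (\<forall>v \<in> sim_tapes V. clean (poly p n) (\<tau> v)) \<and>
     \<tau> 1 = (Y, int (i * L)) \<and> \<tau> 4 = (A, int (i * L)) \<and>
     \<tau> 2 = (Y, int ((poly M n + j) * L)) \<and> \<tau> 5 = (A, int ((poly M n + j) * L)) \<and>
     \<tau> 3 = (Y, int ((poly M n + poly N n) * L + c * poly p n)) \<and>
     \<tau> 13 = (fst (unary (poly H n)), int a))"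

lemma stage_shift:
  "stage x y b E i j c a \<tau> \<Longrightarrow> r \<in> E \<Longrightarrow> E \<subseteq> {11, 12} \<Longrightarrow> stage x y b E i j c a (shift {r} \<delta> \<tau>)"
  unfolding stage_def Let_def by (auto simp: shift_def)

context
  fixes x y b :: "bool list" and B n :: nat
  assumes n: "n = length x" "n \<le> B"
    and P: "\<And>v P. (v, P) \<in> set l \<Longrightarrow> poly P n \<le> B"
begin

lemma wp_hit:
  assumes st: "stage x y b {11, 12} i j (i * poly N n + j) a \<tau>"
    and Q: "\<And>\<tau>'. stage x y b {11, 12} i j (i * poly N n + Suc j) (a + of_bool (hit x y b i j)) \<tau>' \<Longrightarrow>
      \<tau>' 11 = \<tau> 11 \<Longrightarrow> \<tau>' 12 = \<tau> 12 \<Longrightarrow> Q \<tau>'"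
  shows "wp B (simulate V [(copies V, copies V + 1), (7, 1), (7, 2), (7, 4), (7, 5)]) Q \<tau>"
proof -
  define X L where "X = copies V" and "L = poly q n"
  let ?len = "\<lambda>r. if r = X then n else L"
  note st' = st[unfolded stage_def Let_def, folded n(1)]
  have x: "\<tau> (X + s) = input_tape (bit_syms x)" if "s < spare l" for s
    using st' that by (simp add: X_def)
  have x0: "\<tau> X = input_tape (bit_syms x)" "\<tau> (Suc X) = input_tape (bit_syms x)"
    using x[of 0] x[of 1] spare_ge[of l] by auto
  have r: "\<tau> 7 = unary (poly q n)" "\<tau> 8 = unary (poly U n)" "\<tau> 9 = unary (poly p n)"
     "\<tau> 10 = unary (poly W n)" using st' by (auto simp: l_def)
  have nt: "num_symbols V \<ge> 4" "num_tapes V \<ge> 1" using wf by (auto simp: wf_ptm_def)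
  show ?thesis unfolding X_def[symmetric]
  proof (rule wp_simulate_all[OF wf, where len = ?len and u = "word x y b i j"
        and T = "poly p n" and W = "poly W n"])
    show "word x y b i j = concat (map (\<lambda>(r, s). block (\<tau> s) (?len r) @ [3])
       [(X, X + 1), (7, 1), (7, 2), (7, 4), (7, 5)])"
      using st' x0 by (simp add: word_def Let_def L_def X_def cut_def n)
    show "set (word x y b i j) \<subseteq> {..<num_symbols V}"
      using nt(1) set_bit_syms[of x] set_cut[of y "i * L" L] set_cut[of b "i * L" L]
        set_cut[of y "(poly M n + j) * L" L] set_cut[of b "(poly M n + j) * L" L]
      unfolding word_def Let_def n(1)[symmetric] L_def[symmetric]
      by (auto simp: subset_iff)
    show "clean (poly p n) (\<tau> v)" if "v \<in> sim_tapes V" for v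
      using st' that by blast
    have lu: "length (word x y b i j) = poly U n" by (simp add: word_def Let_def U n)
    show "ruler (\<tau> 8) (length (word x y b i j))" "ruler (\<tau> 9) (poly p n)" "ruler (\<tau> 10) (poly W n)"
      "length (word x y b i j) \<le> B" "poly p n \<le> B" "poly W n \<le> B"
      "poly W n \<ge> 3 * poly p n + length (word x y b i j)"
      using P[of 8 U] P[of 9 p] P[of 10 W] by (simp_all add: r lu W l_def)
    fix r' s assume "(r', s) \<in> set [(X, X + 1), (7, 1), (7, 2), (7, 4), (7, 5)]"
    then show "ruler (\<tau> r') (?len r') \<and> ?len r' \<le> B \<and> r' \<noteq> s \<and> r' \<noteq> 14 \<and> s \<noteq> 14"
      using P[of 7 q] nt(2) n ruler_input_tape[of "bit_syms x"] x0
      by (auto simp: l_def X_def L_def r)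
  next
    fix \<tau>'
    assume fr: "\<And>r. r \<notin> {3, 6, 13} \<union> sim_tapes V \<Longrightarrow> \<tau>' r = \<tau> r"
      and 3: "\<tau>' 3 = (fst (\<tau> 3), snd (\<tau> 3) + int (poly p n))"
      and 13: "\<tau>' 13 = (fst (\<tau> 13), snd (\<tau> 13) +
         of_bool (accepts V (map (\<lambda>u. u = 2) (block (\<tau> 3) (poly p n))) (word x y b i j)))"
      and cl: "\<And>v. v \<in> sim_tapes V \<Longrightarrow> clean (poly p n) (\<tau>' v)"
    have "hit x y b i j = accepts V (map (\<lambda>u. u = 2) (block (\<tau> 3) (poly p n))) (word x y b i j)"
      using st' by (simp add: hit_def Let_def n bits_of_def cut_def)
    then have "\<tau>' 13 = (fst (unary (poly H n)), int (a + of_bool (hit x y b i j)))"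
      using 13 st' by simp
    moreover have "\<tau>' 3 = (fst (input_tape (bit_syms y)),
        int ((poly M n + poly N n) * L + (i * poly N n + Suc j) * poly p n))"
      using 3 st' by (simp add: L_def algebra_simps)
    moreover have "\<tau>' (copies V + s) = \<tau> (copies V + s)" for s by (rule fr) auto
    ultimately have "stage x y b {11, 12} i j (i * poly N n + Suc j) (a + of_bool (hit x y b i j)) \<tau>'"
      using st' fr cl unfolding stage_def Let_def n(1)[symmetric] L_def[symmetric]
      by (auto simp: l_def)
    then show "Q \<tau>'" by (rule Q) (auto intro: fr)
  qed
qed

lemma wp_row:
  assumes st: "stage x y b {11} i 0 (i * poly N n) a \<tau>"
    and Q: "\<And>\<tau>'. stage x y b {11} i (poly N n) (Suc i * poly N n) (a + (\<Sum>j<poly N n. of_bool (hit x y b i j))) \<tau>' \<Longrightarrow>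
      \<tau>' 11 = \<tau> 11 \<Longrightarrow> Q \<tau>'"
  shows "wp B (For 12 (simulate V [(copies V, copies V + 1), (7, 1), (7, 2), (7, 4), (7, 5)] ;;
                For 7 (mv {2, 5} Right))) Q \<tau>"
proof -
  have \<tau>12: "\<tau> 12 = unary (poly N n)" using st by (auto simp: stage_def Let_def l_def n)
  show ?thesis
  proof (rule wp_For[where m = "poly N n" and I = "\<lambda>j \<tau>'. \<tau>' 11 = \<tau> 11 \<and>
      stage x y b {11, 12} i j (i * poly N n + j) (a + (\<Sum>j<j. of_bool (hit x y b i j))) \<tau>'"])
    show "\<tau> 11 = \<tau> 11 \<and> stage x y b {11, 12} i 0 (i * poly N n + 0) (a + (\<Sum>j<0. of_bool (hit x y b i j))) \<tau>"
      using st unfolding stage_def Let_def by auto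
  next
    fix j \<tau>1
    assume j: "j < poly N n" "\<tau>1 11 = \<tau> 11 \<and>
      stage x y b {11, 12} i j (i * poly N n + j) (a + (\<Sum>j<j. of_bool (hit x y b i j))) \<tau>1"
      "\<tau>1 12 = (fst (\<tau> 12), int j)"
    show "wp B (simulate V [(copies V, copies V + 1), (7, 1), (7, 2), (7, 4), (7, 5)] ;; For 7 (mv {2, 5} Right))
       (\<lambda>\<tau>'. \<tau>' 12 = (fst (\<tau> 12), int j) \<and> \<tau>' 11 = \<tau> 11 \<and>
          stage x y b {11, 12} i (Suc j) (i * poly N n + Suc j) (a + (\<Sum>j<Suc j. of_bool (hit x y b i j))) \<tau>') \<tau>1"
    proof (rule wp_Then, rule wp_hit[OF conjunct2[OF j(2)]], goal_cases)
      case (1 \<tau>2)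
      have 7: "\<tau>2 7 = unary (poly q n)" using 1(1) by (auto simp: stage_def Let_def l_def n)
      show ?case
      proof (rule wp_For_mv[where m = "poly q n"], goal_cases)
        case 4
        then show ?case using 1 j unfolding stage_def Let_def n(1)[symmetric]
          by (auto simp: shift_def l_def algebra_simps)
      qed (use 7 P[of 7 q] in \<open>auto simp: l_def\<close>)
    qed
  next
    show "shift {12} \<delta> \<tau>2 11 = \<tau> 11 \<and> stage x y b {11, 12} i j (i * poly N n + j) (a + (\<Sum>j<j. of_bool (hit x y b i j))) (shift {12} \<delta> \<tau>2)" if
       "\<tau>2 11 = \<tau> 11 \<and> stage x y b {11, 12} i j (i * poly N n + j) (a + (\<Sum>j<j. of_bool (hit x y b i j))) \<tau>2" for j \<delta> \<tau>2
      using that stage_shift[of x y b "{11, 12}"] by (simp add: shift_notin)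
    fix \<tau>2 assume 2: "\<tau>2 11 = \<tau> 11 \<and> stage x y b {11, 12} i (poly N n) (i * poly N n + poly N n)
       (a + (\<Sum>j<poly N n. of_bool (hit x y b i j))) \<tau>2" "\<tau>2 12 = \<tau> 12"
    have "stage x y b {11} i (poly N n) (Suc i * poly N n) (a + (\<Sum>j<poly N n. of_bool (hit x y b i j))) \<tau>2"
      using 2 \<tau>12 unfolding stage_def Let_def n(1)[symmetric] by (auto simp: l_def algebra_simps)
    then show "Q \<tau>2" using 2 by (intro Q) auto
  qed (use \<tau>12 P[of 12 N] in \<open>auto simp: l_def\<close>)
qed

lemma wp_table:
  assumes st: "stage x y b {} 0 0 0 0 \<tau>"
    and Q: "\<And>\<tau>'. stage x y b {} (poly M n) 0 (poly M n * poly N n)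
       (\<Sum>i<poly M n. \<Sum>j<poly N n. of_bool (hit x y b i j)) \<tau>' \<Longrightarrow> Q \<tau>'"
  shows "wp B (For 11
       (For 12 (simulate V [(copies V, copies V + 1), (7, 1), (7, 2), (7, 4), (7, 5)] ;;
                For 7 (mv {2, 5} Right)) ;;
        For 12 (For 7 (mv {2, 5} Left)) ;;
        For 7 (mv {1, 4} Right))) Q \<tau>"
proof -
  have \<tau>11: "\<tau> 11 = unary (poly M n)" using st by (auto simp: stage_def Let_def l_def n)
  let ?I = "\<lambda>i \<tau>'. stage x y b {11} i 0 (i * poly N n) (\<Sum>i<i. \<Sum>j<poly N n. of_bool (hit x y b i j)) \<tau>'"
  show ?thesis
  proof (rule wp_For[where m = "poly M n" and I = ?I])
    show "?I 0 \<tau>" using st unfolding stage_def Let_def by auto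
  next
    fix i \<tau>1 assume i: "i < poly M n" "?I i \<tau>1" "\<tau>1 11 = (fst (\<tau> 11), int i)"
    show "wp B (For 12 (simulate V [(copies V, copies V + 1), (7, 1), (7, 2), (7, 4), (7, 5)] ;;
                For 7 (mv {2, 5} Right)) ;;
        For 12 (For 7 (mv {2, 5} Left)) ;;
        For 7 (mv {1, 4} Right)) (\<lambda>\<tau>'. \<tau>' 11 = (fst (\<tau> 11), int i) \<and> ?I (Suc i) \<tau>') \<tau>1"
    proof (rule wp_Then, rule wp_row[OF i(2)], goal_cases)
      case (1 \<tau>2)
      have r: "\<tau>2 7 = unary (poly q n)" "\<tau>2 12 = unary (poly N n)"
        using 1(1) by (auto simp: stage_def Let_def l_def n)
      show ?case
      proof (rule wp_Then, rule wp_For_For_mv[where m = "poly N n" and l = "poly q n"], goal_cases)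
        case 8
        show ?case
        proof (rule wp_For_mv[where m = "poly q n"], goal_cases)
          case 4
          then show ?case using 1 i unfolding stage_def Let_def n(1)[symmetric]
            by (auto simp: shift_def l_def algebra_simps)
        qed (use r P[of 7 q] in \<open>auto simp: l_def shift_notin\<close>)
      qed (use r P[of 7 q] P[of 12 N] in \<open>auto simp: l_def\<close>)
    qed
  next
    show "?I i (shift {11} \<delta> \<tau>2)" if "?I i \<tau>2" for i \<delta> \<tau>2
      using that stage_shift[of x y b "{11}"] by simp
    fix \<tau>2 assume 2: "?I (poly M n) \<tau>2" "\<tau>2 11 = \<tau> 11"
    then show "Q \<tau>2" using \<tau>11 unfolding stage_def Let_def n(1)[symmetric]
      by (intro Q) (auto simp: stage_def Let_def n(1)[symmetric] l_def)
  qed (use \<tau>11 P[of 11 M] in \<open>auto simp: l_def\<close>)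
qed

end

lemma wp_run_pairs:
  assumes ws: "ws = [x, y, b]" and n: "n = length x"
  shows "wp (poly (bound l) (length (encode ws))) (run_pairs V l)
    (\<lambda>\<tau>. reads \<tau> 13 = 0 \<longleftrightarrow>
       poly H n \<le> (\<Sum>i<poly M n. \<Sum>j<poly N n. of_bool (hit x y b i j)))
    (init_tapes ws)"
proof -
  define B X where "B = poly (bound l) (length (encode ws))" and "X = copies V"
  have le: "length w \<le> B" if "w \<in> set ws" for w
    using length_le_encode[OF that] le_bound[of "length (encode ws)" l] by (simp add: B_def)
  have nB: "n \<le> B" using le[of x] by (simp add: ws n)
  have P: "poly P n \<le> B" if "(v, P) \<in> set l" for v P
    using poly_le_bound[OF that] length_le_encode[of x ws] by (simp add: ws n B_def)
  let ?D = "{X..<X + spare l}"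
  let ?Q = "\<lambda>\<tau>. reads \<tau> 13 = 0 \<longleftrightarrow>
       poly H n \<le> (\<Sum>i<poly M n. \<Sum>j<poly N n. of_bool (hit x y b i j))"
  have X: "X \<ge> 14" "X \<in> ?D" "Suc X \<in> ?D" using spare_ge[of l] by (auto simp: X_def)
  define \<tau>1 where "\<tau>1 = (\<lambda>r. if r \<in> ?D then input_tape (bit_syms x)
      else if r \<in> {1, 2, 3} then input_tape (bit_syms y)
      else if r \<in> {4, 5} then input_tape (bit_syms b)
      else if r = 0 then (fst (input_tape (encode ws)), int (length (encode [x, y, b]))) else blank_tape)"
  define \<tau>2 where "\<tau>2 = (\<lambda>r. case map_of l r of Some P \<Rightarrow> unary (poly P n) | None \<Rightarrow> \<tau>1 r)"
  let ?main = "For 11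
       (For 12 (simulate V [(X, X + 1), (7, 1), (7, 2), (7, 4), (7, 5)] ;;
                For 7 (mv {2, 5} Right)) ;;
        For 12 (For 7 (mv {2, 5} Left)) ;;
        For 7 (mv {1, 4} Right))"
  let ?pos = "For 11 (For 7 (mv {2, 3, 5} Right)) ;; For 12 (For 7 (mv {3} Right)) ;; ?main"
  let ?MN = "int (poly N n) * (int (poly q n) * move Right 0)"
  let ?\<tau>3 = "shift {3} ?MN (shift {2, 3, 5} (int (poly M n) * (int (poly q n) * move Right 0)) \<tau>2)"
  \<comment> \<open>Heads 2 and 5 have passed the first prover's \<open>M\<close> blocks, head 3
    also the \<open>N\<close> blocks of the second, so it stands on the first block of
    coins.\<close>
  have st: "stage x y b {} 0 0 0 0 ?\<tau>3"
    unfolding stage_def Let_def n[symmetric] X_def[symmetric]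
    by (auto simp: \<tau>2_def \<tau>1_def l_def shift_def X_def clean_def blank_tape_def unary_def algebra_simps
        input_tape_def)
  have pos: "wp B ?pos ?Q \<tau>2"
  proof (rule wp_Then, rule wp_For_For_mv[where m = "poly M n" and l = "poly q n"], goal_cases)
    case 8
    show ?case
    proof (rule wp_Then, rule wp_For_For_mv[where m = "poly N n" and l = "poly q n"], goal_cases)
      case 8
      show ?case unfolding X_def
      proof (rule wp_table[OF n nB P st], assumption)
        fix \<tau>' assume "stage x y b {} (poly M n) 0 (poly M n * poly N n)
            (\<Sum>i<poly M n. \<Sum>j<poly N n. of_bool (hit x y b i j)) \<tau>'"
        then show "?Q \<tau>'" unfolding stage_def Let_def n[symmetric]
          by (auto simp: reads_def unary_past_end simp del: of_nat_sum)
      qed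
    qed (use P[of 12 N] P[of 7 q] in \<open>auto simp: \<tau>2_def l_def shift_notin\<close>)
  qed (use P[of 11 M] P[of 7 q] in \<open>auto simp: \<tau>2_def l_def\<close>)
  have rul: "wp B (make_rulers X l ;; ?pos) ?Q \<tau>1"
  proof (rule wp_Then, rule wp_make_rulers[where n = n], goal_cases)
    case (1 i P)
    then have "i < spare l" using length_coeffs_le_spare[of _ P l] by fastforce
    then show ?case using ruler_input_tape[of "bit_syms x"] by (simp add: \<tau>1_def n)
  next
    case 6
    then show ?case using pos by (simp add: \<tau>2_def)
  qed (use P[of 7 q] P[of 8 U] P[of 9 p] P[of 10 W] P[of 11 M] P[of 12 N] P[of 13 H] nB X in
      \<open>auto simp: l_def \<tau>1_def\<close>)
  show ?thesis
    unfolding run_pairs_def X_def[symmetric] B_def[symmetric]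
  proof (rule wp_Then, rule wp_load[where us = "[]" and w = x and vs = "[y, b]"], goal_cases)
    case 6
    show ?case
    proof (rule wp_Then, rule wp_load[where us = "[x]" and w = y and vs = "[b]"], goal_cases)
      case 6
      show ?case
      proof (rule wp_Then, rule wp_load[where us = "[x, y]" and w = b and vs = "[]"], goal_cases)
        case 6
        show ?case
          by (rule back_subst[where P = "wp _ _ _", OF rul]) (use X in \<open>auto simp: \<tau>1_def ws fun_eq_iff init_tapes_def\<close>)
      qed (use X le in \<open>auto simp: init_tapes_def ws\<close>)
    qed (use X le in \<open>auto simp: init_tapes_def ws\<close>)
  qed (use X le in \<open>auto simp: init_tapes_def ws input_tape_def\<close>)
qed

end

section \<open>Sampling from a free game\<close>

definition mean :: "'a set \<Rightarrow> ('a \<Rightarrow> real) \<Rightarrow> real" where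
  "mean S f = (\<Sum>s\<in>S. f s) / real (card S)"

definition tuples :: "'a set \<Rightarrow> nat \<Rightarrow> 'a list set" where
  "tuples S n = {zs. set zs \<subseteq> S \<and> length zs = n}"

lemma mean_const: "finite S \<Longrightarrow> S \<noteq> {} \<Longrightarrow> mean S (\<lambda>_. c) = c"
  by (simp add: mean_def)

lemma mean_add: "mean S (\<lambda>s. f s + g s) = mean S f + mean S g"
  and mean_diff: "mean S (\<lambda>s. f s - g s) = mean S f - mean S g"
  and mean_cmult: "mean S (\<lambda>s. c * f s) = c * mean S f"
  by (simp_all add: mean_def sum.distrib sum_subtractf add_divide_distrib diff_divide_distrib sum_distrib_left)

lemma mean_sum: "mean S (\<lambda>s. \<Sum>i\<in>I. f i s) = (\<Sum>i\<in>I. mean S (f i))"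
  unfolding mean_def by (subst sum.swap) (simp add: sum_divide_distrib)

lemma mean_mono: "(\<And>s. s \<in> S \<Longrightarrow> f s \<le> g s) \<Longrightarrow> mean S f \<le> mean S g"
  by (simp add: mean_def divide_right_mono sum_mono)

lemma mean_cong: "(\<And>s. s \<in> S \<Longrightarrow> f s = g s) \<Longrightarrow> mean S f = mean S g"
  by (simp add: mean_def)

lemma mean_le: "finite S \<Longrightarrow> S \<noteq> {} \<Longrightarrow> (\<And>s. s \<in> S \<Longrightarrow> f s \<le> c) \<Longrightarrow> mean S f \<le> c"
  using mean_mono[of S f "\<lambda>_. c"] by (simp add: mean_const)

lemma mean_ge: "finite S \<Longrightarrow> S \<noteq> {} \<Longrightarrow> (\<And>s. s \<in> S \<Longrightarrow> c \<le> f s) \<Longrightarrow> c \<le> mean S f"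
  using mean_mono[of S "\<lambda>_. c" f] by (simp add: mean_const)

lemma mean_swap: "mean S (\<lambda>s. mean T (f s)) = mean T (\<lambda>t. mean S (\<lambda>s. f s t))"
  unfolding mean_def by (simp add: sum_divide_distrib[symmetric] sum.swap[of _ T S])

lemma mean_bij: "bij_betw h S T \<Longrightarrow> mean T f = mean S (\<lambda>s. f (h s))"
  unfolding mean_def by (simp add: sum.reindex_bij_betw bij_betw_same_card)

lemma mean_Times: "mean (S \<times> T) f = mean S (\<lambda>s. mean T (\<lambda>t. f (s, t)))"
  by (simp add: mean_def card_cartesian_product sum.cartesian_product' sum_divide_distrib[symmetric]
        mult.commute)

lemma finite_tuples [simp]: "finite S \<Longrightarrow> finite (tuples S n)"
  by (simp add: tuples_def finite_lists_length_eq)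

lemma card_tuples: "finite S \<Longrightarrow> card (tuples S n) = card S ^ n"
  by (simp add: tuples_def card_lists_length_eq)

lemma tuples_nonempty [simp]: "S \<noteq> {} \<Longrightarrow> tuples S n \<noteq> {}"
proof -
  assume "S \<noteq> {}"
  then obtain s where "s \<in> S" by blast
  then have "replicate n s \<in> tuples S n" by (auto simp: tuples_def)
  then show ?thesis by blast
qed

lemma tuples_nth: "zs \<in> tuples S n \<Longrightarrow> i < n \<Longrightarrow> zs ! i \<in> S"
  by (auto simp: tuples_def)

lemma mean_tuples_0: "mean (tuples S 0) f = f []"
proof -
  have "tuples S 0 = {[]}" by (auto simp: tuples_def)
  then show ?thesis by (simp add: mean_def)
qed

lemma mean_tuples_Suc:
  "mean (tuples S (Suc n)) f = mean S (\<lambda>z. mean (tuples S n) (\<lambda>zs. f (z # zs)))"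
proof -
  have "bij_betw (\<lambda>(z, zs). z # zs) (S \<times> tuples S n) (tuples S (Suc n))"
    by (intro bij_betwI[where g = "\<lambda>l. (hd l, tl l)"]) (auto simp: tuples_def length_Suc_conv)
  from mean_bij[OF this, of f] show ?thesis by (simp add: mean_Times)
qed

lemma mean_prod_tuples:
  "mean (tuples S n) (\<lambda>zs. \<Prod>i<n. g i (zs ! i)) = (\<Prod>i<n. mean S (g i))"
proof (induction n arbitrary: g)
  case 0
  then show ?case by (simp add: mean_tuples_0)
next
  case (Suc n)
  have "mean (tuples S (Suc n)) (\<lambda>zs. \<Prod>i<Suc n. g i (zs ! i)) =
      mean S (\<lambda>z. mean (tuples S n) (\<lambda>zs. g 0 z * (\<Prod>i<n. g (Suc i) (zs ! i))))"
    by (simp add: mean_tuples_Suc prod.lessThan_Suc_shift del: prod.lessThan_Suc)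
  also have "\<dots> = mean S (\<lambda>z. (\<Prod>i<n. mean S (g (Suc i))) * g 0 z)"
    using Suc.IH[of "\<lambda>i. g (Suc i)"] by (simp add: mean_cmult mult.commute)
  also have "\<dots> = (\<Prod>i<Suc n. mean S (g i))"
    by (simp add: mean_cmult prod.lessThan_Suc_shift del: prod.lessThan_Suc)
  finally show ?case .
qed

lemma exp_le_quadratic:
  fixes x :: real
  assumes "\<bar>x\<bar> \<le> 1"
  shows "exp x \<le> 1 + x + x\<^sup>2"
proof (cases "x \<ge> 0")
  case True
  then show ?thesis using exp_bound assms by auto
next
  case False
  define y where "y = - x"
  have y: "0 \<le> y" "y \<le> 1" using False assms by (auto simp: y_def)
  \<comment> \<open>For negative arguments the claim is
    \<open>1 \<le> (1 - y + y\<^sup>2) * exp y\<close>; the factor \<open>1 - y + y\<^sup>2\<close>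
    is chosen to multiply with \<open>1 + y\<close>, a lower bound of \<open>exp y\<close>, to
    \<open>1 + y ^ 3\<close>.\<close>
  have "1 \<le> 1 + y ^ 3" using y by simp
  also have "\<dots> = (1 - y + y\<^sup>2) * (1 + y)" by (simp add: algebra_simps power2_eq_square power3_eq_cube)
  also have "\<dots> \<le> (1 - y + y\<^sup>2) * exp y"
    using y exp_ge_add_one_self[of y] by (intro mult_left_mono) auto
  finally have "1 \<le> (1 - y + y\<^sup>2) * exp y" .
  then have "exp (- y) \<le> 1 - y + y\<^sup>2" by (simp add: exp_minus field_simps)
  then show ?thesis by (simp add: y_def)
qed

text \<open>The linear term of \<open>exp_le_quadratic\<close> averages to 0 because the function is
  centred, which leaves \<open>1 + c\<^sup>2\<close>.\<close>

lemma mean_exp_centered: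
  assumes S: "finite S" "S \<noteq> {}" and f: "\<And>s. s \<in> S \<Longrightarrow> 0 \<le> f s \<and> f s \<le> 1" and "\<bar>c\<bar> \<le> 1"
  shows "mean S (\<lambda>s. exp (c * (f s - mean S f))) \<le> exp (c\<^sup>2)"
proof -
  have m: "0 \<le> mean S f" "mean S f \<le> 1"
    using f by (auto intro!: mean_ge mean_le S)
  have "exp (c * (f s - mean S f)) \<le> (1 + c\<^sup>2) + c * (f s - mean S f)" if "s \<in> S" for s
  proof -
    have 1: "\<bar>f s - mean S f\<bar> \<le> 1" using f[OF that] m by auto
    have 2: "\<bar>c * (f s - mean S f)\<bar> \<le> 1"
      using mult_mono[OF assms(4) 1] by (simp add: abs_mult)
    have "(c * (f s - mean S f))\<^sup>2 \<le> c\<^sup>2"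
      using mult_left_mono[of "(f s - mean S f)\<^sup>2" 1 "c\<^sup>2"] 1
      by (simp add: power_mult_distrib abs_square_le_1)
    then show ?thesis using exp_le_quadratic[OF 2] by simp
  qed
  then have "mean S (\<lambda>s. exp (c * (f s - mean S f))) \<le> mean S (\<lambda>s. (1 + c\<^sup>2) + c * (f s - mean S f))"
    by (rule mean_mono)
  also have "\<dots> = 1 + c\<^sup>2"
    by (simp add: mean_add mean_cmult mean_diff mean_const[OF S])
  also have "\<dots> \<le> exp (c\<^sup>2)" by (rule exp_ge_add_one_self)
  finally show ?thesis .
qed

text \<open>The function may vary with the index: each coin block is judged by a predicate depending
  on the pair of challenges it belongs to.\<close>

definition deviation :: "'a set \<Rightarrow> nat \<Rightarrow> (nat \<Rightarrow> 'a \<Rightarrow> real) \<Rightarrow> 'a list \<Rightarrow> real" where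
  "deviation S n f zs = (\<Sum>i<n. f i (zs ! i) - mean S (f i)) / real n"

definition max_deviation :: "'a set \<Rightarrow> nat \<Rightarrow> 'k set \<Rightarrow> ('k \<Rightarrow> nat \<Rightarrow> 'a \<Rightarrow> real) \<Rightarrow> 'a list \<Rightarrow> real" where
  "max_deviation S n K f zs = Max ((\<lambda>k. \<bar>deviation S n (f k) zs\<bar>) ` K)"

lemma deviation_le_max: "finite K \<Longrightarrow> k \<in> K \<Longrightarrow> \<bar>deviation S n (f k) zs\<bar> \<le> max_deviation S n K f zs"
  unfolding max_deviation_def by (intro Max_ge) auto

lemma max_deviation_nonneg: "finite K \<Longrightarrow> K \<noteq> {} \<Longrightarrow> 0 \<le> max_deviation S n K f zs"
  using deviation_le_max[of K _ S n f zs] by (metis abs_ge_zero all_not_in_conv order_trans)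

text \<open>Exponential moments turn the union bound over \<open>K\<close> into the logarithmic dependence on its size.\<close>

lemma mean_max_deviation:
  assumes S: "finite S" "S \<noteq> {}" and K: "finite K" "K \<noteq> {}" "card K \<le> 2 ^ m"
    and f: "\<And>k i s. k \<in> K \<Longrightarrow> i < n \<Longrightarrow> s \<in> S \<Longrightarrow> 0 \<le> f k i s \<and> f k i s \<le> 1"
    and e: "0 < e" "e \<le> 1" "real (m + 1) \<le> e\<^sup>2 * real n"
  shows "mean (tuples S n) (max_deviation S n K f) \<le> 2 * e"
proof -
  have n: "n > 0" using e by (cases n) auto
  let ?D = "\<lambda>k zs. \<Sum>i<n. f k i (zs ! i) - mean S (f k i)"
  let ?X = "max_deviation S n K f"
  \<comment> \<open>\<open>exp c\<close> bounds the sum of \<open>2 * card K\<close> exponential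
    moments: \<open>exp (m + 1)\<close> covers \<open>2 * 2 ^ m\<close>, and
    \<open>exp (e\<^sup>2 * n)\<close> each single moment. By the hypothesis on \<open>n\<close>, c
    is at most \<open>2 * e\<^sup>2 * n\<close>.\<close>
  define c where "c = real (m + 1) + e\<^sup>2 * real n"
  have moment: "mean (tuples S n) (\<lambda>zs. exp (t * ?D k zs)) \<le> exp (e\<^sup>2 * real n)"
    if k: "k \<in> K" and t: "t\<^sup>2 = e\<^sup>2" "\<bar>t\<bar> \<le> 1" for k t
  proof -
    have "mean (tuples S n) (\<lambda>zs. exp (t * ?D k zs)) =
        (\<Prod>i<n. mean S (\<lambda>s. exp (t * (f k i s - mean S (f k i)))))"
      by (subst mean_prod_tuples[symmetric]) (simp add: sum_distrib_left exp_sum)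
    also have "\<dots> \<le> (\<Prod>i<n. exp (e\<^sup>2))"
    proof (intro prod_mono conjI)
      fix i assume "i \<in> {..<n}"
      then show "mean S (\<lambda>s. exp (t * (f k i s - mean S (f k i)))) \<le> exp (e\<^sup>2)"
        using mean_exp_centered[OF S, of "f k i" t] f[OF k] t by simp
      qed (rule mean_ge[OF S], simp)
    also have "\<dots> = exp (e\<^sup>2 * real n)" by (simp add: exp_of_nat_mult[symmetric] mult.commute)
    finally show ?thesis .
  qed
  \<comment> \<open>The tangent inequality \<open>x \<le> c - 1 + exp (x - c)\<close> takes the
    place of Jensen's inequality for the logarithm; inside \<open>exp\<close>, the maximum is
    bounded by the sum over \<open>K\<close> and over both signs.\<close>
  have pt: "e * real n * ?X zs \<le>
      c - 1 + exp (- c) * (\<Sum>k\<in>K. exp (e * ?D k zs) + exp (- e * ?D k zs))" for zs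
  proof -
    have "?X zs \<in> (\<lambda>k. \<bar>deviation S n (f k) zs\<bar>) ` K"
      unfolding max_deviation_def using K by (intro Max_in) auto
    then obtain k where k: "k \<in> K" "?X zs = \<bar>deviation S n (f k) zs\<bar>" by blast
    have "e * real n * ?X zs = \<bar>e * ?D k zs\<bar>"
      using n e by (simp add: k deviation_def abs_mult)
    then have "exp (e * real n * ?X zs) \<le> exp (e * ?D k zs) + exp (- e * ?D k zs)"
      by (auto simp: abs_if)
    also have "\<dots> \<le> (\<Sum>k\<in>K. exp (e * ?D k zs) + exp (- e * ?D k zs))"
      using K k by (intro member_le_sum) (auto intro: add_nonneg_nonneg)
    finally have "exp (- c) * exp (e * real n * ?X zs) \<le>
       exp (- c) * (\<Sum>k\<in>K. exp (e * ?D k zs) + exp (- e * ?D k zs))" by simp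
    moreover have "1 + (e * real n * ?X zs - c) \<le> exp (- c) * exp (e * real n * ?X zs)"
      using exp_ge_add_one_self[of "e * real n * ?X zs - c"] by (simp add: exp_diff exp_minus field_simps)
    ultimately show ?thesis by linarith
  qed
  have T: "finite (tuples S n)" "tuples S n \<noteq> {}" using S by auto
  have "e * real n * mean (tuples S n) ?X = mean (tuples S n) (\<lambda>zs. e * real n * ?X zs)"
    by (simp add: mean_cmult)
  also have "\<dots> \<le> mean (tuples S n)
     (\<lambda>zs. (c - 1) + exp (- c) * (\<Sum>k\<in>K. exp (e * ?D k zs) + exp (- e * ?D k zs)))"
    using pt by (intro mean_mono)
  also have "\<dots> = (c - 1) + exp (- c) * (\<Sum>k\<in>K. mean (tuples S n) (\<lambda>zs. exp (e * ?D k zs)) +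
       mean (tuples S n) (\<lambda>zs. exp (- e * ?D k zs)))"
    by (simp only: mean_add[of _ "\<lambda>_. c - 1"] mean_cmult mean_sum mean_add mean_const[OF T])
  also have "\<dots> \<le> (c - 1) + exp (- c) * (\<Sum>k\<in>K. 2 * exp (e\<^sup>2 * real n))"
  proof (intro add_left_mono mult_left_mono sum_mono)
    fix k assume k: "k \<in> K"
    show "mean (tuples S n) (\<lambda>zs. exp (e * ?D k zs)) + mean (tuples S n) (\<lambda>zs. exp (- e * ?D k zs))
        \<le> 2 * exp (e\<^sup>2 * real n)"
      using moment[OF k, of e] moment[OF k, of "- e"] e(1,2) by simp
  qed simp
  also have "\<dots> \<le> (c - 1) + exp (- c) * exp c"
  proof -
    have "real (card K) \<le> real (2 ^ m)" using K(3) by (simp only: of_nat_le_iff)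
    then have "real (2 * card K) \<le> 2 * 2 ^ m" by simp
    also have "\<dots> \<le> exp 1 ^ (m + 1)"
      using power_mono[of "2 :: real" "exp 1" "m + 1"] exp_ge_add_one_self[of "1 :: real"] by simp
    also have "\<dots> = exp (real (m + 1))" by (metis exp_of_nat_mult mult.right_neutral)
    finally have "2 * real (card K) \<le> exp (real (m + 1))" by simp
    then have "(\<Sum>k\<in>K. 2 * exp (e\<^sup>2 * real n)) \<le> exp c"
      unfolding c_def exp_add by (simp add: mult.assoc[symmetric] mult.commute[of _ 2])
    then show ?thesis by simp
  qed
  also have "\<dots> = c" by (simp flip: exp_add)
  also have "\<dots> \<le> e * real n * (2 * e)" using e(3) by (simp add: c_def power2_eq_square mult_ac)
  finally show ?thesis using e n by simp
qed


section \<open>The sampled free game\<close>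

locale free_game =
  fixes S :: "'a set" and R :: "'r set" and A :: "'a \<Rightarrow> 'a \<Rightarrow> 'a \<Rightarrow> 'a \<Rightarrow> 'r \<Rightarrow> bool" and l :: nat
  assumes S: "finite S" "S \<noteq> {}" "card S \<le> 2 ^ l" and R: "finite R" "R \<noteq> {}"
begin

definition D :: "'a \<Rightarrow> 'a \<Rightarrow> 'a \<Rightarrow> 'a \<Rightarrow> real" where
  "D y z a b = mean R (\<lambda>r. of_bool (A y z a b r))"

text \<open>The factor \<open>40000\<close> is \<open>1 / \<epsilon>\<^sup>2\<close> for the error \<open>\<epsilon> = 1 / 200\<close> used below.\<close>

definition \<kappa> :: nat where "\<kappa> = 40000 * (l + 1)"
definition N :: nat where "N = 40000 * (2 * l * \<kappa> + 1)"
definition M :: nat where "M = 40000 * (l * N + 1)"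

definition score :: "'a list \<Rightarrow> 'a list \<Rightarrow> 'r list \<Rightarrow> 'a list \<Rightarrow> 'a list \<Rightarrow> real" where
  "score Y Z rs a b =
     (\<Sum>i<M. \<Sum>j<N. of_bool (A (Y ! i) (Z ! j) (a ! i) (b ! j) (rs ! (i * N + j)))) / (real M * real N)"

abbreviation \<epsilon> :: real where "\<epsilon> \<equiv> 1 / 200"

lemma sizes:
  "0 < N" "0 < M" "real (l + 1) \<le> \<epsilon>\<^sup>2 * real \<kappa>" "real (2 * l * \<kappa> + 1) \<le> \<epsilon>\<^sup>2 * real N"
  "real (l * N + 1) \<le> \<epsilon>\<^sup>2 * real M" "real (l * (M + N) + 1) \<le> \<epsilon>\<^sup>2 * real (M * N)"
proof -
  show "0 < N" "0 < M" by (simp_all add: M_def N_def)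
  show "real (l + 1) \<le> \<epsilon>\<^sup>2 * real \<kappa>" "real (2 * l * \<kappa> + 1) \<le> \<epsilon>\<^sup>2 * real N"
    "real (l * N + 1) \<le> \<epsilon>\<^sup>2 * real M"
    by (simp_all add: \<kappa>_def N_def M_def power2_eq_square)
  \<comment> \<open>The bound for the coins. As \<open>N\<close> contains the factor
    \<open>1 / \<epsilon>\<^sup>2\<close>, it reduces to integers; there \<open>l * N + 1\<close> is
    absorbed by \<open>M\<close>, and \<open>M * l\<close> by the term with
    \<open>\<kappa> \<ge> 1\<close>.\<close>
  have "l * (M + N) + 1 \<le> M * (2 * l * \<kappa> + 1)"
  proof (cases "l = 0")
    case True
    have "1 \<le> M" by (simp add: M_def)
    moreover have "l * (M + N) = 0" "M * (2 * l * \<kappa> + 1) = M" using True by auto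
    ultimately show ?thesis by linarith
  next
    case False
    have "l * N + 1 \<le> M" by (simp add: M_def)
    moreover have "M * l * 1 \<le> M * l * (2 * \<kappa>)" by (intro mult_left_mono) (auto simp: \<kappa>_def)
    moreover have "M * (2 * l * \<kappa> + 1) = M * l * (2 * \<kappa>) + M" "l * (M + N) + 1 = M * l * 1 + (l * N + 1)"
      by (simp_all add: algebra_simps)
    ultimately show ?thesis by linarith
  qed
  then have "real (l * (M + N) + 1) \<le> real (M * (2 * l * \<kappa> + 1))" by (simp only: of_nat_le_iff)
  also have "\<dots> = \<epsilon>\<^sup>2 * real (M * N)" by (simp add: N_def power2_eq_square algebra_simps)
  finally show "real (l * (M + N) + 1) \<le> \<epsilon>\<^sup>2 * real (M * N)" .
qed

lemma D_bounds: "0 \<le> D y z a b" "D y z a b \<le> 1"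
  unfolding D_def by (auto intro!: mean_ge mean_le R)

lemma avg_bounds:
  assumes "\<And>i. 0 \<le> f i \<and> f i \<le> 1"
  shows "0 \<le> (\<Sum>i<n. f i) / real n" "(\<Sum>i<n. f i) / real n \<le> (1 :: real)"
proof -
  show "0 \<le> (\<Sum>i<n. f i) / real n" using assms by (auto intro!: divide_nonneg_nonneg sum_nonneg)
  have "(\<Sum>i<n. f i) \<le> (\<Sum>i<n. 1)" using assms by (intro sum_mono) auto
  then show "(\<Sum>i<n. f i) / real n \<le> 1" by (cases "n = 0") auto
qed

lemma deviation_eq: "deviation T n (\<lambda>_. g) zs = (\<Sum>i<n. g (zs ! i)) / real n - mean T g" if "n > 0"
  using that by (simp add: deviation_def sum_subtractf field_simps)

definition coin :: "'a list \<Rightarrow> 'a list \<Rightarrow> 'a list \<times> 'a list \<Rightarrow> nat \<Rightarrow> 'r \<Rightarrow> real" where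
  "coin Y Z ab t r =
     of_bool (A (Y ! (t div N)) (Z ! (t mod N)) (fst ab ! (t div N)) (snd ab ! (t mod N)) r)"

lemma sum_pairs: "(\<Sum>i<m. \<Sum>j<k. f (i * k + j)) = (\<Sum>t<m * k. f t)" for f :: "nat \<Rightarrow> real"
proof (induction m)
  case (Suc m)
  have "(\<Sum>t<c + k. f t) = (\<Sum>t<c. f t) + (\<Sum>j<k. f (c + j))" for c
    by (induction k) auto
  from this[of "m * k"] show ?case using Suc by (simp add: add.commute)
qed simp

text \<open>Once challenges and answers are fixed, the coin blocks are independent with means
  \<open>D\<close>, so the score splits into the coin-free game on the sample and pure coin
  noise.\<close>

lemma score_deviation:
  "score Y Z rs a b =
     (\<Sum>i<M. (\<Sum>j<N. D (Y ! i) (Z ! j) (a ! i) (b ! j)) / real N) / real M +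
     deviation R (M * N) (coin Y Z (a, b)) rs"
proof -
  have "(\<Sum>t<M * N. coin Y Z (a, b) t (rs ! t) - mean R (coin Y Z (a, b) t)) =
    (\<Sum>i<M. \<Sum>j<N. coin Y Z (a, b) (i * N + j) (rs ! (i * N + j)) - mean R (coin Y Z (a, b) (i * N + j)))"
    by (rule sum_pairs[symmetric])
  also have "\<dots> = (\<Sum>i<M. \<Sum>j<N. of_bool (A (Y ! i) (Z ! j) (a ! i) (b ! j) (rs ! (i * N + j))) -
      D (Y ! i) (Z ! j) (a ! i) (b ! j))"
    by (intro sum.cong refl) (simp add: coin_def[abs_def] D_def)
  finally have e: "deviation R (M * N) (coin Y Z (a, b)) rs = score Y Z rs a b -
      (\<Sum>i<M. \<Sum>j<N. D (Y ! i) (Z ! j) (a ! i) (b ! j)) / (real M * real N)"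
    by (simp add: deviation_def score_def sum_subtractf diff_divide_distrib)
  have "(\<Sum>i<M. (\<Sum>j<N. D (Y ! i) (Z ! j) (a ! i) (b ! j)) / real N) / real M =
      (\<Sum>i<M. \<Sum>j<N. D (Y ! i) (Z ! j) (a ! i) (b ! j)) / (real M * real N)"
    by (simp add: sum_divide_distrib[symmetric] mult.commute)
  then show ?thesis unfolding e by simp
qed

definition best :: "('a \<Rightarrow> real) \<Rightarrow> 'a" where
  "best \<phi> = (SOME a. a \<in> S \<and> (\<forall>a'\<in>S. \<phi> a' \<le> \<phi> a))"

lemma best: "best \<phi> \<in> S" "a \<in> S \<Longrightarrow> \<phi> a \<le> \<phi> (best \<phi>)"
proof -
  have "\<exists>a. a \<in> S \<and> (\<forall>a'\<in>S. \<phi> a' \<le> \<phi> a)"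
  proof -
    have "Max (\<phi> ` S) \<in> \<phi> ` S" using S by (intro Max_in) auto
    then obtain a where "a \<in> S" "\<phi> a = Max (\<phi> ` S)" by auto
    then show ?thesis using S by (intro exI[of _ a]) auto
  qed
  then have "best \<phi> \<in> S \<and> (\<forall>a'\<in>S. \<phi> a' \<le> \<phi> (best \<phi>))"
    unfolding best_def by (rule someI_ex)
  then show "best \<phi> \<in> S" "a \<in> S \<Longrightarrow> \<phi> a \<le> \<phi> (best \<phi>)" by auto
qed

text \<open>The first prover's best response against a sample \<open>u\<close> of challenges to the second prover that are
  answered by \<open>v\<close>.\<close>

definition respond :: "'a list \<Rightarrow> 'a list \<Rightarrow> 'a \<Rightarrow> 'a" where
  "respond u v y = best (\<lambda>a. (\<Sum>s<\<kappa>. D y (u ! s) a (v ! s)) / real \<kappa>)"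

definition row :: "'a list \<Rightarrow> 'a list \<Rightarrow> 'a \<Rightarrow> 'a \<Rightarrow> real" where
  "row Z b y a = (\<Sum>j<N. D y (Z ! j) a (b ! j)) / real N"

definition top_row :: "'a list \<Rightarrow> 'a list \<Rightarrow> 'a \<Rightarrow> real" where
  "top_row Z b y = row Z b y (best (row Z b y))"

definition column :: "('a \<Rightarrow> 'a) \<Rightarrow> 'a \<Rightarrow> 'a \<Rightarrow> real" where
  "column \<alpha> z b = mean S (\<lambda>y. D y z (\<alpha> y) b)"

definition top_column :: "('a \<Rightarrow> 'a) \<Rightarrow> 'a \<Rightarrow> real" where
  "top_column \<alpha> z = column \<alpha> z (best (column \<alpha> z))"

lemma row_bounds: "0 \<le> row Z b y a \<and> row Z b y a \<le> 1"
  unfolding row_def using avg_bounds[of "\<lambda>j. D y (Z ! j) a (b ! j)" N] D_bounds by simp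

lemma column_bounds: "0 \<le> column \<alpha> z b \<and> column \<alpha> z b \<le> 1"
  unfolding column_def using D_bounds by (auto intro!: mean_ge mean_le S)

lemma mean_index: "mean {..<n} (\<lambda>j. f j) = (\<Sum>j<n. f j) / real n"
  by (simp add: mean_def)

text \<open>For fixed \<open>y\<close> only the answer ranges, \<open>l\<close> bits, so
  \<open>\<kappa>\<close> sampled columns estimate the values of all answers at once. The maximiser
  of the estimate loses at most twice the largest deviation, whose mean is at most
  \<open>2 * \<epsilon>\<close>. As \<open>J\<close> is drawn independently of \<open>y\<close>, the
  responses for a fixed \<open>J\<close> form a strategy.\<close>

lemma top_row_le:
  "top_row Z b y \<le>
    mean (tuples {..<N} \<kappa>) (\<lambda>J. row Z b y (respond (map ((!) Z) J) (map ((!) b) J) y)) + 4 * \<epsilon>"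
proof -
  let ?f = "\<lambda>a (s :: nat) j. D y (Z ! j) a (b ! j)"
  let ?dev = "max_deviation {..<N} \<kappa> S ?f"
  let ?r = "\<lambda>J. respond (map ((!) Z) J) (map ((!) b) J) y"
  have \<kappa>: "\<kappa> > 0" by (simp add: \<kappa>_def)
  have I: "finite {..<N}" "{..<N} \<noteq> {}" using sizes(1) by auto
  have T: "finite (tuples {..<N} \<kappa>)" "tuples {..<N} \<kappa> \<noteq> {}" using I by auto
  have "top_row Z b y \<le> row Z b y (?r J) + 2 * ?dev J" if J: "J \<in> tuples {..<N} \<kappa>" for J
  proof -
    define \<psi> where "\<psi> a = (\<Sum>s<\<kappa>. D y (map ((!) Z) J ! s) a (map ((!) b) J ! s)) / real \<kappa>" for a
    have "deviation {..<N} \<kappa> (?f a) J = \<psi> a - row Z b y a" for a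
      using \<kappa> J by (simp add: deviation_eq mean_index row_def \<psi>_def tuples_def)
    then have d: "\<bar>\<psi> a - row Z b y a\<bar> \<le> ?dev J" if "a \<in> S" for a
      using deviation_le_max[OF S(1) that, of "{..<N}" \<kappa> ?f J] by simp
    have r: "?r J = best \<psi>" by (simp add: respond_def \<psi>_def[abs_def])
    show ?thesis
      using d[OF best(1), of "row Z b y"] d[OF best(1), of \<psi>] best(2)[OF best(1), of \<psi> "row Z b y"]
      unfolding top_row_def r by linarith
  qed
  then have "mean (tuples {..<N} \<kappa>) (\<lambda>_. top_row Z b y) \<le>
     mean (tuples {..<N} \<kappa>) (\<lambda>J. row Z b y (?r J) + 2 * ?dev J)"
    by (rule mean_mono)
  also have "\<dots> = mean (tuples {..<N} \<kappa>) (\<lambda>J. row Z b y (?r J)) + 2 * mean (tuples {..<N} \<kappa>) ?dev"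
    by (simp only: mean_add mean_cmult)
  also have "mean (tuples {..<N} \<kappa>) ?dev \<le> 2 * \<epsilon>"
    by (rule mean_max_deviation[OF I S]) (use sizes(3) D_bounds in auto)
  finally show ?thesis by (simp add: mean_const[OF T])
qed

text \<open>Three errors, each uniform over what Merlin may adapt to the sample: all answers against
  the coins, the second prover's answers against \<open>Y\<close>, and the strings determining a
  response against \<open>Z\<close>. \<open>dev2\<close> holds \<open>Z\<close> fixed, as the
  independence of the two samples permits.\<close>

definition dev1 :: "'a list \<Rightarrow> 'a list \<Rightarrow> 'r list \<Rightarrow> real" where
  "dev1 Y Z = max_deviation R (M * N) (tuples S M \<times> tuples S N) (coin Y Z)"

definition dev2 :: "'a list \<Rightarrow> 'a list \<Rightarrow> real" where
  "dev2 Z = max_deviation S M (tuples S N) (\<lambda>b _. top_row Z b)"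

definition dev3 :: "'a list \<Rightarrow> real" where
  "dev3 = max_deviation S N (tuples S \<kappa> \<times> tuples S \<kappa>) (\<lambda>uv _. top_column (respond (fst uv) (snd uv)))"

lemma card_tuples_le: "card (tuples S n) \<le> 2 ^ (l * n)"
  using power_mono[OF S(3), of n] by (simp add: card_tuples S(1) power_mult)

lemma dev1: "mean (tuples R (M * N)) (dev1 Y Z) \<le> 2 * \<epsilon>"
  unfolding dev1_def
proof (rule mean_max_deviation[OF R])
  show "card (tuples S M \<times> tuples S N) \<le> 2 ^ (l * (M + N))"
    using mult_mono[OF card_tuples_le[of M] card_tuples_le[of N]]
    by (simp add: card_cartesian_product power_add distrib_left)
qed (use sizes(6) S in \<open>auto simp: coin_def\<close>)

lemma dev2: "mean (tuples S M) (dev2 Z) \<le> 2 * \<epsilon>"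
  unfolding dev2_def
  by (rule mean_max_deviation[OF S(1,2) _ _ card_tuples_le])
     (use sizes(5) S row_bounds in \<open>auto simp: top_row_def\<close>)

lemma dev3: "mean (tuples S N) dev3 \<le> 2 * \<epsilon>"
  unfolding dev3_def
proof (rule mean_max_deviation[OF S(1,2)])
  show "card (tuples S \<kappa> \<times> tuples S \<kappa>) \<le> 2 ^ (2 * l * \<kappa>)"
    using mult_mono[OF card_tuples_le[of \<kappa>] card_tuples_le[of \<kappa>]]
    by (simp add: card_cartesian_product mult_2 power_add distrib_right)
qed (use sizes(4) S column_bounds in \<open>auto simp: top_column_def\<close>)

text \<open>The sampled game is transformed step by step: \<open>a\<close> is replaced by the best
  row, \<open>Y\<close> by all challenges, the best row by a response to a subsample,
  \<open>b\<close> by the best column, and \<open>Z\<close> by all challenges. What remains is a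
  pair of strategies of the original game, to which \<open>val\<close> applies.\<close>

lemma score_le:
  assumes val: "\<And>\<alpha> \<beta>. \<alpha> \<in> S \<rightarrow> S \<Longrightarrow> \<beta> \<in> S \<rightarrow> S \<Longrightarrow>
      mean S (\<lambda>y. mean S (\<lambda>z. D y z (\<alpha> y) (\<beta> z))) \<le> 1 / 3"
    and YZ: "Y \<in> tuples S M" "Z \<in> tuples S N" and ab: "a \<in> tuples S M" "b \<in> tuples S N"
  shows "score Y Z rs a b \<le> 1 / 3 + 4 * \<epsilon> + (dev1 Y Z rs + dev2 Z Y + dev3 Z)"
proof -
  have I: "finite {..<N}" "{..<N} \<noteq> {}" using sizes(1) by auto
  have "score Y Z rs a b \<le> (\<Sum>i<M. row Z b (Y ! i) (a ! i)) / real M + dev1 Y Z rs"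
    using deviation_le_max[of "tuples S M \<times> tuples S N" "(a, b)" R "M * N" "coin Y Z" rs] ab S
    by (simp add: score_deviation dev1_def row_def)
  also have "(\<Sum>i<M. row Z b (Y ! i) (a ! i)) / real M \<le> (\<Sum>i<M. top_row Z b (Y ! i)) / real M"
    using tuples_nth[OF ab(1)] by (auto intro!: divide_right_mono sum_mono best(2) simp: top_row_def)
  also have "\<dots> \<le> mean S (top_row Z b) + dev2 Z Y"
    using deviation_le_max[of "tuples S N" b S M "\<lambda>b _. top_row Z b" Y] ab S sizes(2)
    by (simp add: dev2_def deviation_eq abs_le_iff)
  also have "mean S (top_row Z b) \<le> 1 / 3 + 4 * \<epsilon> + dev3 Z"
  proof -
    let ?r = "\<lambda>J. respond (map ((!) Z) J) (map ((!) b) J)"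
    have *: "mean S (\<lambda>y. row Z b y (?r J y)) \<le> 1 / 3 + dev3 Z" if J: "J \<in> tuples {..<N} \<kappa>" for J
    proof -
      let ?uv = "(map ((!) Z) J, map ((!) b) J)"
      \<comment> \<open>Although \<open>?r J\<close> depends on \<open>Z\<close> and
        \<open>b\<close>, it is determined by these \<open>2 * \<kappa>\<close> strings, so
        \<open>dev3\<close> covers it.\<close>
      have uv: "?uv \<in> tuples S \<kappa> \<times> tuples S \<kappa>"
        using J YZ(2) ab(2) by (auto simp: tuples_def subset_iff)
      have r: "?r J \<in> S \<rightarrow> S" by (auto simp: respond_def best(1))
      have "mean S (\<lambda>y. row Z b y (?r J y)) = (\<Sum>j<N. column (?r J) (Z ! j) (b ! j)) / real N"
        unfolding row_def column_def mean_sum[symmetric]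
        by (simp add: mean_def sum_divide_distrib mult.commute)
      also have "\<dots> \<le> (\<Sum>j<N. top_column (?r J) (Z ! j)) / real N"
        using tuples_nth[OF ab(2)] by (auto intro!: divide_right_mono sum_mono best(2) simp: top_column_def)
      also have "\<dots> \<le> mean S (top_column (?r J)) + dev3 Z"
        using deviation_le_max[OF _ uv, of S N "\<lambda>uv _. top_column (respond (fst uv) (snd uv))" Z] S sizes(1)
        by (simp add: dev3_def deviation_eq abs_le_iff)
      also have "mean S (top_column (?r J)) =
          mean S (\<lambda>y. mean S (\<lambda>z. D y z (?r J y) (best (column (?r J) z))))"
        unfolding top_column_def by (subst mean_swap) (simp add: column_def)
      also have "\<dots> \<le> 1 / 3" using r by (intro val) (auto intro: best(1))
      finally show ?thesis by simp
    qed
    have "mean S (top_row Z b) \<le> mean S (\<lambda>y. mean (tuples {..<N} \<kappa>) (\<lambda>J. row Z b y (?r J y)) + 4 * \<epsilon>)"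
      by (intro mean_mono top_row_le)
    also have "\<dots> = mean (tuples {..<N} \<kappa>) (\<lambda>J. mean S (\<lambda>y. row Z b y (?r J y))) + 4 * \<epsilon>"
      by (simp only: mean_add mean_const[OF S(1,2)] mean_swap[of S])
    also have "mean (tuples {..<N} \<kappa>) (\<lambda>J. mean S (\<lambda>y. row Z b y (?r J y))) \<le> 1 / 3 + dev3 Z"
      using I by (intro mean_le *) auto
    finally show ?thesis by simp
  qed
  finally show ?thesis by simp
qed

abbreviation expect :: "('a list \<Rightarrow> 'a list \<Rightarrow> 'r list \<Rightarrow> real) \<Rightarrow> real" where
  "expect F \<equiv> mean (tuples S M) (\<lambda>Y. mean (tuples S N) (\<lambda>Z. mean (tuples R (M * N)) (F Y Z)))"

text \<open>The means are nested with \<open>Y\<close> outermost, but \<open>d2\<close> is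
  controlled for fixed \<open>Z\<close>; the two independent samples are swapped for this
  term.\<close>

lemma expect_devs:
  assumes "\<And>Y Z. mean (tuples R (M * N)) (d1 Y Z) \<le> 2 * \<epsilon>" "\<And>Z. mean (tuples S M) (d2 Z) \<le> 2 * \<epsilon>"
    "mean (tuples S N) d3 \<le> 2 * \<epsilon>"
  shows "expect (\<lambda>Y Z rs. d1 Y Z rs + d2 Z Y + d3 Z) \<le> 6 * \<epsilon>"
proof -
  have T: "finite (tuples S n)" "tuples S n \<noteq> {}" "finite (tuples R n)" "tuples R n \<noteq> {}" for n
    using S R by auto
  have "expect (\<lambda>Y Z rs. d1 Y Z rs + d2 Z Y + d3 Z) =
     expect d1 + mean (tuples S M) (\<lambda>Y. mean (tuples S N) (\<lambda>Z. d2 Z Y)) + mean (tuples S N) d3"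
    by (simp only: mean_add mean_const[OF T(1,2)] mean_const[OF T(3,4)])
  also have "mean (tuples S M) (\<lambda>Y. mean (tuples S N) (\<lambda>Z. d2 Z Y)) =
     mean (tuples S N) (\<lambda>Z. mean (tuples S M) (d2 Z))" by (rule mean_swap)
  also have "\<dots> \<le> 2 * \<epsilon>" by (intro mean_le T assms)
  also have "expect d1 \<le> 2 * \<epsilon>" by (intro mean_le T assms)
  also note assms(3)
  finally show ?thesis by simp
qed

lemma expect_score_le:
  assumes val: "\<And>\<alpha> \<beta>. \<alpha> \<in> S \<rightarrow> S \<Longrightarrow> \<beta> \<in> S \<rightarrow> S \<Longrightarrow>
      mean S (\<lambda>y. mean S (\<lambda>z. D y z (\<alpha> y) (\<beta> z))) \<le> 1 / 3"
  shows "expect (\<lambda>Y Z rs. of_bool (\<exists>a\<in>tuples S M. \<exists>b\<in>tuples S N. 1 / 2 \<le> score Y Z rs a b)) \<le> 1 / 3"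
proof -
  have nn: "0 \<le> dev1 Y Z rs" "0 \<le> dev2 Z Y" "0 \<le> dev3 Z" for Y Z rs
    unfolding dev1_def dev2_def dev3_def using S by (simp_all add: max_deviation_nonneg)
  have "expect (\<lambda>Y Z rs. of_bool (\<exists>a\<in>tuples S M. \<exists>b\<in>tuples S N. 1 / 2 \<le> score Y Z rs a b)) \<le>
      expect (\<lambda>Y Z rs. (150 / 22) * (dev1 Y Z rs + dev2 Z Y + dev3 Z))"
  proof (intro mean_mono)
    fix Y Z rs assume YZ: "Y \<in> tuples S M" "Z \<in> tuples S N"
    show "of_bool (\<exists>a\<in>tuples S M. \<exists>b\<in>tuples S N. 1 / 2 \<le> score Y Z rs a b) \<le>
        (150 / 22) * (dev1 Y Z rs + dev2 Z Y + dev3 Z)"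
    proof (cases "\<exists>a\<in>tuples S M. \<exists>b\<in>tuples S N. 1 / 2 \<le> score Y Z rs a b")
      case True
      then obtain a b where ab: "a \<in> tuples S M" "b \<in> tuples S N" "1 / 2 \<le> score Y Z rs a b" by blast
      have "score Y Z rs a b \<le> 1 / 3 + 4 * \<epsilon> + (dev1 Y Z rs + dev2 Z Y + dev3 Z)"
        by (rule score_le[OF _ YZ ab(1,2)]) (rule val)
      \<comment> \<open>The gap is \<open>1 / 2 - 1 / 3 - 4 * \<epsilon> = 22 / 150\<close>. By
        Markov's inequality, errors of mean at most \<open>6 * \<epsilon>\<close> fill it with
        probability at most \<open>150 / 22 * (6 * \<epsilon>)\<close>, about 0.2.\<close>
      then have "22 / 150 \<le> dev1 Y Z rs + dev2 Z Y + dev3 Z" using ab(3) by linarith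
      from mult_left_mono[OF this, of "150 / 22"]
      have "1 \<le> 150 / 22 * (dev1 Y Z rs + dev2 Z Y + dev3 Z)" by simp
      then show ?thesis unfolding of_bool_def using True by (simp only: if_True)
    qed (use nn(1)[of Y Z rs] nn(2)[of Z Y] nn(3)[of Z] in simp)
  qed
  also have "\<dots> = (150 / 22) * expect (\<lambda>Y Z rs. dev1 Y Z rs + dev2 Z Y + dev3 Z)"
    by (simp only: mean_cmult)
  also have "\<dots> \<le> (150 / 22) * (6 * \<epsilon>)"
    by (intro mult_left_mono expect_devs dev1 dev2 dev3) simp
  finally show ?thesis by simp
qed

text \<open>The strategies are fixed before the sample, so the errors in \<open>Y\<close> and
  \<open>Z\<close> concern one function each; the index set \<open>{()}\<close> with
  \<open>m = 0\<close> specialises the uniform bound to this case. The gap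
  \<open>2 / 3 - 1 / 2\<close> gives the factor 6, and \<open>1 - 36 * \<epsilon> = 0.82\<close> is
  enough.\<close>

lemma expect_score_ge:
  assumes \<alpha>\<beta>: "\<alpha> \<in> S \<rightarrow> S" "\<beta> \<in> S \<rightarrow> S"
    and val: "mean S (\<lambda>y. mean S (\<lambda>z. D y z (\<alpha> y) (\<beta> z))) \<ge> 2 / 3"
  shows "expect (\<lambda>Y Z rs. of_bool (1 / 2 \<le> score Y Z rs (map \<alpha> Y) (map \<beta> Z))) \<ge> 2 / 3"
proof -
  define r where "r Z y = row Z (map \<beta> Z) y (\<alpha> y)" for Z y
  define c where "c z = column \<alpha> z (\<beta> z)" for z
  define d2 where "d2 Z = max_deviation S M {()} (\<lambda>_ _. r Z)" for Z
  define d3 where "d3 = max_deviation S N {()} (\<lambda>_ _. c)"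
  have d2: "mean (tuples S M) (d2 Z) \<le> 2 * \<epsilon>" for Z
    unfolding d2_def by (rule mean_max_deviation[OF S(1,2), where m = 0])
      (use order_trans[OF _ sizes(5), of "real (0 + 1)"] row_bounds in \<open>simp_all add: r_def\<close>)
  have d3: "mean (tuples S N) d3 \<le> 2 * \<epsilon>"
    unfolding d3_def by (rule mean_max_deviation[OF S(1,2), where m = 0])
      (use order_trans[OF _ sizes(4), of "real (0 + 1)"] column_bounds in \<open>simp_all add: c_def\<close>)
  have nn: "0 \<le> dev1 Y Z rs" "0 \<le> d2 Z Y" "0 \<le> d3 Z" for Y Z rs
    unfolding dev1_def d2_def d3_def using S by (simp_all add: max_deviation_nonneg)
  have mc: "mean S c \<ge> 2 / 3"
    unfolding c_def column_def using val by (subst mean_swap) simp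
  have T: "finite (tuples S n)" "tuples S n \<noteq> {}" "finite (tuples R n)" "tuples R n \<noteq> {}" for n
    using S R by auto
  have "expect (\<lambda>Y Z rs. 1 - 6 * (dev1 Y Z rs + d2 Z Y + d3 Z)) \<le>
      expect (\<lambda>Y Z rs. of_bool (1 / 2 \<le> score Y Z rs (map \<alpha> Y) (map \<beta> Z)))"
  proof (intro mean_mono)
    fix Y Z rs assume YZ: "Y \<in> tuples S M" "Z \<in> tuples S N"
    have ab: "(map \<alpha> Y, map \<beta> Z) \<in> tuples S M \<times> tuples S N"
      using YZ \<alpha>\<beta> by (auto simp: tuples_def)
    have e: "(\<Sum>i<M. (\<Sum>j<N. D (Y ! i) (Z ! j) (map \<alpha> Y ! i) (map \<beta> Z ! j)) / real N) = (\<Sum>i<M. r Z (Y ! i))"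
      using YZ by (intro sum.cong refl) (simp add: r_def row_def tuples_def)
    have "\<bar>deviation R (M * N) (coin Y Z (map \<alpha> Y, map \<beta> Z)) rs\<bar> \<le> dev1 Y Z rs"
      unfolding dev1_def by (rule deviation_le_max[OF _ ab]) (simp add: S)
    then have 1: "score Y Z rs (map \<alpha> Y) (map \<beta> Z) \<ge> (\<Sum>i<M. r Z (Y ! i)) / real M - dev1 Y Z rs"
      unfolding score_deviation e by linarith
    have 2: "(\<Sum>i<M. r Z (Y ! i)) / real M \<ge> mean S (r Z) - d2 Z Y"
      using deviation_le_max[of "{()}" "()" S M "\<lambda>_ _. r Z" Y] sizes(2)
      by (simp add: d2_def deviation_eq abs_le_iff)
    have "mean S (r Z) = (\<Sum>j<N. column \<alpha> (Z ! j) (map \<beta> Z ! j)) / real N"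
      unfolding r_def row_def column_def mean_sum[symmetric]
      by (simp add: mean_def sum_divide_distrib mult.commute)
    also have "\<dots> = (\<Sum>j<N. c (Z ! j)) / real N" using YZ by (simp add: c_def tuples_def)
    also have "\<dots> \<ge> mean S c - d3 Z"
      using deviation_le_max[of "{()}" "()" S N "\<lambda>_ _. c" Z] sizes(1)
      by (simp add: d3_def deviation_eq abs_le_iff)
    finally have "score Y Z rs (map \<alpha> Y) (map \<beta> Z) \<ge> 2 / 3 - (dev1 Y Z rs + d2 Z Y + d3 Z)"
      using 1 2 mc by simp
    then show "1 - 6 * (dev1 Y Z rs + d2 Z Y + d3 Z) \<le>
        of_bool (1 / 2 \<le> score Y Z rs (map \<alpha> Y) (map \<beta> Z))"
      using nn(1)[of Y Z rs] nn(2)[of Z Y] nn(3)[of Z] by auto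
  qed
  moreover have "expect (\<lambda>Y Z rs. 1 - 6 * (dev1 Y Z rs + d2 Z Y + d3 Z)) =
      1 - 6 * expect (\<lambda>Y Z rs. dev1 Y Z rs + d2 Z Y + d3 Z)"
    by (simp only: mean_diff mean_cmult mean_const[OF T(1,2)] mean_const[OF T(3,4)])
  moreover have "expect (\<lambda>Y Z rs. dev1 Y Z rs + d2 Z Y + d3 Z) \<le> 6 * \<epsilon>"
    by (intro expect_devs dev1 d2 d3)
  ultimately show ?thesis by simp
qed

end

section \<open>Comparing one prover with two\<close>

lemma pmf_bind_uniform:
  "finite S \<Longrightarrow> S \<noteq> {} \<Longrightarrow> pmf (bind_pmf (pmf_of_set S) f) c = mean S (\<lambda>s. pmf (f s) c)"
  by (simp add: pmf_bind_pmf_of_set mean_def)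

lemma pmf_verdict:
  "pmf (verdict V p ws) True =
     mean (bitstrings (poly p (length (encode ws)))) (\<lambda>r. of_bool (accepts V r (encode ws)))"
  unfolding verdict_def map_pmf_def
  by (simp add: pmf_bind_uniform accepts_def init_def of_bool_def indicator_def)

lemma accept_prob_1:
  "accept_prob 1 q p V x b =
     mean (bitstrings (poly q (length x))) (\<lambda>y. pmf (verdict V p [x, y, b 0 y]) True)"
  unfolding accept_prob_def One_nat_def replicate_pmf.simps
  by (simp add: bind_assoc_pmf bind_return_pmf pmf_bind_uniform)

lemma accept_prob_2:
  "accept_prob 2 q p V x b =
     mean (bitstrings (poly q (length x))) (\<lambda>y. mean (bitstrings (poly q (length x)))
       (\<lambda>z. pmf (verdict V p [x, y, z, b 0 y, b 1 z]) True))"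
  unfolding accept_prob_def numeral_2_eq_2 replicate_pmf.simps
  by (simp add: bind_assoc_pmf bind_return_pmf pmf_bind_uniform)

lemma card_bitstrings: "card (bitstrings n) = 2 ^ n"
  using card_lists_length_eq[of "UNIV :: bool set" n] by (simp add: bitstrings_def)

lemma mean_bitstrings_add:
  "mean (bitstrings (m + n)) f = mean (bitstrings m) (\<lambda>u. mean (bitstrings n) (\<lambda>v. f (u @ v)))"
proof -
  have "bij_betw (\<lambda>(u, v). u @ v) (bitstrings m \<times> bitstrings n) (bitstrings (m + n))"
    by (intro bij_betwI[where g = "\<lambda>w. (take m w, drop m w)"]) (auto simp: in_bitstrings)
  from mean_bij[OF this, of f] show ?thesis by (simp add: mean_Times)
qed

lemma mean_bitstrings_mult:
  "mean (bitstrings (k * m)) f = mean (tuples (bitstrings m) k) (\<lambda>us. f (concat us))"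
proof (induction k arbitrary: f)
  case 0
  have "bitstrings 0 = {[]}" by (auto simp: in_bitstrings)
  then have "mean (bitstrings 0) f = f []" for f by (simp add: mean_def)
  then show ?case by (simp add: mean_tuples_0)
next
  case (Suc k)
  then show ?case by (simp add: mean_bitstrings_add mean_tuples_Suc)
qed

text \<open>Left inverse of \<open>concat\<close> on tuples of \<open>k\<close> blocks of length
  \<open>m\<close>; it tolerates a tail, so it applies to whole challenges and padded
  answers.\<close>

definition slices :: "nat \<Rightarrow> nat \<Rightarrow> bool list \<Rightarrow> bool list list" where
  "slices m k w = map (\<lambda>i. take m (drop (i * m) w)) [0..<k]"

lemma length_concat_tuples: "us \<in> tuples (bitstrings m) k \<Longrightarrow> length (concat us) = k * m"
proof (induction us arbitrary: k)
  case (Cons u us)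
  then obtain k' where "k = Suc k'" "us \<in> tuples (bitstrings m) k'" "length u = m"
    by (cases k) (auto simp: tuples_def in_bitstrings)
  then show ?case using Cons.IH by simp
qed (simp add: tuples_def)

lemma slice_concat:
  "us \<in> tuples (bitstrings m) k \<Longrightarrow> i < k \<Longrightarrow> take m (drop (i * m) (concat us @ w)) = us ! i"
proof (induction us arbitrary: k i)
  case (Cons u us)
  then obtain k' where k': "k = Suc k'" "us \<in> tuples (bitstrings m) k'" "length u = m"
    by (cases k) (auto simp: tuples_def in_bitstrings)
  show ?case
  proof (cases i)
    case (Suc i')
    then show ?thesis using Cons.IH[OF k'(2), of i'] Cons.prems k' by simp
  qed (use k' in simp)
qed (simp add: tuples_def)

lemma slices_concat: "us \<in> tuples (bitstrings m) k \<Longrightarrow> slices m k (concat us @ w) = us"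
proof (rule nth_equalityI)
  fix i assume "us \<in> tuples (bitstrings m) k" "i < length (slices m k (concat us @ w))"
  then show "slices m k (concat us @ w) ! i = us ! i"
    using slice_concat[of us m k i w] by (simp add: slices_def)
qed (simp add: slices_def tuples_def)

lemma slices_in_tuples: "k * m \<le> length w \<Longrightarrow> slices m k w \<in> tuples (bitstrings m) k"
proof -
  assume w: "k * m \<le> length w"
  have "m \<le> length w - i * m" if "i < k" for i
  proof -
    have "Suc i * m \<le> k * m" using that by (intro mult_right_mono) auto
    then show ?thesis using w by simp
  qed
  then show ?thesis by (auto simp: slices_def tuples_def in_bitstrings)
qed

lemma cut_slice: "i < k \<Longrightarrow> h + k * m \<le> length w \<Longrightarrow> cut w (h + i * m) m = bit_syms (slices m k (drop h w) ! i)"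
proof -
  assume i: "i < k" "h + k * m \<le> length w"
  have "Suc i * m \<le> k * m" using i by (intro mult_right_mono) auto
  then show ?thesis using i by (simp add: cut_eq slices_def add.commute)
qed

lemma strategiesD: "b \<in> strategies k m \<Longrightarrow> i < k \<Longrightarrow> length y = m \<Longrightarrow> length (b i y) = m"
  unfolding strategies_def bitstrings_def by blast

context pairs
begin

text \<open>The link between program and game: on challenges of the intended length the cells read
  by the program are the blocks of the sampled tuples.\<close>

lemma hit_iff:
  assumes n: "n = length x" and L: "L = poly q n"
    and Y: "Y \<in> tuples (bitstrings L) (poly M n)" and Z: "Z \<in> tuples (bitstrings L) (poly N n)"
    and rs: "rs \<in> tuples (bitstrings (poly p n)) (poly M n * poly N n)"
    and b: "(poly M n + poly N n) * L \<le> length b" and ij: "i < poly M n" "j < poly N n"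
  shows "hit x (concat Y @ concat Z @ concat rs) b i j \<longleftrightarrow>
     accepts V (rs ! (i * poly N n + j))
       (encode [x, Y ! i, Z ! j, slices L (poly M n) b ! i, slices L (poly N n) (drop (poly M n * L) b) ! j])"
proof -
  let ?M = "poly M n" and ?N = "poly N n" and ?T = "poly p n"
  let ?y = "concat Y @ concat Z @ concat rs"
  note lens = length_concat_tuples[OF Y] length_concat_tuples[OF Z] length_concat_tuples[OF rs]
  have dY: "drop (?M * L) ?y = concat Z @ concat rs" using lens(1) by simp
  have dZ: "drop ((?M + ?N) * L) ?y = concat rs @ []" using lens(1,2) by (simp add: distrib_right)
  have t: "i * ?N + j < ?M * ?N"
  proof -
    have "Suc i * ?N \<le> ?M * ?N" using ij(1) by (intro mult_right_mono) auto
    then show ?thesis using ij(2) by simp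
  qed
  have c1: "cut ?y (i * L) L = bit_syms (Y ! i)"
    using cut_slice[OF ij(1), of 0 L ?y] lens slices_concat[OF Y] by simp
  have c2: "cut ?y ((?M + j) * L) L = bit_syms (Z ! j)"
    using cut_slice[OF ij(2), of "?M * L" L ?y] lens slices_concat[OF Z] dY by (simp add: distrib_right)
  have c3: "cut ?y ((?M + ?N) * L + (i * ?N + j) * ?T) ?T = bit_syms (rs ! (i * ?N + j))"
    using cut_slice[OF t, of "(?M + ?N) * L" ?T ?y] lens slices_concat[OF rs, of "[]"] dZ
    by (simp add: distrib_right)
  have c4: "cut b (i * L) L = bit_syms (slices L ?M b ! i)"
    using cut_slice[OF ij(1), of 0 L b] b by (simp add: distrib_right)
  have c5: "cut b ((?M + j) * L) L = bit_syms (slices L ?N (drop (?M * L) b) ! j)"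
    using cut_slice[OF ij(2), of "?M * L" L b] b by (simp add: distrib_right)
  show ?thesis
    unfolding hit_def word_def Let_def n[symmetric] L[symmetric] c1 c2 c3 c4 c5 by simp
qed

end

section \<open>The two inclusions\<close>

lemma AM_provers_2_subset: "AM_provers 2 \<subseteq> AM_provers 1"
proof
  fix L :: "bool list set" assume "L \<in> AM_provers 2"
  then obtain q p0 V where V': "poly_time_ptm (2 * 2 + 1) p0 V"
    and all: "\<forall>x. (x \<in> L \<longrightarrow> (\<exists>b \<in> strategies 2 (poly q (length x)). accept_prob 2 q p0 V x b \<ge> 2 / 3)) \<and>
      (x \<notin> L \<longrightarrow> (\<forall>b \<in> strategies 2 (poly q (length x)). accept_prob 2 q p0 V x b \<le> 1 / 3))"
    unfolding AM_provers_def by blast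
  have V: "poly_time_ptm 5 p0 V" using V' by simp
  have acc: "\<exists>b \<in> strategies 2 (poly q (length x)). accept_prob 2 q p0 V x b \<ge> 2 / 3" if "x \<in> L" for x
    using all that by blast
  have rej: "accept_prob 2 q p0 V x b \<le> 1 / 3" if "x \<notin> L" "b \<in> strategies 2 (poly q (length x))" for x b
    using all that by blast
  define U where "U = [:5, 1:] + 4 * q"
  define p where "p = pcompose p0 U"
  define W where "W = 3 * p + U"
  define K where "K = 40000 * (q + 1)"
  define N where "N = 40000 * (2 * q * K + 1)"
  define M where "M = 40000 * (q * N + 1)"
  \<comment> \<open>Exactly half of \<open>M * N\<close>, for the threshold 1/2 of the score; the
    even constant in \<open>M\<close> keeps it a polynomial over the naturals.\<close>
  define H where "H = 20000 * (q * N + 1) * N"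
  have U: "poly U n = n + 4 * poly q n + 5" for n by (simp add: U_def)
  have W: "poly W n = 3 * poly p n + poly U n" for n by (simp add: W_def)
  have wf: "wf_ptm V" using V by (simp add: poly_time_ptm_def)
  interpret pairs V q U p W M N H by unfold_locales (fact wf U W)+
  define F where "F ws = (\<exists>x y b. ws = [x, y, b] \<and>
     poly H (length x) \<le> (\<Sum>i<poly M (length x). \<Sum>j<poly N (length x). of_bool (hit x y b i j)))" for ws
  \<comment> \<open>The challenges for both provers and \<open>M * N\<close> blocks of coins.
    Answers must have the same length, so the honest strategy pads its answers with
    \<open>False\<close>.\<close>
  define q' where "q' = (M + N) * q + M * N * p"
  have "\<exists>V' T. poly_time_ptm 3 T V' \<and> (\<forall>ws. length ws = 3 \<longrightarrow> verdict V' T ws = return_pmf (F ws))"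
  proof (rule deterministic_ptm[where g = "\<lambda>\<rho>. \<rho> 13 = 0" and P = "bound l"])
    show "wf_prog (copies V + spare l) (max 4 (max (num_symbols V) (num_states V))) (run_pairs V l)"
      using wf by (intro wf_run_pairs) (auto simp: l_def)
    fix ws :: "bool list list" assume "length ws = 3"
    then obtain x y b where ws: "ws = [x, y, b]" by (auto simp: length_Suc_conv numeral_3_eq_3)
    show "wp (poly (bound l) (length (encode ws))) (run_pairs V l) (\<lambda>\<tau>. reads \<tau> 13 = 0 \<longleftrightarrow> F ws) (init_tapes ws)"
      using wp_run_pairs[OF ws refl] by (simp add: F_def ws)
  qed auto
  then obtain V' T where V': "poly_time_ptm 3 T V'"
    and verdict: "\<And>x y b. verdict V' T [x, y, b] = return_pmf (F [x, y, b])"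
    by (auto simp: numeral_3_eq_3)
  have main: "(x \<in> L \<longrightarrow> (\<exists>b \<in> strategies 1 (poly q' (length x)). accept_prob 1 q' T V' x b \<ge> 2 / 3)) \<and>
     (x \<notin> L \<longrightarrow> (\<forall>b \<in> strategies 1 (poly q' (length x)). accept_prob 1 q' T V' x b \<le> 1 / 3))" for x
  proof -
    define n m where "n = length x" and "m = poly q n"
    let ?S = "bitstrings m" and ?R = "bitstrings (poly p n)"
    define A where "A = (\<lambda>y z a b r. accepts V r (encode [x, y, z, a, b]))"
    interpret g: free_game ?S ?R A m
      by unfold_locales (simp_all add: card_bitstrings)
    have N: "poly N n = g.N" by (simp add: N_def g.N_def K_def g.\<kappa>_def flip: m_def)
    have M: "poly M n = g.M" by (simp add: M_def g.M_def N flip: m_def)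
    have H: "2 * poly H n = g.M * g.N" by (simp add: H_def g.M_def N flip: m_def)
    have q': "poly q' n = g.M * m + (g.N * m + g.M * g.N * poly p n)"
      by (simp add: q'_def M N algebra_simps flip: m_def)
    have F: "F [x, concat Y @ concat Z @ concat rs, b] \<longleftrightarrow>
        1 / 2 \<le> g.score Y Z rs (slices m g.M b) (slices m g.N (drop (g.M * m) b))"
      if "Y \<in> tuples ?S g.M" "Z \<in> tuples ?S g.N" "rs \<in> tuples ?R (g.M * g.N)"
         and b: "length b = poly q' n" for Y Z rs b
    proof -
      let ?c = "\<Sum>i<g.M. \<Sum>j<g.N. of_bool (A (Y ! i) (Z ! j) (slices m g.M b ! i)
          (slices m g.N (drop (g.M * m) b) ! j) (rs ! (i * g.N + j))) :: nat"
      have "F [x, concat Y @ concat Z @ concat rs, b] \<longleftrightarrow>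
         poly H n \<le> (\<Sum>i<g.M. \<Sum>j<g.N. of_bool (hit x (concat Y @ concat Z @ concat rs) b i j))"
        by (simp add: F_def flip: n_def M N)
      also have "(\<Sum>i<g.M. \<Sum>j<g.N. of_bool (hit x (concat Y @ concat Z @ concat rs) b i j)) = ?c"
      proof (intro sum.cong refl)
        fix i j assume ij: "i \<in> {..<g.M}" "j \<in> {..<g.N}"
        have "(g.M + g.N) * m \<le> length b" by (simp add: b q' algebra_simps)
        then show "(of_bool (hit x (concat Y @ concat Z @ concat rs) b i j) :: nat) =
            of_bool (A (Y ! i) (Z ! j) (slices m g.M b ! i)
              (slices m g.N (drop (g.M * m) b) ! j) (rs ! (i * g.N + j)))"
          using hit_iff[OF n_def m_def, of Y Z rs b i j] that ij by (simp add: A_def M N)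
      qed
      also have "poly H n \<le> ?c \<longleftrightarrow> g.M * g.N \<le> 2 * ?c" using H by linarith
      also have "\<dots> \<longleftrightarrow> real (g.M * g.N) \<le> real (2 * ?c)" by (simp only: of_nat_le_iff)
      also have "\<dots> \<longleftrightarrow> 1 / 2 \<le> g.score Y Z rs (slices m g.M b) (slices m g.N (drop (g.M * m) b))"
        unfolding g.score_def using g.sizes(1,2) by (simp add: field_simps)
      finally show ?thesis .
    qed
    have prob: "accept_prob 1 q' T V' x b =
        g.expect (\<lambda>Y Z rs. of_bool (F [x, concat Y @ concat Z @ concat rs, b 0 (concat Y @ concat Z @ concat rs)]))" for b
      unfolding accept_prob_1 n_def[symmetric] q' verdict mean_bitstrings_add mean_bitstrings_mult
      by (simp add: indicator_def of_bool_def)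
    \<comment> \<open>With challenges and answers of length \<open>m\<close>, the length of the
      encoded input depends on \<open>n\<close> alone. Hence \<open>V\<close> gets
      \<open>poly p n\<close> coins in every run and one set \<open>?R\<close> serves all.\<close>
    have D: "pmf (verdict V p0 [x, y, z, a, b]) True = g.D y z a b"
      if "length y = m" "length z = m" "length a = m" "length b = m" for y z a b
    proof -
      have "length (encode [x, y, z, a, b]) = poly U n"
        using that by (simp add: U m_def flip: n_def)
      then have "poly p0 (length (encode [x, y, z, a, b])) = poly p n"
        by (simp only: p_def poly_pcompose)
      then show ?thesis unfolding pmf_verdict g.D_def by (simp only: A_def)
    qed
    have len: "length (concat Y @ concat Z @ concat rs) = poly q' n"
      if "Y \<in> tuples ?S g.M" "Z \<in> tuples ?S g.N" "rs \<in> tuples ?R (g.M * g.N)" for Y Z rs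
      using that[THEN length_concat_tuples] by (simp add: q')
    have "\<exists>b \<in> strategies 1 (poly q' n). accept_prob 1 q' T V' x b \<ge> 2 / 3" if xL: "x \<in> L"
    proof -
      obtain b where b: "b \<in> strategies 2 m" "accept_prob 2 q p0 V x b \<ge> 2 / 3"
        using acc[OF xL] by (auto simp: m_def n_def)
      have bS: "b 0 \<in> ?S \<rightarrow> ?S" "b 1 \<in> ?S \<rightarrow> ?S" using b(1) by (auto simp: strategies_def)
      have "accept_prob 2 q p0 V x b = mean ?S (\<lambda>y. mean ?S (\<lambda>z. g.D y z (b 0 y) (b 1 z)))"
        unfolding accept_prob_2 n_def[symmetric] m_def[symmetric] using strategiesD[OF b(1)]
        by (intro mean_cong D) (auto simp: in_bitstrings)
      then have val: "g.expect (\<lambda>Y Z rs. of_bool (1 / 2 \<le> g.score Y Z rs (map (b 0) Y) (map (b 1) Z))) \<ge> 2 / 3"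
        using b(2) by (intro g.expect_score_ge bS) simp
      define b' where "b' (i :: nat) y = concat (map (b 0) (slices m g.M y)) @
         concat (map (b 1) (slices m g.N (drop (g.M * m) y))) @ replicate (g.M * g.N * poly p n) False" for i y
      have tup: "map \<alpha> Y \<in> tuples ?S k" if "\<alpha> \<in> ?S \<rightarrow> ?S" "Y \<in> tuples ?S k" for \<alpha> Y k
        using that by (auto simp: tuples_def)
      have lb: "length (b' i y) = poly q' n" if "length y = poly q' n" for i y
      proof -
        have "slices m g.M y \<in> tuples ?S g.M" "slices m g.N (drop (g.M * m) y) \<in> tuples ?S g.N"
          using that q' by (auto intro!: slices_in_tuples)
        from tup[OF bS(1) this(1)] tup[OF bS(2) this(2)] show ?thesis
          by (simp add: b'_def length_concat_tuples q')
      qed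
      have "accept_prob 1 q' T V' x b' =
         g.expect (\<lambda>Y Z rs. of_bool (1 / 2 \<le> g.score Y Z rs (map (b 0) Y) (map (b 1) Z)))"
        unfolding prob
      proof (intro mean_cong)
        fix Y Z rs assume YZ: "Y \<in> tuples ?S g.M" "Z \<in> tuples ?S g.N" "rs \<in> tuples ?R (g.M * g.N)"
        let ?y = "concat Y @ concat Z @ concat rs"
        have "slices m g.M ?y = Y" by (rule slices_concat[OF YZ(1)])
        moreover have "slices m g.N (drop (g.M * m) ?y) = Z"
          using slices_concat[OF YZ(2)] length_concat_tuples[OF YZ(1)] by simp
        ultimately have b'y: "b' 0 ?y = concat (map (b 0) Y) @ concat (map (b 1) Z) @
            replicate (g.M * g.N * poly p n) False" by (simp add: b'_def)
        have 1: "slices m g.M (b' 0 ?y) = map (b 0) Y"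
          unfolding b'y by (rule slices_concat[OF tup[OF bS(1) YZ(1)]])
        have 2: "slices m g.N (drop (g.M * m) (b' 0 ?y)) = map (b 1) Z"
          unfolding b'y using slices_concat[OF tup[OF bS(2) YZ(2)]] length_concat_tuples[OF tup[OF bS(1) YZ(1)]]
          by simp
        show "of_bool (F [x, ?y, b' 0 ?y]) =
            of_bool (1 / 2 \<le> g.score Y Z rs (map (b 0) Y) (map (b 1) Z))"
          using F[OF YZ lb[OF len[OF YZ], of 0]] by (simp only: 1 2)
      qed
      moreover have "b' \<in> strategies 1 (poly q' n)"
        using lb by (auto simp: strategies_def in_bitstrings)
      ultimately show ?thesis using val by (intro bexI[of _ b']) (simp_all only:)
    qed
    moreover have "accept_prob 1 q' T V' x b \<le> 1 / 3"
      if "x \<notin> L" and b: "b \<in> strategies 1 (poly q' n)" for b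
    proof -
      have "accept_prob 1 q' T V' x b \<le>
        g.expect (\<lambda>Y Z rs. of_bool (\<exists>a\<in>tuples ?S g.M. \<exists>b\<in>tuples ?S g.N. 1 / 2 \<le> g.score Y Z rs a b))"
        unfolding prob
      proof (intro mean_mono)
        fix Y Z rs assume YZ: "Y \<in> tuples ?S g.M" "Z \<in> tuples ?S g.N" "rs \<in> tuples ?R (g.M * g.N)"
        let ?w = "b 0 (concat Y @ concat Z @ concat rs)"
        have w: "length ?w = poly q' n" using strategiesD[OF b _ len[OF YZ]] by simp
        have "slices m g.M ?w \<in> tuples ?S g.M" "slices m g.N (drop (g.M * m) ?w) \<in> tuples ?S g.N"
          using w q' by (auto intro!: slices_in_tuples)
        then show "of_bool (F [x, concat Y @ concat Z @ concat rs, ?w]) \<le>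
            (of_bool (\<exists>a\<in>tuples ?S g.M. \<exists>b\<in>tuples ?S g.N. 1 / 2 \<le> g.score Y Z rs a b) :: real)"
          using F[OF YZ w] by auto
      qed
      also have "\<dots> \<le> 1 / 3"
      proof (rule g.expect_score_le)
        fix \<alpha> \<beta> assume \<alpha>\<beta>: "\<alpha> \<in> ?S \<rightarrow> ?S" "\<beta> \<in> ?S \<rightarrow> ?S"
        define b2 where "b2 i = (if i = (0 :: nat) then \<alpha> else \<beta>)" for i
        have b2: "b2 \<in> strategies 2 m" using \<alpha>\<beta> by (simp add: strategies_def b2_def)
        have "mean ?S (\<lambda>y. mean ?S (\<lambda>z. g.D y z (\<alpha> y) (\<beta> z))) = accept_prob 2 q p0 V x b2"
          unfolding accept_prob_2 n_def[symmetric] m_def[symmetric] using \<alpha>\<beta>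
          by (intro mean_cong, subst D) (auto simp: in_bitstrings b2_def Pi_iff)
        also have "\<dots> \<le> 1 / 3" using rej[OF that(1)] b2 by (simp add: m_def n_def)
        finally show "mean ?S (\<lambda>y. mean ?S (\<lambda>z. g.D y z (\<alpha> y) (\<beta> z))) \<le> 1 / 3" .
      qed
      finally show ?thesis .
    qed
    ultimately show ?thesis by (simp add: n_def)
  qed
  have "poly_time_ptm (2 * 1 + 1) T V'" using V' by simp
  then show "L \<in> AM_provers 1" unfolding AM_provers_def using main by blast
qed

text \<open>The second prover is ignored; the challenge sent to it supplies the coins of the original
  verifier.\<close>

lemma AM_provers_1_subset: "AM_provers 1 \<subseteq> AM_provers 2"
proof
  fix L :: "bool list set" assume "L \<in> AM_provers 1"
  then obtain q p0 V where V': "poly_time_ptm (2 * 1 + 1) p0 V"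
    and all: "\<forall>x. (x \<in> L \<longrightarrow> (\<exists>b \<in> strategies 1 (poly q (length x)). accept_prob 1 q p0 V x b \<ge> 2 / 3)) \<and>
      (x \<notin> L \<longrightarrow> (\<forall>b \<in> strategies 1 (poly q (length x)). accept_prob 1 q p0 V x b \<le> 1 / 3))"
    unfolding AM_provers_def by blast
  have V: "poly_time_ptm 3 p0 V" using V' by simp
  have acc: "\<exists>b \<in> strategies 1 (poly q (length x)). accept_prob 1 q p0 V x b \<ge> 2 / 3" if "x \<in> L" for x
    using all that by blast
  have rej: "accept_prob 1 q p0 V x b \<le> 1 / 3" if "x \<notin> L" "b \<in> strategies 1 (poly q (length x))" for x b
    using all that by blast
  define U where "U = [:3, 1:] + 2 * q"
  define p where "p = pcompose p0 U"
  define W where "W = 3 * p + U"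
  define l :: "(nat \<times> nat poly) list" where "l = [(7, q), (8, U), (9, p), (10, W), (13, 1)]"
  have U: "poly U n = n + 2 * poly q n + 3" for n by (simp add: U_def)
  have W: "poly W n = 3 * poly p n + poly U n" for n by (simp add: W_def)
  have wf: "wf_ptm V" using V by (simp add: poly_time_ptm_def)
  define F where "F ws = (\<exists>x y1 y2 b1 b2. ws = [x, y1, y2, b1, b2] \<and>
     accepts V (bits_of (cut y2 0 (poly p (length x))))
       (bit_syms x @ [3] @ cut y1 0 (poly q (length x)) @ [3] @ cut b1 0 (poly q (length x)) @ [3]))" for ws
  \<comment> \<open>Both challenges share one length: the first has to contain \<open>q\<close> bits
    for the prover, the second \<open>p\<close> bits of coins.\<close>
  define q' where "q' = q + p"
  have "\<exists>V' T. poly_time_ptm 5 T V' \<and> (\<forall>ws. length ws = 5 \<longrightarrow> verdict V' T ws = return_pmf (F ws))"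
  proof (rule deterministic_ptm[where g = "\<lambda>\<rho>. \<rho> 13 = 0" and P = "bound l"])
    show "wf_prog (copies V + spare l) (max 4 (max (num_symbols V) (num_states V))) (run_once V l)"
      using wf by (intro wf_run_once) (auto simp: l_def)
    fix ws :: "bool list list" assume "length ws = 5"
    then obtain x y1 y2 b1 b2 where ws: "ws = [x, y1, y2, b1, b2]"
      by (auto simp: length_Suc_conv eval_nat_numeral)
    show "wp (poly (bound l) (length (encode ws))) (run_once V l) (\<lambda>\<tau>. reads \<tau> 13 = 0 \<longleftrightarrow> F ws) (init_tapes ws)"
      using wp_run_once[OF wf l_def U W ws] by (simp add: F_def ws)
  qed auto
  then obtain V' T where V': "poly_time_ptm 5 T V'"
    and verdict: "\<And>x y1 y2 b1 b2. verdict V' T [x, y1, y2, b1, b2] = return_pmf (F [x, y1, y2, b1, b2])"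
    by (auto simp: eval_nat_numeral)
  have main: "(x \<in> L \<longrightarrow> (\<exists>b \<in> strategies 2 (poly q' (length x)). accept_prob 2 q' T V' x b \<ge> 2 / 3)) \<and>
     (x \<notin> L \<longrightarrow> (\<forall>b \<in> strategies 2 (poly q' (length x)). accept_prob 2 q' T V' x b \<le> 1 / 3))" for x
  proof -
    define n m t where "n = length x" and "m = poly q n" and "t = poly p n"
    have q': "poly q' n = m + t" by (simp add: q'_def m_def t_def)
    have prob1: "accept_prob 1 q p0 V x b =
        mean (bitstrings m) (\<lambda>u. mean (bitstrings t) (\<lambda>c. of_bool (accepts V c (encode [x, u, b 0 u]))))"
      if b: "b \<in> strategies 1 m" for b
      unfolding accept_prob_1 n_def[symmetric] m_def[symmetric]
    proof (intro mean_cong)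
      fix u assume u: "u \<in> bitstrings m"
      have "length (b 0 u) = m" using strategiesD[OF b] u by (simp add: in_bitstrings)
      then have "length (encode [x, u, b 0 u]) = poly U n"
        using u by (simp add: U in_bitstrings m_def flip: n_def)
      then show "pmf (verdict V p0 [x, u, b 0 u]) True =
          mean (bitstrings t) (\<lambda>c. of_bool (accepts V c (encode [x, u, b 0 u])))"
        by (simp only: pmf_verdict p_def poly_pcompose t_def)
    qed
    \<comment> \<open>The coins \<open>c\<close> are taken from the second challenge and so are
      independent of the first answer. The surplus \<open>v\<close> of the first challenge is
      averaged outermost: each fixed \<open>v\<close> leaves a play of the one-prover game.\<close>
    have prob2: "accept_prob 2 q' T V' x b =
        mean (bitstrings t) (\<lambda>v. mean (bitstrings m) (\<lambda>u. mean (bitstrings t)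
          (\<lambda>c. of_bool (accepts V c (encode [x, u, take m (b 0 (u @ v))])))))"
      if b: "b \<in> strategies 2 (m + t)" for b
    proof -
      have split: "mean (bitstrings (m + t)) f = mean (bitstrings t) (\<lambda>c. mean (bitstrings m) (\<lambda>d. f (c @ d)))" for f
        using mean_bitstrings_add[of t m f] by (simp add: add.commute)
      have "accept_prob 2 q' T V' x b = mean (bitstrings (m + t)) (\<lambda>y. mean (bitstrings (m + t))
          (\<lambda>z. of_bool (F [x, y, z, b 0 y, b 1 z])))"
        unfolding accept_prob_2 verdict n_def[symmetric] q' by (simp add: indicator_def of_bool_def)
      also have "\<dots> = mean (bitstrings (m + t)) (\<lambda>y. mean (bitstrings t) (\<lambda>c. mean (bitstrings m)
          (\<lambda>d. of_bool (F [x, y, c @ d, b 0 y, b 1 (c @ d)]))))"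
        by (intro mean_cong split)
      also have "\<dots> = mean (bitstrings m) (\<lambda>u. mean (bitstrings t) (\<lambda>v.
          mean (bitstrings t) (\<lambda>c. mean (bitstrings m) (\<lambda>d.
            of_bool (F [x, u @ v, c @ d, b 0 (u @ v), b 1 (c @ d)])))))"
        by (rule mean_bitstrings_add)
      also have "\<dots> = mean (bitstrings m) (\<lambda>u. mean (bitstrings t) (\<lambda>v.
          mean (bitstrings t) (\<lambda>c. mean (bitstrings m) (\<lambda>d.
            of_bool (accepts V c (encode [x, u, take m (b 0 (u @ v))]))))))"
      proof (intro mean_cong)
        fix u v c d assume uv: "u \<in> bitstrings m" "v \<in> bitstrings t" "c \<in> bitstrings t" "d \<in> bitstrings m"
        have "length (b 0 (u @ v)) = m + t" using strategiesD[OF b] uv by (simp add: in_bitstrings)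
        then show "of_bool (F [x, u @ v, c @ d, b 0 (u @ v), b 1 (c @ d)]) =
            of_bool (accepts V c (encode [x, u, take m (b 0 (u @ v))]))"
          using uv by (simp add: F_def cut_eq in_bitstrings flip: n_def m_def t_def)
      qed
      also have "\<dots> = mean (bitstrings m) (\<lambda>u. mean (bitstrings t) (\<lambda>v.
          mean (bitstrings t) (\<lambda>c. of_bool (accepts V c (encode [x, u, take m (b 0 (u @ v))])))))"
        by (simp add: mean_const)
      finally show ?thesis by (simp only: mean_swap[of "bitstrings m" "bitstrings t"])
    qed
    have "\<exists>b \<in> strategies 2 (m + t). accept_prob 2 q' T V' x b \<ge> 2 / 3" if xL: "x \<in> L"
    proof -
      obtain b where b: "b \<in> strategies 1 m" "accept_prob 1 q p0 V x b \<ge> 2 / 3"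
        using acc[OF xL] by (auto simp: m_def n_def)
      define b' where "b' (i :: nat) y = b 0 (take m y) @ replicate t False" for i y
      have lb: "length (b 0 y) = m" if "length y = m" for y using strategiesD[OF b(1)] that by simp
      have b': "b' \<in> strategies 2 (m + t)"
        using lb by (auto simp: strategies_def in_bitstrings b'_def)
      have "accept_prob 2 q' T V' x b' = mean (bitstrings t) (\<lambda>v. accept_prob 1 q p0 V x b)"
        unfolding prob2[OF b'] prob1[OF b(1)]
        by (intro mean_cong) (simp add: b'_def in_bitstrings lb)
      then show ?thesis using b(2) b' by (intro bexI[of _ b']) (simp_all add: mean_const)
    qed
    moreover have "accept_prob 2 q' T V' x b \<le> 1 / 3"
      if "x \<notin> L" and b: "b \<in> strategies 2 (m + t)" for b
      unfolding prob2[OF b]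
    proof (rule mean_le[OF finite_bitstrings bitstrings_nonempty])
      fix v assume v: "v \<in> bitstrings t"
      \<comment> \<open>For fixed \<open>v\<close> the first prover's answers, cut to length
        \<open>m\<close>, form a one-prover strategy.\<close>
      define b1 where "b1 (i :: nat) u = take m (b 0 (u @ v))" for i u
      have b1: "b1 \<in> strategies 1 m"
        using strategiesD[OF b] v by (auto simp: strategies_def in_bitstrings b1_def)
      show "mean (bitstrings m) (\<lambda>u. mean (bitstrings t)
          (\<lambda>c. of_bool (accepts V c (encode [x, u, take m (b 0 (u @ v))])))) \<le> 1 / 3"
        using rej[OF that(1), of b1] b1 prob1[OF b1] by (simp add: b1_def m_def n_def)
    qed
    ultimately show ?thesis by (simp add: q' flip: n_def)
  qed
  have "poly_time_ptm (2 * 2 + 1) T V'" using V' by simp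
  then show "L \<in> AM_provers 2" unfolding AM_provers_def using main by blast
qed

theorem theorem47:
  shows "AM_provers 2 = AM"
  unfolding AM_def using AM_provers_1_subset AM_provers_2_subset by blast

end
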